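(* Let $n>1$, $m\ge1$, and let $X=X_1\times\cdots\times X_m$ with coordinates $x_i^{(r)}\in\mathbb{C}^*$, $1\le i\le m$, $r\in\mathbb{Z}/n\mathbb{Z}$, with $S_m$ acting on the field of rational functions $\mathbb{C}(X)$ by the birational $R$-matrix action. Then $$\mathbb{C}(X)^{S_m}=\mathbb{C}\big(e_r^{(s)}\big),$$ the subfield generated over $\mathbb{C}$ by the loop elementary symmetric functions $e_r^{(s)}(x_1,\dots,x_m)$, $1\le r\le m$, $s\in\mathbb{Z}/n\mathbb{Z}$. In particular, these $mn$ functions $e_r^{(s)}$ are algebraically independent. Moreover, the map $X\to U^{\le m}$ given by $$(x_1,\dots,x_m)\longmapsto M(x_1)M(x_2)\cdots M(x_m)$$ identifies (via pullback of functions) the ring $\mathrm{LSym}_m=\mathbb{C}[e_r^{(s)}]$ with the coordinate ring $\mathbb{C}[U^{\le m}]$.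
   Context: Upper indices are always taken modulo $n$. Each $X_i\simeq(\mathbb{C}^* )^n$ and $x_i=(x_i^{(r)})_{r\in\mathbb{Z}/n\mathbb{Z}}$. **Birational $R$-matrix action.** Let $$\kappa_r(x_j,x_{j+1})=\sum_{s=0}^{n-1}\Big(\prod_{t=1}^{s}x_{j+1}^{(r+t)}\prod_{t=s+1}^{n-1}x_j^{(r+t)}\Big).$$ The group $S_m$ acts on $\mathbb{C}(X)$ by field automorphisms over $\mathbb{C}$, the simple transposition $s_j$ ($1\le j\le m-1$) acting by $$s_j(x_j^{(r)})=\frac{x_{j+1}^{(r+1)}\kappa_{r+1}(x_j,x_{j+1})}{\kappa_r(x_j,x_{j+1})},\qquad s_j(x_{j+1}^{(r)})=\frac{x_j^{(r-1)}\kappa_{r-1}(x_j,x_{j+1})}{\kappa_r(x_j,x_{j+1})},$$ and $s_j(x_k^{(r)})=x_k^{(r)}$ for $k\neq j,j+1$. **Loop elementary symmetric functions.** For $r\ge1$ and $s\in\mathbb{Z}/n\mathbb{Z}$, $$e_r^{(s)}(x_1,\dots,x_m)=\sum_{1\le i_1<i_2<\cdots<i_r\le m}x_{i_1}^{(s)}x_{i_2}^{(s+1)}\cdots x_{i_r}^{(s+r-1)},$$ with $e_0^{(s)}=1$ and $e_r^{(s)}=0$ for $r<0$. $\mathrm{LSym}_m\subset\mathbb{C}[X]$ is the ring ($\mathbb{C}$-algebra) generated by the $e_r^{(s)}$. **Whirls and $U^{\le m}$.** An element $g=(g_{ij})$ of $GL_n(\mathbb{C}((t)))$ with $g_{ij}=\sum_k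 g_{ij}^kt^k$ is identified with the infinite periodic matrix $Y=(y_{rs})_{r,s\in\mathbb{Z}}$, $y_{i+kn,j+k'n}=g_{ij}^{k'-k}$ ($1\le i,j\le n$). $U$ is the group of such $Y$ that are upper triangular with $1$'s on the main diagonal, and $U^{\le m}\subset U$ consists of those with $y_{ij}=0$ for $j-i>m$; thus $U^{\le m}\simeq\mathbb{C}^{mn}$ with coordinates $y_{s,s+r}$ ($s\in\mathbb{Z}/n\mathbb{Z}$, $1\le r\le m$). For $x=(x^{(1)},\dots,x^{(n)})$, the whirl $M(x)\in U$ is the infinite periodic matrix with $M(x)_{i,i}=1$, $M(x)_{i,i+1}=x^{(i)}$, and all other entries $0$. *)

theory Defs
  imports
    Complex_Main
    "HOL-Library.Poly_Mapping"
    "HOL-Library.FuncSet"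
    "HOL-Library.Nat_Bijection"
    "HOL-Computational_Algebra.Polynomial_Factorial"
    "HOL-Combinatorics.Transposition"
    "HOL-Algebra.QuotRing"
    "HOL-Algebra.Group_Action"
    "HOL-Algebra.Sym_Groups"
begin

text \<open>
  A family \<open>x = (x_i^(r))\<close> is a function \<open>x\<close> with \<open>x i r\<close> standing for \<open>x_i^(r)\<close>.  Lower indices
  are natural numbers in \<open>{1..m}\<close>.  Upper indices are integers, and all families used below are
  \<open>n\<close>-periodic in the upper index, which expresses \<open>r \<in> Z/nZ\<close>.  The formulas for \<open>kappa\<close>,
  \<open>loop_e\<close> and \<open>whirl\<close> are used both for elements of the rational function field and for complex
  points, hence the polymorphic types.
\<close>

definition kappa :: "nat \<Rightarrow> (int \<Rightarrow> 'a::comm_ring_1) \<Rightarrow> (int \<Rightarrow> 'a) \<Rightarrow> int \<Rightarrow> 'a" where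
  "kappa n x y r =
     (\<Sum>s=0..n - 1. (\<Prod>t=1..s. y (r + int t)) * (\<Prod>t=s + 1..n - 1. x (r + int t)))"

text \<open>
  The summation is over strictly increasing sequences \<open>i_1 < ... < i_r\<close> in \<open>{1..m}\<close>, listed from
  position \<open>0\<close>.
\<close>

definition loop_e :: "nat \<Rightarrow> (nat \<Rightarrow> int \<Rightarrow> 'a::comm_ring_1) \<Rightarrow> nat \<Rightarrow> int \<Rightarrow> 'a" where
  "loop_e m x r s =
     (\<Sum>is\<in>{is. length is = r \<and> sorted_wrt (<) is \<and> set is \<subseteq> {1..m}}.
        \<Prod>k<r. x (is ! k) (s + int k))"

section \<open>The field of rational functions\<close>

type_synonym 'v cpoly = "('v \<Rightarrow>\<^sub>0 nat) \<Rightarrow>\<^sub>0 complex"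

text \<open>
  Rational functions over the complex numbers in countably many variables numbered by natural
  numbers; the variable \<open>x_i^(r)\<close> has number \<open>prod_encode (i, r mod n)\<close>.  The function field of
  \<open>X\<close> is the subfield \<open>ratfun_field n m\<close> generated by the \<open>mn\<close> variables that occur in \<open>X\<close>.
\<close>

type_synonym ratfun = "nat cpoly fract"

definition const_rf :: "complex \<Rightarrow> ratfun" where
  "const_rf c = to_fract (Poly_Mapping.single 0 c)"

definition var_rf :: "nat \<Rightarrow> ratfun" where
  "var_rf v = to_fract (Poly_Mapping.single (Poly_Mapping.single v 1) 1)"

definition coord :: "nat \<Rightarrow> nat \<Rightarrow> int \<Rightarrow> ratfun" where
  "coord n i r = var_rf (prod_encode (i, nat (r mod int n)))"

definition complex_subfield :: "ratfun set \<Rightarrow> bool" where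
  "complex_subfield K \<longleftrightarrow>
     range const_rf \<subseteq> K \<and>
     (\<forall>f\<in>K. \<forall>g\<in>K. f + g \<in> K \<and> f * g \<in> K) \<and>
     (\<forall>f\<in>K. - f \<in> K \<and> inverse f \<in> K)"

definition complex_adjoin :: "ratfun set \<Rightarrow> ratfun set" where
  "complex_adjoin S = \<Inter>{K. complex_subfield K \<and> S \<subseteq> K}"

definition ratfun_field :: "nat \<Rightarrow> nat \<Rightarrow> ratfun set" where
  "ratfun_field n m = complex_adjoin {coord n i r | i r. i \<in> {1..m}}"

definition eval_cpoly :: "('v \<Rightarrow> ratfun) \<Rightarrow> 'v cpoly \<Rightarrow> ratfun" where
  "eval_cpoly f p =
     (\<Sum>a\<in>Poly_Mapping.keys p. const_rf (Poly_Mapping.lookup p a) *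
        (\<Prod>v\<in>Poly_Mapping.keys a. f v ^ Poly_Mapping.lookup a v))"

definition algebraically_independent :: "('v \<Rightarrow> ratfun) \<Rightarrow> 'v set \<Rightarrow> bool" where
  "algebraically_independent f I \<longleftrightarrow>
     (\<forall>p. (\<forall>a\<in>Poly_Mapping.keys p. Poly_Mapping.keys a \<subseteq> I) \<longrightarrow> eval_cpoly f p = 0 \<longrightarrow> p = 0)"

section \<open>The birational R-matrix action\<close>

text \<open>
  Bijectivity of each \<open>act w\<close> on the field is part of \<open>group_action\<close>, so the second conjunct makes
  \<open>act w\<close> a field automorphism over the complex numbers.
\<close>

definition birational_R_action ::
    "nat \<Rightarrow> nat \<Rightarrow> ((nat \<Rightarrow> nat) \<Rightarrow> ratfun \<Rightarrow> ratfun) \<Rightarrow> bool" where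
  "birational_R_action n m act \<longleftrightarrow>
     group_action (sym_group m) (ratfun_field n m) act \<and>
     (\<forall>w\<in>carrier (sym_group m).
        (\<forall>c. act w (const_rf c) = const_rf c) \<and>
        (\<forall>f\<in>ratfun_field n m. \<forall>g\<in>ratfun_field n m.
           act w (f + g) = act w f + act w g \<and> act w (f * g) = act w f * act w g)) \<and>
     (\<forall>j\<in>{1..<m}. let x = coord n; \<kappa> = kappa n (x j) (x (j + 1)); s = transpose j (j + 1) in
        \<forall>r. act s (x j r) = x (j + 1) (r + 1) * \<kappa> (r + 1) / \<kappa> r \<and>
            act s (x (j + 1) r) = x j (r - 1) * \<kappa> (r - 1) / \<kappa> r \<and>
            (\<forall>k\<in>{1..m} - {j, j + 1}. act s (x k r) = x k r))"

definition invariant_field ::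
    "nat \<Rightarrow> nat \<Rightarrow> ((nat \<Rightarrow> nat) \<Rightarrow> ratfun \<Rightarrow> ratfun) \<Rightarrow> ratfun set" where
  "invariant_field n m act =
     {f \<in> ratfun_field n m. \<forall>w\<in>carrier (sym_group m). act w f = f}"

section \<open>Rings of functions on varieties\<close>

text \<open>Functions on a set \<open>S\<close> of points are extensional: they are \<open>undefined\<close> outside \<open>S\<close>.\<close>

inductive_set generated_algebra :: "'p set \<Rightarrow> ('p \<Rightarrow> complex) set \<Rightarrow> ('p \<Rightarrow> complex) set"
  for S :: "'p set" and G :: "('p \<Rightarrow> complex) set"
where
  const: "(\<lambda>p\<in>S. c) \<in> generated_algebra S G"
| gen: "g \<in> G \<Longrightarrow> restrict g S \<in> generated_algebra S G"
| add: "f \<in> generated_algebra S G \<Longrightarrow> g \<in> generated_algebra S G \<Longrightarrow>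
        (\<lambda>p\<in>S. f p + g p) \<in> generated_algebra S G"
| mult: "f \<in> generated_algebra S G \<Longrightarrow> g \<in> generated_algebra S G \<Longrightarrow>
        (\<lambda>p\<in>S. f p * g p) \<in> generated_algebra S G"

definition function_ring :: "'p set \<Rightarrow> ('p \<Rightarrow> complex) set \<Rightarrow> ('p \<Rightarrow> complex) ring" where
  "function_ring S G =
     \<lparr>carrier = generated_algebra S G,
      mult = (\<lambda>f g. \<lambda>p\<in>S. f p * g p), one = (\<lambda>p\<in>S. 1),
      zero = (\<lambda>p\<in>S. 0), add = (\<lambda>f g. \<lambda>p\<in>S. f p + g p)\<rparr>"

text \<open>The complex points of \<open>X = X_1 \<times> ... \<times> X_m\<close>, each factor being \<open>(C^*)^n\<close>.\<close>

definition X_space :: "nat \<Rightarrow> nat \<Rightarrow> (nat \<Rightarrow> int \<Rightarrow> complex) set" where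
  "X_space n m = (\<Pi>\<^sub>E i\<in>{1..m}. {u. \<forall>r. u r \<noteq> 0 \<and> u (r + int n) = u r})"

definition LSym :: "nat \<Rightarrow> nat \<Rightarrow> ((nat \<Rightarrow> int \<Rightarrow> complex) \<Rightarrow> complex) ring" where
  "LSym n m = function_ring (X_space n m) {(\<lambda>x. loop_e m x r s) | r s. r \<ge> 1}"

section \<open>Whirls\<close>

type_synonym 'a infmat = "int \<Rightarrow> int \<Rightarrow> 'a"

text \<open>
  Multiplication of upper triangular infinite matrices; only indices \<open>k\<close> with \<open>i \<le> k \<le> j\<close>
  contribute to the \<open>(i,j)\<close> entry.
\<close>

definition infmat_mult :: "'a::comm_ring_1 infmat \<Rightarrow> 'a infmat \<Rightarrow> 'a infmat" where
  "infmat_mult A B = (\<lambda>i j. \<Sum>k=i..j. A i k * B k j)"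

definition infmat_one :: "'a::comm_ring_1 infmat" where
  "infmat_one = (\<lambda>i j. if i = j then 1 else 0)"

definition whirl :: "(int \<Rightarrow> 'a::comm_ring_1) \<Rightarrow> 'a infmat" where
  "whirl u = (\<lambda>i j. if j = i then 1 else if j = i + 1 then u i else 0)"

definition whirl_product :: "nat \<Rightarrow> (nat \<Rightarrow> int \<Rightarrow> 'a::comm_ring_1) \<Rightarrow> 'a infmat" where
  "whirl_product m x = foldr (\<lambda>i A. infmat_mult (whirl (x i)) A) [1..<m + 1] infmat_one"

text \<open>
  An \<open>n\<close>-periodic upper unitriangular matrix always comes from an element of \<open>GL_n(C((t)))\<close>: its
  entries are power series and it is invertible, being unitriangular at \<open>t = 0\<close>.  Hence no
  further condition is needed to describe \<open>U\<close>.
\<close>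

definition U_group :: "nat \<Rightarrow> complex infmat set" where
  "U_group n = {Y. (\<forall>i j. Y (i + int n) (j + int n) = Y i j) \<and>
                   (\<forall>i j. j < i \<longrightarrow> Y i j = 0) \<and> (\<forall>i. Y i i = 1)}"

definition U_le :: "nat \<Rightarrow> nat \<Rightarrow> complex infmat set" where
  "U_le n m = {Y \<in> U_group n. \<forall>i j. j - i > int m \<longrightarrow> Y i j = 0}"

text \<open>
  The coordinate ring of the affine space \<open>U_le n m\<close>: polynomial functions in the coordinates
  \<open>y_{s,s+r}\<close>, \<open>1 \<le> r \<le> m\<close>.
\<close>

definition U_coordinate_ring :: "nat \<Rightarrow> nat \<Rightarrow> (complex infmat \<Rightarrow> complex) ring" where
  "U_coordinate_ring n m =
     function_ring (U_le n m) {(\<lambda>Y. Y s (s + int r)) | r s. r \<in> {1..m}}"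

definition pullback :: "'p set \<Rightarrow> ('p \<Rightarrow> 'q) \<Rightarrow> ('q \<Rightarrow> complex) \<Rightarrow> 'p \<Rightarrow> complex" where
  "pullback S \<Phi> f = (\<lambda>p\<in>S. f (\<Phi> p))"

end

theory Submission
  imports Defs
begin

text \<open>
  Write \<open>K\<close> for the field generated by the loop elementary symmetric functions, \<open>L\<close> for the field of
  rational functions on \<open>X\<close>, and \<open>l_i = (-1)^n / (x_i^(1) ... x_i^(n))\<close> for the multiplier of the
  \<open>i\<close>-th factor.  The loop elementary symmetric functions are the entries of the product
  \<open>Y = M(x_1) ... M(x_m)\<close>, so \<open>Y\<close> acts as a recurrence operator on sequences.  A sequence killed by
  the single whirl \<open>M(x_i)\<close> satisfies \<open>v(k + n) = l_i v(k)\<close>; hence \<open>Y\<close> behaves like a polynomial that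
  has been split into linear factors, with the \<open>l_i\<close> as its roots.

  The multipliers determine the factors: the sequences killed by \<open>Y\<close> on which the shift by \<open>n\<close> acts
  as \<open>l_m\<close> form a line, that line is defined over \<open>K(l_m)\<close>, and \<open>x_m\<close> can be read off from it
  (\<open>factors_mem\<close>).  So \<open>L = K(l_1, ..., l_m)\<close>.  Moreover the shift by \<open>n\<close> on the kernel of \<open>Y\<close> has
  characteristic polynomial \<open>(T - l_1) ... (T - l_m)\<close>, which yields a monic polynomial of degree \<open>m\<close>
  over \<open>K\<close> with root \<open>l_m\<close> (\<open>multiplier_integral_equation\<close>).

  The birational R-matrix \<open>s_j\<close> keeps \<open>M(x_j) M(x_(j+1))\<close> and exchanges \<open>l_j\<close> and \<open>l_(j+1)\<close>.  It is
  an involution, which makes the substitution injective on polynomials and extends it to \<open>L\<close>.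
  Since \<open>L\<close> is generated by \<open>K\<close> and the \<open>l_i\<close>, an endomorphism of \<open>L\<close> over \<open>K\<close> is determined by
  the permutation of the \<open>l_i\<close> that it induces (\<open>lifts_unique\<close>); this gives an action of the whole
  symmetric group, with the Coxeter relations coming for free.  Finally the extension \<open>L\<close> of \<open>K\<close> is
  obtained by adjoining the \<open>m\<close> distinct roots of a polynomial of degree \<open>m\<close> that are permuted
  arbitrarily, so an invariant element descends through the tower
  \<open>K(l_1, ..., l_i)\<close> down to \<open>K\<close> (\<open>invariants_of_split_extension\<close>).

  Algebraic independence is proved on points.  Substituting powers of one parameter for the
  coordinates, with exponents that grow quickly with the lower index, makes
  \<open>x_1^(s) x_2^(s+1) ... x_r^(s+r-1)\<close> the term of lowest order in \<open>e_r^(s)\<close>, and different monomials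
  in the \<open>e_r^(s)\<close> get different lowest exponents (\<open>loop_e_values_dense\<close>).  Thus a polynomial function on
  \<open>U_le n m\<close> that vanishes on all products of whirls is zero, which is the injectivity of the
  pullback; its surjectivity is the entry formula (\<open>whirl_product_entry\<close>).
\<close>



section \<open>Subfields and linear relations\<close>

locale subfield_set =
  fixes F :: "'a::field set"
  assumes zero_mem [simp]: "0 \<in> F" and one_mem [simp]: "1 \<in> F"
    and add_mem: "a \<in> F \<Longrightarrow> b \<in> F \<Longrightarrow> a + b \<in> F"
    and mult_mem: "a \<in> F \<Longrightarrow> b \<in> F \<Longrightarrow> a * b \<in> F"
    and uminus_mem: "a \<in> F \<Longrightarrow> - a \<in> F"
    and inverse_mem: "a \<in> F \<Longrightarrow> inverse a \<in> F"
begin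

lemma diff_mem: "a \<in> F \<Longrightarrow> b \<in> F \<Longrightarrow> a - b \<in> F"
  using add_mem[OF _ uminus_mem] by force

lemma divide_mem: "a \<in> F \<Longrightarrow> b \<in> F \<Longrightarrow> a / b \<in> F"
  using mult_mem[OF _ inverse_mem] by (simp add: divide_inverse)

lemma sum_mem: "(\<And>i. i \<in> A \<Longrightarrow> f i \<in> F) \<Longrightarrow> sum f A \<in> F"
  by (induction A rule: infinite_finite_induct) (auto intro: add_mem)

lemma prod_mem: "(\<And>i. i \<in> A \<Longrightarrow> f i \<in> F) \<Longrightarrow> prod f A \<in> F"
  by (induction A rule: infinite_finite_induct) (auto intro: mult_mem)

lemma power_mem: "a \<in> F \<Longrightarrow> a ^ k \<in> F"
  by (induction k) (auto intro: mult_mem)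

lemmas closed = add_mem mult_mem uminus_mem inverse_mem diff_mem divide_mem sum_mem prod_mem power_mem

text \<open>
  Think of an \<open>F\<close>-linear projection of the ambient field onto \<open>F\<close>: applying it to the \<open>v j\<close> gives
  elements of \<open>F\<close> that satisfy every inhomogeneous linear relation over \<open>F\<close> that the \<open>v j\<close> satisfy.
  Only countably many values are needed, so they can be chosen one after the other.  This is the
  tool by which solutions of linear systems, once known to be unique, are seen to lie in \<open>F\<close>.
\<close>

lemma linear_relations_solvable_in_subfield:
  fixes v :: "nat \<Rightarrow> 'a"
  obtains w where "\<And>k. w k \<in> F"
    and "\<And>N a b. (\<And>j. j < N \<Longrightarrow> a j \<in> F) \<Longrightarrow> b \<in> F \<Longrightarrow> (\<Sum>j<N. a j * v j) = b \<Longrightarrow>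
           (\<Sum>j<N. a j * w j) = b"
proof -
  define P where "P = (\<lambda>w N r. r \<in> F \<and> (\<forall>a b. (\<forall>j\<le>N. a j \<in> F) \<longrightarrow> b \<in> F \<longrightarrow>
     (\<Sum>j<N. a j * v j) + a N * v N = b \<longrightarrow> (\<Sum>j<N. a j * w j) + a N * r = b))"
  have "\<exists>w. \<forall>N. P w N (w N)"
  proof (rule dependent_wellorder_choice)
    fix r :: 'a and f g :: "nat \<Rightarrow> 'a" and x :: nat
    assume "\<And>y. y < x \<Longrightarrow> f y = g y"
    then show "P f x r = P g x r" unfolding P_def by simp
  next
    fix N :: nat and w
    assume IH: "\<And>y. y < N \<Longrightarrow> P w y (w y)"
    have mem: "w j \<in> F" if "j < N" for j
      using IH[OF that] unfolding P_def by blast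
    have rel: "(\<Sum>j<N. a j * w j) = b"
      if "\<And>j. j < N \<Longrightarrow> a j \<in> F" "b \<in> F" "(\<Sum>j<N. a j * v j) = b" for a b
    proof (cases N)
      case 0
      then show ?thesis using that by simp
    next
      case (Suc M)
      then show ?thesis using that IH[of M] unfolding P_def by simp
    qed
    show "\<exists>r. P w N r"
    proof (cases "\<exists>a b. (\<forall>j<N. a j \<in> F) \<and> b \<in> F \<and> (\<Sum>j<N. a j * v j) + v N = b")
      case True
      then obtain a b where ab: "\<And>j. j < N \<Longrightarrow> a j \<in> F" "b \<in> F" "(\<Sum>j<N. a j * v j) + v N = b"
        by blast
      have "P w N (b - (\<Sum>j<N. a j * w j))"
        unfolding P_def
      proof (intro conjI allI impI)
        show "b - (\<Sum>j<N. a j * w j) \<in> F"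
          using ab mem by (auto intro!: closed)
      next
        fix a' b'
        assume a': "\<forall>j\<le>N. a' j \<in> F" and b': "b' \<in> F"
          and eq: "(\<Sum>j<N. a' j * v j) + a' N * v N = b'"
        \<comment> \<open>Subtract a multiple of the chosen relation to eliminate \<open>v N\<close>.\<close>
        have "(\<Sum>j<N. (a' j - a' N * a j) * v j) = b' - a' N * b"
          using eq ab(3)[symmetric]
          by (simp add: algebra_simps sum_subtractf sum_distrib_left)
        then have "(\<Sum>j<N. (a' j - a' N * a j) * w j) = b' - a' N * b"
          using a' b' ab by (intro rel) (auto intro!: closed)
        then show "(\<Sum>j<N. a' j * w j) + a' N * (b - (\<Sum>j<N. a j * w j)) = b'"
          by (simp add: algebra_simps sum_subtractf sum_distrib_left)
      qed
      then show ?thesis ..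
    next
      case False
      have "P w N 0"
        unfolding P_def
      proof (intro conjI allI impI)
        fix a' b'
        assume a': "\<forall>j\<le>N. a' j \<in> F" and b': "b' \<in> F"
          and eq: "(\<Sum>j<N. a' j * v j) + a' N * v N = b'"
        have "a' N = 0"
        proof (rule ccontr)
          assume nz: "a' N \<noteq> 0"
          have "(\<Sum>j<N. (a' j / a' N) * v j) + v N = ((\<Sum>j<N. a' j * v j) + a' N * v N) / a' N"
            using nz by (simp add: sum_divide_distrib add_divide_distrib)
          then have "(\<Sum>j<N. (a' j / a' N) * v j) + v N = b' / a' N"
            using eq by simp
          moreover have "\<forall>j<N. a' j / a' N \<in> F" "b' / a' N \<in> F"
            using a' b' by (auto intro!: closed)
          ultimately show False using False[simplified, rule_format, of "\<lambda>j. a' j / a' N"] by auto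
        qed
        then show "(\<Sum>j<N. a' j * w j) + a' N * 0 = b'"
          using eq rel[of a' b'] a' b' by simp
      qed simp
      then show ?thesis ..
    qed
  qed
  then obtain w where w: "\<And>N. P w N (w N)" by blast
  show ?thesis
  proof
    show "w k \<in> F" for k using w[of k] unfolding P_def by blast
    show "(\<Sum>j<N. a j * w j) = b"
      if "\<And>j. j < N \<Longrightarrow> a j \<in> F" "b \<in> F" "(\<Sum>j<N. a j * v j) = b" for N a b
    proof (cases N)
      case 0
      then show ?thesis using that by simp
    next
      case (Suc M)
      then show ?thesis using that w[of M] unfolding P_def by simp
    qed
  qed
qed

lemma finite_linear_relations_solvable_in_subfield:
  fixes v :: "nat \<Rightarrow> 'a"
  obtains w where "\<And>k. w k \<in> F"
    and "\<And>J a g b. finite J \<Longrightarrow> (\<And>j. j \<in> J \<Longrightarrow> a j \<in> F) \<Longrightarrow> b \<in> F \<Longrightarrow>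
           (\<Sum>j\<in>J. a j * v (g j)) = b \<Longrightarrow> (\<Sum>j\<in>J. a (j::nat) * w (g j)) = b"
proof -
  obtain w where w: "\<And>k. w k \<in> F"
    and rel: "\<And>N a b. (\<And>j. j < N \<Longrightarrow> a j \<in> F) \<Longrightarrow> b \<in> F \<Longrightarrow> (\<Sum>j<N. a j * v j) = b \<Longrightarrow>
           (\<Sum>j<N. a j * w j) = b"
    by (rule linear_relations_solvable_in_subfield[of v]) blast
  show ?thesis
  proof
    show "w k \<in> F" for k by (rule w)
    fix J :: "nat set" and a :: "nat \<Rightarrow> 'a" and g b
    assume J: "finite J" and a: "\<And>j. j \<in> J \<Longrightarrow> a j \<in> F" and b: "b \<in> F"
      and eq: "(\<Sum>j\<in>J. a j * v (g j)) = b"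
    obtain N where N: "g ` J \<subseteq> {..<N}"
      using J finite_nat_iff_bounded[of "g ` J"] by blast
    have collect: "(\<Sum>j\<in>J. a j * u (g j)) = (\<Sum>k<N. (\<Sum>j | j \<in> J \<and> g j = k. a j) * u k)" for u
      by (subst sum.group[OF J finite_lessThan N, symmetric]) (simp add: sum_distrib_right)
    show "(\<Sum>j\<in>J. a j * w (g j)) = b"
      using eq unfolding collect by (intro rel) (use a b in \<open>auto intro!: closed\<close>)
  qed
qed

end

section \<open>Loop elementary symmetric functions\<close>

lemma finite_increasing_lists:
  "finite {is. length is = r \<and> sorted_wrt (<) is \<and> set is \<subseteq> {1..m::nat}}"
  by (rule finite_subset[OF _ finite_lists_length_eq[of "{1..m}" r]]) auto

lemma loop_e_0 [simp]: "loop_e m x 0 s = 1"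
proof -
  have "{is. length is = 0 \<and> sorted_wrt (<) is \<and> set is \<subseteq> {1..m::nat}} = {[]}" by auto
  then show ?thesis unfolding loop_e_def by simp
qed

lemma loop_e_no_variables [simp]: "loop_e 0 x (Suc r) s = 0"
proof -
  have none: "{is. length is = Suc r \<and> sorted_wrt (<) is \<and> set is \<subseteq> {1..0::nat}} = {}" by auto
  show ?thesis unfolding loop_e_def none by (rule sum.empty)
qed

text \<open>
  An increasing index sequence either avoids the last index \<open>m + 1\<close> or ends with it.
\<close>

lemma loop_e_Suc_Suc:
  "loop_e (Suc m) x (Suc r) s = loop_e m x (Suc r) s + loop_e m x r s * x (Suc m) (s + int r)"
proof -
  let ?L = "\<lambda>r m. {is. length is = r \<and> sorted_wrt (<) is \<and> set is \<subseteq> {1..m::nat}}"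
  have split: "?L (Suc r) (Suc m) = ?L (Suc r) m \<union> (\<lambda>is. is @ [Suc m]) ` ?L r m"
  proof (intro equalityI subsetI)
    fix "is" assume a: "is \<in> ?L (Suc r) (Suc m)"
    then obtain js j where js: "is = js @ [j]" by (metis (mono_tags) length_Suc_conv_rev mem_Collect_eq)
    show "is \<in> ?L (Suc r) m \<union> (\<lambda>is. is @ [Suc m]) ` ?L r m"
    proof (cases "j = Suc m")
      case True
      then have "js \<in> ?L r m" using a js by (fastforce simp: sorted_wrt_append)
      then show ?thesis using True js by blast
    next
      case False
      then have "is \<in> ?L (Suc r) m" using a js by (fastforce simp: sorted_wrt_append)
      then show ?thesis by blast
    qed
  next
    fix "is" assume "is \<in> ?L (Suc r) m \<union> (\<lambda>is. is @ [Suc m]) ` ?L r m"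
    then show "is \<in> ?L (Suc r) (Suc m)"
      by (force simp: sorted_wrt_append)
  qed
  have disj: "?L (Suc r) m \<inter> (\<lambda>is. is @ [Suc m]) ` ?L r m = {}" by auto
  have "loop_e (Suc m) x (Suc r) s = loop_e m x (Suc r) s +
      (\<Sum>is\<in>(\<lambda>is. is @ [Suc m]) ` ?L r m. \<Prod>k<Suc r. x (is ! k) (s + int k))"
    unfolding loop_e_def split
    by (rule sum.union_disjoint) (use finite_increasing_lists disj in auto)
  also have "(\<Sum>is\<in>(\<lambda>is. is @ [Suc m]) ` ?L r m. \<Prod>k<Suc r. x (is ! k) (s + int k)) =
     (\<Sum>is\<in>?L r m. (\<Prod>k<r. x (is ! k) (s + int k)) * x (Suc m) (s + int r))"
    by (subst sum.reindex) (auto simp: inj_on_def nth_append intro!: sum.cong)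
  finally show ?thesis by (simp add: loop_e_def sum_distrib_right)
qed

lemma loop_e_eq_0: "m < r \<Longrightarrow> loop_e m x r s = 0"
proof (induction m arbitrary: r)
  case 0
  then show ?case by (cases r) auto
next
  case (Suc m)
  then show ?case by (cases r) (auto simp: loop_e_Suc_Suc)
qed

lemma loop_e_top: "loop_e m x m s = (\<Prod>k<m. x (Suc k) (s + int k))"
  by (induction m) (auto simp: loop_e_Suc_Suc loop_e_eq_0)

lemma loop_e_cong:
  "(\<And>i r. i \<in> {1..m} \<Longrightarrow> x i r = y i r) \<Longrightarrow> loop_e m x r s = loop_e m y r s"
proof (induction m arbitrary: r)
  case 0
  then show ?case by (cases r) auto
next
  case (Suc m)
  then show ?case by (cases r) (auto simp: loop_e_Suc_Suc)
qed

lemma loop_e_periodic: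
  "(\<And>i r. i \<in> {1..m} \<Longrightarrow> x i (r + int n) = x i r) \<Longrightarrow> loop_e m x r (s + int n) = loop_e m x r s"
proof (induction m arbitrary: r)
  case 0
  then show ?case by (cases r) auto
next
  case (Suc m)
  have "x (Suc m) (s + int n + int k) = x (Suc m) (s + int k)" for k
    using Suc.prems[of "Suc m" "s + int k"] by (simp add: algebra_simps)
  with Suc show ?case by (cases r) (auto simp: loop_e_Suc_Suc)
qed

text \<open>
  Splitting off the variables with lower index \<open>j + 1\<close> and \<open>j\<close>, one sees that they enter only through
  \<open>x_j^(r) + x_(j+1)^(r)\<close> and \<open>x_j^(r) x_(j+1)^(r+1)\<close>, the entries of \<open>M(x_j) M(x_(j+1))\<close>.
\<close>

lemma loop_e_swap:
  fixes x y :: "nat \<Rightarrow> int \<Rightarrow> 'a::comm_ring_1"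
  assumes j: "j \<ge> 1" and m: "Suc j \<le> m"
    and other: "\<And>i r. i \<noteq> j \<Longrightarrow> i \<noteq> Suc j \<Longrightarrow> i \<in> {1..m} \<Longrightarrow> y i r = x i r"
    and sums: "\<And>r. y j r + y (Suc j) r = x j r + x (Suc j) r"
    and prods: "\<And>r. y j r * y (Suc j) (r + 1) = x j r * x (Suc j) (r + 1)"
  shows "loop_e m y r s = loop_e m x r s"
  using m other
proof (induction m arbitrary: r rule: dec_induct)
  case base
  obtain i where i: "j = Suc i" using j by (cases j) auto
  have low: "loop_e i y r s = loop_e i x r s" for r
    using base i by (intro loop_e_cong) auto
  show ?case
  proof (cases r)
    case (Suc q)
    show ?thesis
    proof (cases q)
      case 0
      have "y (Suc i) s + y (Suc (Suc i)) s = x (Suc i) s + x (Suc (Suc i)) s"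
        using sums[of s] i by simp
      with 0 Suc i low[of 1] show ?thesis by (simp add: loop_e_Suc_Suc algebra_simps)
    next
      case (Suc p)
      have expand: "loop_e (Suc j) z r s = loop_e i z r s
          + loop_e i z q s * (z j (s + int q) + z (Suc j) (s + int q))
          + loop_e i z p s * (z j (s + int p) * z (Suc j) (s + int p + 1))" for z :: "nat \<Rightarrow> int \<Rightarrow> 'a"
        using \<open>r = Suc q\<close> Suc i by (simp add: loop_e_Suc_Suc algebra_simps)
      show ?thesis unfolding expand low sums prods ..
    qed
  qed simp
next
  case (step k)
  show ?case
    using step.IH step.prems step.hyps by (cases r) (auto simp: loop_e_Suc_Suc)
qed

lemma int_periodic_mod:
  fixes f :: "int \<Rightarrow> 'a"
  assumes "\<And>r. f (r + int n) = f r"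
  shows "f (r mod int n) = f r"
proof -
  have nat: "f (r + int k * int n) = f r" for r k
  proof (induction k)
    case (Suc k)
    have "f (r + int (Suc k) * int n) = f ((r + int k * int n) + int n)"
      by (simp add: algebra_simps)
    then show ?case using Suc assms by simp
  qed simp
  have "f (r mod int n + (r div int n) * int n) = f (r mod int n)"
  proof (cases "r div int n \<ge> 0")
    case True
    then show ?thesis using nat[of "r mod int n" "nat (r div int n)"] by simp
  next
    case False
    then show ?thesis
      using nat[of "r mod int n + (r div int n) * int n" "nat (- (r div int n))"]
      by (simp add: minus_div_mult_eq_mod)
  qed
  then show ?thesis by (simp add: mult.commute)
qed

section \<open>Whirls acting on sequences\<close>

text \<open>
  The matrices act on column vectors.  Since all of them are upper triangular, vectors indexed by
  the natural numbers suffice, and they can be defined by recursion.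
\<close>

definition whirl_op :: "(int \<Rightarrow> 'a::comm_ring_1) \<Rightarrow> (nat \<Rightarrow> 'a) \<Rightarrow> nat \<Rightarrow> 'a" where
  "whirl_op u v i = v i + u (int i) * v (Suc i)"

definition loop_op :: "nat \<Rightarrow> (nat \<Rightarrow> int \<Rightarrow> 'a::comm_ring_1) \<Rightarrow> (nat \<Rightarrow> 'a) \<Rightarrow> nat \<Rightarrow> 'a" where
  "loop_op m x v i = (\<Sum>r\<le>m. loop_e m x r (int i) * v (i + r))"

lemma loop_op_0 [simp]: "loop_op 0 x v = v"
  by (simp add: loop_op_def fun_eq_iff)

text \<open>
  This identifies \<open>loop_op m x\<close> with the composition of the whirls of \<open>x 1, ..., x m\<close>; the whirl of
  \<open>x m\<close> acts first.
\<close>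

lemma loop_op_Suc: "loop_op (Suc m) x v = loop_op m x (whirl_op (x (Suc m)) v)"
proof
  fix i
  have "loop_op (Suc m) x v i
      = v i + (\<Sum>r\<le>m. loop_e (Suc m) x (Suc r) (int i) * v (i + Suc r))"
    unfolding loop_op_def by (subst sum.atMost_Suc_shift) simp
  also have "\<dots> = (v i + (\<Sum>r\<le>m. loop_e m x (Suc r) (int i) * v (i + Suc r)))
      + (\<Sum>r\<le>m. loop_e m x r (int i) * x (Suc m) (int i + int r) * v (i + Suc r))"
    by (simp add: loop_e_Suc_Suc algebra_simps sum.distrib)
  also have "v i + (\<Sum>r\<le>m. loop_e m x (Suc r) (int i) * v (i + Suc r))
      = (\<Sum>r\<le>Suc m. loop_e m x r (int i) * v (i + r))"
    by (subst sum.atMost_Suc_shift) simp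
  also have "\<dots> = (\<Sum>r\<le>m. loop_e m x r (int i) * v (i + r))"
    by (simp add: loop_e_eq_0)
  finally show "loop_op (Suc m) x v i = loop_op m x (whirl_op (x (Suc m)) v) i"
    by (simp add: loop_op_def whirl_op_def algebra_simps sum.distrib)
qed

definition kernel_seq :: "(int \<Rightarrow> 'a::field) \<Rightarrow> nat \<Rightarrow> 'a" where
  "kernel_seq u i = (\<Prod>k<i. - inverse (u (int k)))"

text \<open>
  The factor by which the sequence killed by a whirl changes over one period.
\<close>

definition multiplier :: "nat \<Rightarrow> (int \<Rightarrow> 'a::field) \<Rightarrow> 'a" where
  "multiplier n u = kernel_seq u n"

lemma kernel_seq_0 [simp]: "kernel_seq u 0 = 1"
  by (simp add: kernel_seq_def)

lemma whirl_op_kernel_seq: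
  "(\<And>r. u r \<noteq> 0) \<Longrightarrow> whirl_op u (kernel_seq u) = (\<lambda>i. 0)"
  by (auto simp: whirl_op_def kernel_seq_def fun_eq_iff)

lemma whirl_op_eq_0_imp_kernel_seq:
  assumes "\<And>r. u r \<noteq> 0" and "whirl_op u v = (\<lambda>i. 0)"
  shows "v i = v 0 * kernel_seq u i"
proof (induction i)
  case (Suc i)
  have "v i + u (int i) * v (Suc i) = 0"
    using fun_cong[OF assms(2), of i] by (simp add: whirl_op_def)
  then have "u (int i) * v (Suc i) = - v i"
    by (simp add: eq_neg_iff_add_eq_0 add.commute)
  then have "v (Suc i) = - inverse (u (int i)) * v i"
    using assms(1)[of "int i"] by (simp add: field_simps)
  then show ?case using Suc by (simp add: kernel_seq_def)
qed simp

lemma kernel_seq_shift: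
  assumes "\<And>r. u (r + int n) = u r"
  shows "kernel_seq u (i + n) = multiplier n u * kernel_seq u i"
proof (induction i)
  case (Suc i)
  have "u (int (i + n)) = u (int i)" using assms[of "int i"] by simp
  then show ?case using Suc by (simp add: kernel_seq_def)
qed (simp add: multiplier_def)

lemma kernel_seq_shift_mult:
  assumes "\<And>r. u (r + int n) = u r"
  shows "kernel_seq u (k * n) = multiplier n u ^ k"
proof (induction k)
  case (Suc k)
  have "kernel_seq u (k * n + n) = multiplier n u * kernel_seq u (k * n)"
    by (rule kernel_seq_shift[of u n, OF assms])
  with Suc show ?case by (simp add: add.commute)
qed simp

definition periodic_units :: "nat \<Rightarrow> nat \<Rightarrow> (nat \<Rightarrow> int \<Rightarrow> 'a::field) \<Rightarrow> bool" where
  "periodic_units n m x \<longleftrightarrow> (\<forall>i\<in>{1..m}. \<forall>r. x i r \<noteq> 0 \<and> x i (r + int n) = x i r)"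

lemma periodic_units_Suc: "periodic_units n (Suc m) x \<Longrightarrow> periodic_units n m x"
  by (simp add: periodic_units_def)

lemma periodic_unitsD:
  "periodic_units n m x \<Longrightarrow> i \<in> {1..m} \<Longrightarrow> x i r \<noteq> 0"
  "periodic_units n m x \<Longrightarrow> i \<in> {1..m} \<Longrightarrow> x i (r + int n) = x i r"
  by (auto simp: periodic_units_def)

lemma whirl_op_quasi_periodic:
  assumes "\<And>r. u (r + int n) = u r" and "\<And>i. v (i + n) = c * v i"
  shows "whirl_op u v (i + n) = c * whirl_op u v i"
  using assms(1)[of "int i"] assms(2)[of i] assms(2)[of "Suc i"]
  by (simp add: whirl_op_def algebra_simps)

text \<open>
  A whirl kills only multiples of its own kernel sequence, whose multiplier differs from \<open>c\<close>; and it
  maps sequences with multiplier \<open>c\<close> to such sequences, so the factors can be removed one by one.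
\<close>

lemma loop_op_injective_on_quasi_periodic:
  assumes "periodic_units n m x" and "\<And>i. i \<in> {1..m} \<Longrightarrow> c \<noteq> multiplier n (x i)"
    and "\<And>i. v (i + n) = c * v i" and "loop_op m x v = (\<lambda>i. 0)"
  shows "v i = 0"
  using assms
proof (induction m arbitrary: v i)
  case (Suc m)
  note x = periodic_unitsD[OF Suc.prems(1), of "Suc m", simplified]
  have "whirl_op (x (Suc m)) v = (\<lambda>i. 0)"
  proof
    fix i
    show "whirl_op (x (Suc m)) v i = 0"
    proof (rule Suc.IH)
      show "whirl_op (x (Suc m)) v (i + n) = c * whirl_op (x (Suc m)) v i" for i
        using x(2) Suc.prems(3) by (rule whirl_op_quasi_periodic)
    qed (use Suc.prems in \<open>auto simp: periodic_units_def loop_op_Suc\<close>)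
  qed
  note ker = whirl_op_eq_0_imp_kernel_seq[OF x(1) this]
  have "v n = c * v 0" using Suc.prems(3)[of 0] by simp
  moreover have "v n = multiplier n (x (Suc m)) * v 0"
    using ker[of n] by (simp only: multiplier_def mult.commute)
  ultimately have "v 0 = 0" using Suc.prems(2)[of "Suc m"] by simp
  then show ?case using ker[of i] by simp
qed simp

section \<open>Recovering the factors from the product and the multipliers\<close>

context subfield_set
begin

text \<open>
  The kernel sequence of the last factor is the only sequence with initial value \<open>1\<close> that has its
  multiplier and is killed by the whole product, because the other factors are injective on
  sequences with this multiplier.  These conditions are linear over \<open>F\<close>, so the sequence has values
  in \<open>F\<close>, and quotients of consecutive values give the entries of the factor.
\<close>

lemma last_factor_mem:
  assumes n: "n > 0" and x: "periodic_units n (Suc m) x"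
    and e: "\<And>r s. loop_e (Suc m) x r s \<in> F"
    and mult: "multiplier n (x (Suc m)) \<in> F"
    and other: "\<And>i. i \<in> {1..m} \<Longrightarrow> multiplier n (x (Suc m)) \<noteq> multiplier n (x i)"
  shows "x (Suc m) r \<in> F"
proof -
  define u where "u = x (Suc m)"
  define c where "c = multiplier n u"
  have u: "u r \<noteq> 0" "u (r + int n) = u r" for r
    using x by (auto simp: u_def periodic_units_def)
  obtain w where w: "\<And>k. w k \<in> F"
    and rel: "\<And>J a g b. finite J \<Longrightarrow> (\<And>j. j \<in> J \<Longrightarrow> a j \<in> F) \<Longrightarrow> b \<in> F \<Longrightarrow>
       (\<Sum>j\<in>J. a j * kernel_seq u (g j)) = b \<Longrightarrow> (\<Sum>j\<in>J. a (j::nat) * w (g j)) = b"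
    by (rule finite_linear_relations_solvable_in_subfield[of "kernel_seq u"]) blast
  have w0: "w 0 = 1"
    using rel[of "{0}" "\<lambda>_. 1" 1 "\<lambda>_. 0"] by simp
  have wn: "w (i + n) = c * w i" for i
    using rel[of "{0,1}" "\<lambda>j. if j = 0 then 1 else - c" 0 "\<lambda>j. if j = 0 then i + n else i"]
      kernel_seq_shift[of u n i, OF u(2)] mult
    by (simp add: c_def uminus_mem u_def)
  have ker: "loop_op (Suc m) x w = (\<lambda>i. 0)"
  proof
    fix i
    have "loop_op (Suc m) x (kernel_seq u) = loop_op m x (\<lambda>i. 0)"
      using whirl_op_kernel_seq[OF u(1)] by (simp add: loop_op_Suc u_def)
    then have "(\<Sum>r\<le>Suc m. loop_e (Suc m) x r (int i) * kernel_seq u (i + r)) = 0"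
      by (simp add: loop_op_def fun_eq_iff del: sum.atMost_Suc)
    then show "loop_op (Suc m) x w i = 0"
      unfolding loop_op_def by (intro rel) (use e in auto)
  qed
  \<comment> \<open>The remaining factors are injective on sequences with multiplier \<open>c\<close>.\<close>
  have "whirl_op u w = (\<lambda>i. 0)"
  proof
    fix i
    show "whirl_op u w i = 0"
    proof (rule loop_op_injective_on_quasi_periodic[OF periodic_units_Suc[OF x]])
      show "whirl_op u w (i + n) = c * whirl_op u w i" for i
        by (rule whirl_op_quasi_periodic) (use u wn in auto)
      show "c \<noteq> multiplier n (x i)" if "i \<in> {1..m}" for i
        using other[OF that] by (simp add: c_def u_def)
      show "loop_op m x (whirl_op u w) = (\<lambda>i. 0)"
        using ker by (simp add: loop_op_Suc u_def)
    qed
  qed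
  then have wk: "w i = kernel_seq u i" for i
    using whirl_op_eq_0_imp_kernel_seq[of u w i] u w0 by simp
  have nonneg: "u (int k) \<in> F" for k
  proof -
    have rec: "w (Suc k) = w k * - inverse (u (int k))" and nz: "w k \<noteq> 0"
      using u(1) by (auto simp: wk kernel_seq_def)
    have nz': "w (Suc k) \<noteq> 0"
      using u(1) by (simp add: wk kernel_seq_def)
    have "u (int k) * w (Suc k) = - w k"
      unfolding rec using u(1)[of "int k"] by simp
    with nz' have "u (int k) = (- w k) / w (Suc k)"
      by (metis nonzero_mult_div_cancel_right)
    then show ?thesis using w by (simp only: divide_mem uminus_mem)
  qed
  have "u r = u (int (nat (r mod int n)))"
    using int_periodic_mod[of u n r, OF u(2)] n by simp
  then show ?thesis using nonneg by (metis u_def)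
qed

text \<open>
  Once the last factor is known to be defined over \<open>F\<close>, so is the product of the other ones.
\<close>

theorem factors_mem:
  assumes "n > 0" and "periodic_units n m x"
    and "\<And>r s. loop_e m x r s \<in> F"
    and "\<And>i. i \<in> {1..m} \<Longrightarrow> multiplier n (x i) \<in> F"
    and "inj_on (\<lambda>i. multiplier n (x i)) {1..m}"
  shows "i \<in> {1..m} \<Longrightarrow> x i r \<in> F"
  using assms
proof (induction m arbitrary: i r)
  case (Suc m)
  have last: "x (Suc m) r \<in> F" for r
  proof (rule last_factor_mem[OF Suc.prems(2,3,4)])
    show "multiplier n (x (Suc m)) \<noteq> multiplier n (x i)" if "i \<in> {1..m}" for i
      using inj_onD[OF Suc.prems(6), of "Suc m" i] that by auto
  qed (use Suc.prems in auto)
  have e: "loop_e m x r s \<in> F" for r s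
  proof (induction r)
    case (Suc r)
    have "loop_e m x (Suc r) s = loop_e (Suc m) x (Suc r) s - loop_e m x r s * x (Suc m) (s + int r)"
      by (simp add: loop_e_Suc_Suc)
    then show ?case using Suc last Suc.prems \<open>\<And>r s. loop_e (Suc m) x r s \<in> F\<close>
      by (auto intro!: closed)
  qed simp
  show ?case
  proof (cases "i = Suc m")
    case False
    show ?thesis
    proof (rule Suc.IH)
      show "inj_on (\<lambda>i. multiplier n (x i)) {1..m}"
        using Suc.prems(6) by (rule inj_on_subset) auto
    qed (use Suc.prems False e in \<open>auto intro: periodic_units_Suc\<close>)
  qed (use last in simp)
qed simp

end

section \<open>An integral equation for the multipliers\<close>

text \<open>
  The polynomial \<open>p\<close> evaluated at the shift by \<open>n\<close> and applied to \<open>v\<close>.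
\<close>

definition shift_poly :: "nat \<Rightarrow> 'a::comm_ring_1 poly \<Rightarrow> (nat \<Rightarrow> 'a) \<Rightarrow> nat \<Rightarrow> 'a" where
  "shift_poly n p v i = (\<Sum>k\<le>degree p. coeff p k * v (i + k * n))"

lemma shift_poly_altdef:
  "degree p \<le> N \<Longrightarrow> shift_poly n p v i = (\<Sum>k\<le>N. coeff p k * v (i + k * n))"
  unfolding shift_poly_def
  by (rule sum.mono_neutral_left) (auto simp: coeff_eq_0)

lemma shift_poly_times_linear:
  "shift_poly n (p * [:- a, 1:]) v i = shift_poly n p v (i + n) - a * shift_poly n p v i"
proof -
  have coeffs: "coeff (p * [:- a, 1:]) k = coeff (pCons 0 p) k - a * coeff p k" for k
    by (simp add: coeff_pCons)
  have "degree (p * [:- a, 1:]) \<le> Suc (degree p)"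
    using degree_mult_le[of p "[:- a, 1:]"] by simp
  then have "shift_poly n (p * [:- a, 1:]) v i
      = (\<Sum>k\<le>Suc (degree p). coeff (pCons 0 p) k * v (i + k * n))
        - a * (\<Sum>k\<le>Suc (degree p). coeff p k * v (i + k * n))"
    by (simp add: shift_poly_altdef coeffs left_diff_distrib sum_subtractf sum_distrib_left mult.assoc
        del: sum.atMost_Suc mult_pCons_right)
  also have "(\<Sum>k\<le>Suc (degree p). coeff (pCons 0 p) k * v (i + k * n)) = shift_poly n p v (i + n)"
    by (subst sum.atMost_Suc_shift) (simp add: shift_poly_def algebra_simps)
  also have "(\<Sum>k\<le>Suc (degree p). coeff p k * v (i + k * n)) = shift_poly n p v i"
    by (rule shift_poly_altdef[symmetric]) simp
  finally show ?thesis .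
qed

lemma whirl_op_shift_poly:
  assumes "\<And>r. u (r + int n) = u r"
  shows "whirl_op u (shift_poly n p v) = shift_poly n p (whirl_op u v)"
proof
  fix i
  have "u (int (i + k * n)) = u (int i)" for k
  proof (induction k)
    case (Suc k)
    then show ?case using assms[of "int (i + k * n)"] by (simp add: algebra_simps)
  qed simp
  then show "whirl_op u (shift_poly n p v) i = shift_poly n p (whirl_op u v) i"
    by (simp add: whirl_op_def shift_poly_def algebra_simps sum.distrib sum_distrib_left)
qed

text \<open>
  If \<open>w\<close> is the whirl of the last factor applied to \<open>v\<close>, then by induction the product over the
  first \<open>m\<close> linear factors kills \<open>w\<close>.  The shift by \<open>n\<close> commutes with whirls, so the same product maps
  \<open>v\<close> into the kernel of the last whirl, where the last linear factor is zero.
\<close>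

lemma cayley_hamilton_loop_op:
  assumes "periodic_units n m x" and "loop_op m x v = (\<lambda>i. 0)"
  shows "shift_poly n (\<Prod>i=1..m. [:- multiplier n (x i), 1:]) v i = 0"
  using assms
proof (induction m arbitrary: v i)
  case 0
  then show ?case by (simp add: shift_poly_def)
next
  case (Suc m)
  define u where "u = x (Suc m)"
  define p where "p = (\<Prod>i=1..m. [:- multiplier n (x i), 1:])"
  have u: "u r \<noteq> 0" "u (r + int n) = u r" for r
    using Suc.prems(1) by (auto simp: u_def periodic_units_def)
  have "shift_poly n p (whirl_op u v) i = 0" for i
    unfolding p_def
    by (rule Suc.IH) (use Suc.prems in \<open>auto simp: loop_op_Suc u_def intro: periodic_units_Suc\<close>)
  then have "whirl_op u (shift_poly n p v) = (\<lambda>i. 0)"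
    by (simp add: whirl_op_shift_poly[of u n, OF u(2)] fun_eq_iff)
  from whirl_op_eq_0_imp_kernel_seq[OF u(1) this]
  have ker: "shift_poly n p v i = shift_poly n p v 0 * kernel_seq u i" for i .
  have "shift_poly n p v (i + n) = multiplier n u * shift_poly n p v i"
    using ker[of "i + n"] ker[of i] kernel_seq_shift[of u n i, OF u(2)] by simp
  then have "shift_poly n (p * [:- multiplier n u, 1:]) v i = 0"
    by (simp add: shift_poly_times_linear del: mult_pCons_right)
  then show ?case by (simp add: p_def u_def mult.commute del: mult_pCons_right mult_pCons_left)
qed

text \<open>
  The leading coefficient of the recurrence is invertible, so a solution is determined by its first
  \<open>m\<close> values.
\<close>

lemma loop_op_kernel_unique:
  assumes top: "\<And>i. loop_e m x m (int i) \<noteq> (0::'a::field)"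
    and ker: "loop_op m x v = (\<lambda>i. 0)" and init: "\<And>i. i < m \<Longrightarrow> v i = 0"
  shows "v i = 0"
proof (induction i rule: less_induct)
  case (less i)
  show ?case
  proof (cases "i < m")
    case False
    have "loop_op m x v (i - m) = loop_e m x m (int (i - m)) * v i"
      using False less unfolding loop_op_def lessThan_Suc_atMost[symmetric]
      by simp
    then show ?thesis using ker top[of "i - m"] by simp
  qed (use init in simp)
qed

context subfield_set
begin

lemma loop_op_kernel_exists:
  assumes top: "\<And>i. loop_e m x m (int i) \<noteq> 0" and e: "\<And>r s. loop_e m x r s \<in> F"
    and a: "\<And>i. i < m \<Longrightarrow> a i \<in> F"
  shows "\<exists>v. (\<forall>i. v i \<in> F) \<and> loop_op m x v = (\<lambda>i. 0) \<and> (\<forall>i<m. v i = a i)"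
proof -
  \<comment> \<open>The recurrence at \<open>i - m\<close> is solved for the value at \<open>i\<close>.\<close>
  define P where "P = (\<lambda>v i r. r \<in> F \<and> (if i < m then r = a i else
     (\<Sum>k<m. loop_e m x k (int (i - m)) * v (i - m + k)) + loop_e m x m (int (i - m)) * r = 0))"
  have "\<exists>v. \<forall>i. P v i (v i)"
  proof (rule dependent_wellorder_choice)
    fix r :: 'a and f g :: "nat \<Rightarrow> 'a" and i :: nat
    assume "\<And>y. y < i \<Longrightarrow> f y = g y"
    then show "P f i r = P g i r" unfolding P_def by simp
  next
    fix i :: nat and v
    assume IH: "\<And>y. y < i \<Longrightarrow> P v y (v y)"
    have mem: "v y \<in> F" if "y < i" for y using IH[OF that] by (simp add: P_def)
    show "\<exists>r. P v i r"
    proof (cases "i < m")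
      case False
      have "P v i (- (\<Sum>k<m. loop_e m x k (int (i - m)) * v (i - m + k)) / loop_e m x m (int (i - m)))"
        using False e mem top[of "i - m"] unfolding P_def by (auto intro!: closed)
      then show ?thesis ..
    qed (use a in \<open>auto simp: P_def\<close>)
  qed
  then obtain v where v: "\<And>i. P v i (v i)" by blast
  show ?thesis
  proof (intro exI[of _ v] conjI allI impI)
    show "v i \<in> F" for i using v[of i] by (simp add: P_def)
    show "v i = a i" if "i < m" for i using v[of i] that by (simp add: P_def)
    show "loop_op m x v = (\<lambda>i. 0)"
    proof
      fix i
      show "loop_op m x v i = 0"
        using v[of "i + m"] unfolding loop_op_def lessThan_Suc_atMost[symmetric]
        by (simp add: P_def)
    qed
  qed
qed

text \<open>
  The coefficients of \<open>(T - l_1) ... (T - l_m)\<close> solve a linear system over \<open>F\<close>: the polynomial in the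
  shift that they define kills all \<open>F\<close>-valued solutions of the recurrence.  Hence some monic polynomial
  over \<open>F\<close> has this property too, and as the \<open>F\<close>-valued solutions span all solutions, it also kills the
  kernel sequence of the last factor, on which the shift by \<open>n\<close> is multiplication by \<open>l_m\<close>.
\<close>

theorem multiplier_integral_equation:
  assumes x: "periodic_units n m x" and m: "m \<ge> 1" and e: "\<And>r s. loop_e m x r s \<in> F"
  obtains p where "\<And>k. coeff p k \<in> F" "degree p = m" "coeff p m = 1"
    "poly p (multiplier n (x m)) = 0"
proof -
  define C where "C = (\<Prod>i=1..m. [:- multiplier n (x i), 1:])"
  have degC: "degree C = m"
    unfolding C_def by (subst degree_prod_eq_sum_degree) auto
  have "lead_coeff C = 1"
    unfolding C_def by (simp add: lead_coeff_prod)
  then have leadC: "coeff C m = 1" by (simp add: degC)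
  obtain w where w: "\<And>k. w k \<in> F"
    and rel: "\<And>J a g b. finite J \<Longrightarrow> (\<And>j. j \<in> J \<Longrightarrow> a j \<in> F) \<Longrightarrow> b \<in> F \<Longrightarrow>
       (\<Sum>j\<in>J. a j * coeff C (g j)) = b \<Longrightarrow> (\<Sum>j\<in>J. a (j::nat) * w (g j)) = b"
    by (rule finite_linear_relations_solvable_in_subfield[of "coeff C"]) blast
  have wm: "w m = 1"
    using rel[of "{0}" "\<lambda>_. 1" 1 "\<lambda>_. m"] leadC by simp
  define p where "p = (\<Sum>k\<le>m. monom (w k) k)"
  have coeff_p: "coeff p k = (if k \<le> m then w k else 0)" for k
    by (simp add: p_def coeff_sum)
  have deg_p: "degree p = m"
    by (rule antisym[OF degree_le le_degree]) (auto simp: coeff_p wm)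
  have kills: "shift_poly n p v i = 0"
    if v: "\<And>i. v i \<in> F" "loop_op m x v = (\<lambda>i. 0)" for v i
  proof -
    have "(\<Sum>k\<le>m. v (i + k * n) * coeff C k) = 0"
      using cayley_hamilton_loop_op[OF x v(2), of i]
      unfolding C_def[symmetric] by (simp add: shift_poly_def degC mult.commute)
    then have "(\<Sum>k\<le>m. v (i + k * n) * w k) = 0"
      by (intro rel) (use v in auto)
    then show ?thesis
      by (simp add: shift_poly_def deg_p coeff_p mult.commute)
  qed
  have top: "loop_e m x m (int i) \<noteq> 0" for i
    unfolding loop_e_top using x by (auto simp: periodic_units_def)
  have "\<exists>v. (\<forall>i. v i \<in> F) \<and> loop_op m x v = (\<lambda>i. 0) \<and> (\<forall>i<m. v i = (if i = j then 1 else 0))"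
    for j
    by (rule loop_op_kernel_exists[OF top e]) simp
  then obtain V where V: "\<And>j i. V j i \<in> F" "\<And>j. loop_op m x (V j) = (\<lambda>i. 0)"
    "\<And>j i. i < m \<Longrightarrow> V j i = (if i = j then 1 else 0)"
    by metis
  define u where "u = kernel_seq (x m)"
  have xm: "x m r \<noteq> 0" "x m (r + int n) = x m r" for r
    using x m by (auto simp: periodic_units_def)
  have ker_u: "loop_op m x u = (\<lambda>i. 0)"
  proof -
    obtain m' where m': "m = Suc m'" using m by (cases m) auto
    show ?thesis
      using whirl_op_kernel_seq[of "x m"] xm(1)
      by (simp add: m' loop_op_Suc u_def) (simp add: loop_op_def fun_eq_iff)
  qed
  have expand: "u i = (\<Sum>j<m. u j * V j i)" for i
  proof -
    have "u i - (\<Sum>j<m. u j * V j i) = 0"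
    proof (rule loop_op_kernel_unique[where v = "\<lambda>i. u i - (\<Sum>j<m. u j * V j i)", OF top])
      show "loop_op m x (\<lambda>i. u i - (\<Sum>j<m. u j * V j i)) = (\<lambda>i. 0)"
      proof
        fix i
        have "loop_op m x (\<lambda>i. u i - (\<Sum>j<m. u j * V j i)) i
            = loop_op m x u i - (\<Sum>r\<le>m. \<Sum>j<m. u j * (loop_e m x r (int i) * V j (i + r)))"
          by (simp add: loop_op_def right_diff_distrib sum_subtractf sum_distrib_left mult.left_commute)
        also have "\<dots> = loop_op m x u i - (\<Sum>j<m. u j * loop_op m x (V j) i)"
          by (subst sum.swap) (simp add: loop_op_def sum_distrib_left)
        finally show "loop_op m x (\<lambda>i. u i - (\<Sum>j<m. u j * V j i)) i = 0"
          by (simp add: V ker_u)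
      qed
      show "u i - (\<Sum>j<m. u j * V j i) = 0" if "i < m" for i
      proof -
        have "(\<Sum>j<m. u j * V j i) = (\<Sum>j<m. if j = i then u j else 0)"
          using that by (intro sum.cong) (auto simp: V)
        then show ?thesis using that by simp
      qed
    qed
    then show ?thesis by simp
  qed
  have "poly p (multiplier n (x m)) = (\<Sum>k\<le>m. w k * u (k * n))"
    using kernel_seq_shift_mult[of "x m" n, OF xm(2)] by (simp add: poly_altdef deg_p coeff_p u_def)
  also have "\<dots> = (\<Sum>k\<le>m. \<Sum>j<m. u j * (w k * V j (k * n)))"
    by (rule sum.cong[OF refl], subst expand) (simp add: sum_distrib_left mult.left_commute)
  also have "\<dots> = (\<Sum>j<m. u j * shift_poly n p (V j) 0)"
    by (subst sum.swap) (simp add: shift_poly_def deg_p coeff_p sum_distrib_left)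
  also have "\<dots> = 0" using kills V by simp
  finally show ?thesis
    by (intro that[of p]) (use w wm deg_p in \<open>auto simp: coeff_p\<close>)
qed

end

section \<open>Descent along a tower of simple extensions\<close>

context subfield_set
begin

lemma poly_mem: "(\<And>k. coeff p k \<in> F) \<Longrightarrow> a \<in> F \<Longrightarrow> poly p a \<in> F"
  unfolding poly_altdef by (auto intro!: closed)

lemma coeff_mult_mem:
  "(\<And>k. coeff p k \<in> F) \<Longrightarrow> (\<And>k. coeff q k \<in> F) \<Longrightarrow> coeff (p * q) k \<in> F"
  unfolding coeff_mult by (auto intro!: closed)

text \<open>
  Synthetic division: the coefficients of the quotient are computed downwards from the top.
\<close>

lemma coeff_quotient_linear_mem:
  assumes "\<And>k. coeff (p * [:- a, 1:]) k \<in> F" and "a \<in> F"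
  shows "coeff p k \<in> F"
proof (cases "k \<le> Suc (degree p)")
  case True
  then show ?thesis
  proof (induction rule: inc_induct)
    case (step k)
    have "coeff p k = coeff (p * [:- a, 1:]) (Suc k) + a * coeff p (Suc k)"
      by simp
    then show ?case using step assms by (auto intro: add_mem mult_mem simp del: mult_pCons_right)
  qed (simp add: coeff_eq_0)
qed (simp add: coeff_eq_0)

text \<open>
  Division with remainder by a monic polynomial over \<open>F\<close>, recorded only through the values at the roots
  of the divisor.
\<close>

lemma reduce_modulo_monic:
  assumes c: "\<And>k. coeff c k \<in> F" "degree c = d" "coeff c d = 1" and p: "\<And>k. coeff p k \<in> F"
  shows "\<exists>q. (\<forall>k. coeff q k \<in> F) \<and> (\<forall>k\<ge>d. coeff q k = 0) \<and>
           (\<forall>t. poly c t = 0 \<longrightarrow> poly q t = poly p t)"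
  using p
proof (induction p)
  case 0
  show ?case by (rule exI[of _ 0]) simp
next
  case (pCons b p)
  have "b \<in> F" using pCons.prems[of 0] by simp
  moreover have "coeff p k \<in> F" for k using pCons.prems[of "Suc k"] by simp
  with pCons.IH obtain q where q: "\<And>k. coeff q k \<in> F" "\<And>k. k \<ge> d \<Longrightarrow> coeff q k = 0"
    "\<And>t. poly c t = 0 \<Longrightarrow> poly q t = poly p t"
    by blast
  define r where "r = pCons b q - smult (coeff (pCons b q) d) c"
  have mem: "coeff (pCons b q) k \<in> F" for k
    using q \<open>b \<in> F\<close> by (cases k) auto
  have "coeff r k \<in> F" for k
    unfolding r_def using mem c by (auto intro!: closed)
  moreover have "coeff r k = 0" if "k \<ge> d" for k
  proof (cases "k = d")
    case False
    then have "coeff (pCons b q) k = 0"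
      using that q(2)[of "k - 1"] by (cases k) auto
    then show ?thesis using False that c by (simp add: r_def coeff_eq_0)
  qed (simp add: r_def c)
  moreover have "poly r t = poly (pCons b p) t" if "poly c t = 0" for t
    using q(3) that by (simp add: r_def)
  ultimately show ?case by blast
qed

lemma subfield_simple_extension:
  "subfield_set {poly P a / poly Q a | P Q.
     (\<forall>k. coeff P k \<in> F) \<and> (\<forall>k. coeff Q k \<in> F) \<and> poly Q a \<noteq> 0}"
  (is "subfield_set ?S")
proof -
  have intro: "poly P a / poly Q a \<in> ?S"
    if "\<And>k. coeff P k \<in> F" "\<And>k. coeff Q k \<in> F" "poly Q a \<noteq> 0" for P Q
    using that by blast
  have one: "coeff 1 k \<in> F" for k by (simp add: coeff_1)
  show ?thesis
  proof
    show "0 \<in> ?S" using intro[of 0 1] one by simp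
    show "1 \<in> ?S" using intro[of 1 1] one by simp
  next
    fix f g assume "f \<in> ?S" "g \<in> ?S"
    then obtain P Q P' Q' where f: "f = poly P a / poly Q a" and g: "g = poly P' a / poly Q' a"
      and mem: "\<And>k. coeff P k \<in> F" "\<And>k. coeff Q k \<in> F" "\<And>k. coeff P' k \<in> F" "\<And>k. coeff Q' k \<in> F"
      and nz: "poly Q a \<noteq> 0" "poly Q' a \<noteq> 0"
      by blast
    have "poly (P * Q' + P' * Q) a / poly (Q * Q') a \<in> ?S"
      by (rule intro) (use mem nz in \<open>auto intro!: add_mem coeff_mult_mem\<close>)
    moreover have "f + g = poly (P * Q' + P' * Q) a / poly (Q * Q') a"
      using nz by (simp add: f g add_frac_eq)
    ultimately show "f + g \<in> ?S" by (simp only:)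
    have "poly (P * P') a / poly (Q * Q') a \<in> ?S"
      by (rule intro) (use mem nz in \<open>auto intro!: add_mem coeff_mult_mem\<close>)
    moreover have "f * g = poly (P * P') a / poly (Q * Q') a"
      by (simp add: f g)
    ultimately show "f * g \<in> ?S" by (simp only:)
  next
    fix f assume "f \<in> ?S"
    then obtain P Q where f: "f = poly P a / poly Q a"
      and mem: "\<And>k. coeff P k \<in> F" "\<And>k. coeff Q k \<in> F" and nz: "poly Q a \<noteq> 0"
      by blast
    have "poly (- P) a / poly Q a \<in> ?S"
      by (rule intro) (use mem nz in \<open>auto intro!: uminus_mem\<close>)
    then show "- f \<in> ?S" by (simp add: f)
    show "inverse f \<in> ?S"
    proof (cases "poly P a = 0")
      case True
      then show ?thesis using intro[of 0 1] one by (simp add: f)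
    next
      case False
      then show ?thesis using intro[of Q P] mem by (simp add: f)
    qed
  qed
qed

text \<open>
  Replace \<open>P\<close> and \<open>Q\<close> by their remainders modulo \<open>c\<close>.  Then \<open>P - f Q\<close> has more roots than its degree
  allows and vanishes identically, so \<open>f\<close> is a quotient of coefficients of \<open>P\<close> and \<open>Q\<close>.
\<close>

lemma mem_of_conjugates_agree:
  assumes c: "\<And>k. coeff c k \<in> F" "degree c = card S" "coeff c (card S) = 1"
    and S: "finite S" "\<And>b. b \<in> S \<Longrightarrow> poly c b = 0" "a \<in> S"
    and P: "\<And>k. coeff P k \<in> F" and Q: "\<And>k. coeff Q k \<in> F" "poly Q a \<noteq> 0"
    and conj: "\<And>b. b \<in> S \<Longrightarrow> poly P b = f * poly Q b"
  shows "f \<in> F"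
proof -
  obtain P' where P': "\<And>k. coeff P' k \<in> F" "\<And>k. k \<ge> card S \<Longrightarrow> coeff P' k = 0"
    "\<And>t. poly c t = 0 \<Longrightarrow> poly P' t = poly P t"
    using reduce_modulo_monic[OF c P] by blast
  obtain Q' where Q': "\<And>k. coeff Q' k \<in> F" "\<And>k. k \<ge> card S \<Longrightarrow> coeff Q' k = 0"
    "\<And>t. poly c t = 0 \<Longrightarrow> poly Q' t = poly Q t"
    using reduce_modulo_monic[OF c Q(1)] by blast
  define R where "R = P' - smult f Q'"
  have "R = 0"
  proof (rule ccontr)
    assume nz: "R \<noteq> 0"
    have "S \<subseteq> {t. poly R t = 0}"
      using S conj P' Q' by (auto simp: R_def)
    then have "card S \<le> degree R"
      using card_mono[OF poly_roots_finite[OF nz]] card_poly_roots_bound[OF nz] by (meson order_trans)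
    then have "coeff R (degree R) = 0" using P' Q' by (simp add: R_def)
    then show False using nz by simp
  qed
  then have eq: "coeff P' k = f * coeff Q' k" for k
    unfolding R_def by (metis coeff_smult eq_iff_diff_eq_0)
  have "poly Q' a \<noteq> 0" using Q' Q S by simp
  then obtain k where k: "coeff Q' k \<noteq> 0" by (metis poly_0 poly_eqI coeff_0)
  then have "f = coeff P' k / coeff Q' k" using eq[of k] by simp
  then show ?thesis using P' Q' by (simp only: divide_mem)
qed

end

section \<open>Subfields of the field of rational functions\<close>

lemma complex_subfield_iff:
  "complex_subfield K \<longleftrightarrow> subfield_set K \<and> range const_rf \<subseteq> K"
proof -
  have const: "const_rf 0 = 0" "const_rf 1 = 1" by (simp_all add: const_rf_def)
  show ?thesis
  proof
    assume K: "complex_subfield K"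
    then have range: "range const_rf \<subseteq> K" by (simp add: complex_subfield_def)
    have "0 \<in> K" "1 \<in> K"
      using range[THEN subsetD, OF rangeI, of 0] range[THEN subsetD, OF rangeI, of 1]
      by (simp_all only: const)
    then show "subfield_set K \<and> range const_rf \<subseteq> K"
      using K range by (simp add: complex_subfield_def subfield_set_def)
  qed (simp add: complex_subfield_def subfield_set_def)
qed

lemma complex_subfield_adjoin: "complex_subfield (complex_adjoin S)"
  unfolding complex_adjoin_def complex_subfield_def by blast

lemma adjoin_superset: "S \<subseteq> complex_adjoin S"
  unfolding complex_adjoin_def by blast

lemma adjoin_least: "complex_subfield K \<Longrightarrow> S \<subseteq> K \<Longrightarrow> complex_adjoin S \<subseteq> K"
  unfolding complex_adjoin_def by blast

lemma adjoin_mono: "S \<subseteq> T \<Longrightarrow> complex_adjoin S \<subseteq> complex_adjoin T"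
  unfolding complex_adjoin_def by blast

lemma subfield_adjoin: "subfield_set (complex_adjoin S)"
  using complex_subfield_adjoin complex_subfield_iff by blast

lemma const_mem_adjoin: "const_rf c \<in> complex_adjoin S"
  using complex_subfield_adjoin[of S] unfolding complex_subfield_def by blast

text \<open>
  The conditions are restricted to \<open>L\<close>, so that both the maps \<open>act w\<close> and globally defined substitutions are
  covered.
\<close>

definition complex_hom_on :: "ratfun set \<Rightarrow> (ratfun \<Rightarrow> ratfun) \<Rightarrow> bool" where
  "complex_hom_on L \<phi> \<longleftrightarrow> \<phi> ` L \<subseteq> L \<and> (\<forall>c. \<phi> (const_rf c) = const_rf c) \<and>
     (\<forall>f\<in>L. \<forall>g\<in>L. \<phi> (f + g) = \<phi> f + \<phi> g \<and> \<phi> (f * g) = \<phi> f * \<phi> g)"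

locale ratfun_hom =
  fixes L \<phi>
  assumes L: "complex_subfield L" and hom: "complex_hom_on L \<phi>"
begin

sublocale subfield_set L using L complex_subfield_iff by blast

lemma const_mem: "const_rf c \<in> L" using L by (auto simp: complex_subfield_def)
lemma map_const: "\<phi> (const_rf c) = const_rf c" using hom by (auto simp: complex_hom_on_def)
lemma map_add: "f \<in> L \<Longrightarrow> g \<in> L \<Longrightarrow> \<phi> (f + g) = \<phi> f + \<phi> g"
  using hom by (auto simp: complex_hom_on_def)
lemma map_mult: "f \<in> L \<Longrightarrow> g \<in> L \<Longrightarrow> \<phi> (f * g) = \<phi> f * \<phi> g"
  using hom by (auto simp: complex_hom_on_def)
lemma map_0 [simp]: "\<phi> 0 = 0" using map_const[of 0] by (simp add: const_rf_def)
lemma map_1 [simp]: "\<phi> 1 = 1" using map_const[of 1] by (simp add: const_rf_def)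

lemma map_uminus: assumes "f \<in> L" shows "\<phi> (- f) = - \<phi> f"
  using map_add[OF assms uminus_mem[OF assms]] by (simp add: eq_neg_iff_add_eq_0 add.commute)

lemma map_inverse: assumes "f \<in> L" shows "\<phi> (inverse f) = inverse (\<phi> f)"
proof (cases "f = 0")
  case False
  then have "\<phi> f * \<phi> (inverse f) = 1"
    using map_mult[OF assms inverse_mem[OF assms]] by simp
  then show ?thesis by (simp add: inverse_unique)
qed simp

lemma map_sum: "(\<And>i. i \<in> A \<Longrightarrow> f i \<in> L) \<Longrightarrow> \<phi> (sum f A) = (\<Sum>i\<in>A. \<phi> (f i))"
  by (induction A rule: infinite_finite_induct) (auto simp: map_add sum_mem)

lemma map_prod: "(\<And>i. i \<in> A \<Longrightarrow> f i \<in> L) \<Longrightarrow> \<phi> (prod f A) = (\<Prod>i\<in>A. \<phi> (f i))"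
  by (induction A rule: infinite_finite_induct) (auto simp: map_mult prod_mem)

lemma map_power: "f \<in> L \<Longrightarrow> \<phi> (f ^ k) = \<phi> f ^ k"
  by (induction k) (auto simp: map_mult power_mem)

lemma map_poly_value:
  assumes "\<And>k. coeff p k \<in> L" and "\<And>k. \<phi> (coeff p k) = coeff p k" and "a \<in> L"
  shows "\<phi> (poly p a) = poly p (\<phi> a)"
  using assms by (simp add: poly_altdef map_sum map_mult map_power mult_mem power_mem)

lemma equalizer_subfield:
  assumes "complex_hom_on L \<psi>"
  shows "complex_subfield {f \<in> L. \<phi> f = \<psi> f}"
proof -
  interpret psi: ratfun_hom L \<psi> using L assms by unfold_locales
  show ?thesis
    unfolding complex_subfield_def
    by (auto simp: const_mem map_const psi.map_const map_add psi.map_add map_mult psi.map_mult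
        map_uminus psi.map_uminus map_inverse psi.map_inverse intro: add_mem mult_mem uminus_mem inverse_mem)
qed

end

lemma complex_hom_on_id: "complex_hom_on L (\<lambda>f. f)"
  by (simp add: complex_hom_on_def)

lemma complex_hom_on_compose:
  "complex_hom_on L \<phi> \<Longrightarrow> complex_hom_on L \<psi> \<Longrightarrow> complex_hom_on L (\<lambda>f. \<phi> (\<psi> f))"
  unfolding complex_hom_on_def by (auto simp: image_subset_iff)

lemma hom_agree_on_adjoin:
  assumes "complex_subfield L" "complex_hom_on L \<phi>" "complex_hom_on L \<psi>"
    and "S \<subseteq> L" "\<And>g. g \<in> S \<Longrightarrow> \<phi> g = \<psi> g" "f \<in> complex_adjoin S"
  shows "\<phi> f = \<psi> f"
proof -
  interpret ratfun_hom L \<phi> using assms by unfold_locales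
  have "complex_adjoin S \<subseteq> {f \<in> L. \<phi> f = \<psi> f}"
    by (rule adjoin_least[OF equalizer_subfield]) (use assms in auto)
  then show ?thesis using assms(6) by blast
qed

text \<open>
  Over the field \<open>K i\<close> generated by \<open>E\<close> and the first \<open>i\<close> roots, the element \<open>\<alpha> (i + 1)\<close> is a root of
  a polynomial of degree \<open>m - i\<close> whose roots are \<open>\<alpha> (i + 1), ..., \<alpha> m\<close>.  The homomorphisms given by
  the hypothesis for the transpositions of \<open>i + 1\<close> and \<open>j\<close> fix \<open>K i\<close> and move \<open>\<alpha> (i + 1)\<close> to all these
  roots, so \<open>mem_of_conjugates_agree\<close> pushes \<open>f\<close> from \<open>K (i + 1)\<close> down to \<open>K i\<close>.
\<close>

theorem invariants_of_split_extension:
  fixes \<alpha> :: "nat \<Rightarrow> ratfun" and E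
  defines "K \<equiv> \<lambda>i. complex_adjoin (E \<union> \<alpha> ` {1..i})"
  assumes inj: "inj_on \<alpha> {1..m}"
    and c: "\<And>k. coeff c k \<in> K 0" "degree c = m" "coeff c m = 1" "\<And>j. j \<in> {1..m} \<Longrightarrow> poly c (\<alpha> j) = 0"
    and transp: "\<And>i j. i \<in> {1..m} \<Longrightarrow> j \<in> {1..m} \<Longrightarrow> \<exists>\<tau>. complex_hom_on (K m) \<tau> \<and>
        (\<forall>g\<in>E. \<tau> g = g) \<and> (\<forall>k\<in>{1..m}. \<tau> (\<alpha> k) = \<alpha> (transpose i j k)) \<and> \<tau> f = f"
    and f: "f \<in> K m"
  shows "f \<in> complex_adjoin E"
proof -
  have K_mono: "K i \<subseteq> K j" if "i \<le> j" for i j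
    unfolding K_def by (rule adjoin_mono) (use that in auto)
  have K_sub: "subfield_set (K i)" for i unfolding K_def by (rule subfield_adjoin)
  have \<alpha>_mem: "\<alpha> j \<in> K i" if "j \<in> {1..i}" for i j
    using adjoin_superset[of "E \<union> \<alpha> ` {1..i}"] that unfolding K_def by auto
  have E_mem: "E \<subseteq> K i" for i 
    using adjoin_superset[of "E \<union> \<alpha> ` {1..i}"] unfolding K_def by auto
  have factor: "\<exists>c. (\<forall>k. coeff c k \<in> K i) \<and> degree c = m - i \<and> coeff c (m - i) = 1 \<and>
      (\<forall>j\<in>{i<..m}. poly c (\<alpha> j) = 0)" if "i \<le> m" for i
    using that
  proof (induction i)
    case 0
    then show ?case using c by (intro exI[of _ c]) auto
  next
    case (Suc i)
    then obtain c where c: "\<And>k. coeff c k \<in> K i" "degree c = m - i" "coeff c (m - i) = 1"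
      "\<And>j. j \<in> {i<..m} \<Longrightarrow> poly c (\<alpha> j) = 0"
      using Suc_leD[OF Suc.prems] by blast
    interpret subfield_set "K (Suc i)" by (rule K_sub)
    let ?a = "\<alpha> (Suc i)"
    have "poly c ?a = 0" using c(4) Suc.prems by simp
    then obtain q where q: "c = q * [:- ?a, 1:]"
      unfolding poly_eq_0_iff_dvd by (metis dvdE mult.commute)
    have "c \<noteq> 0" using c(3) by (metis coeff_0 zero_neq_one)
    then have "q \<noteq> 0" unfolding q by (metis mult_zero_left)
    then have "degree c = degree q + 1"
      unfolding q by (subst degree_mult_eq) auto
    then have deg: "degree q = m - Suc i" using c(2) by simp
    have "lead_coeff c = lead_coeff q"
      unfolding q by (simp add: lead_coeff_mult del: mult_pCons_right)
    then have "coeff q (m - Suc i) = 1" using deg c(2,3) by simp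
    moreover have "coeff q k \<in> K (Suc i)" for k
    proof (rule coeff_quotient_linear_mem)
      show "coeff (q * [:- ?a, 1:]) k \<in> K (Suc i)" for k
        unfolding q[symmetric] using c(1) K_mono[of i "Suc i"] by auto
    qed (rule \<alpha>_mem, simp)
    moreover have "poly q (\<alpha> j) = 0" if "j \<in> {Suc i<..m}" for j
    proof -
      have "poly c (\<alpha> j) = poly q (\<alpha> j) * (\<alpha> j - ?a)"
        unfolding q by (simp add: algebra_simps)
      moreover have "poly c (\<alpha> j) = 0" using c(4) that by simp
      moreover have "\<alpha> j \<noteq> ?a" using inj_onD[OF inj, of j "Suc i"] that by auto
      ultimately show ?thesis by simp
    qed
    ultimately show ?case using deg by blast
  qed
  have descend: "f \<in> K i" if im: "Suc i \<le> m" and f: "f \<in> K (Suc i)" for i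
  proof -
    interpret Ki: subfield_set "K i" by (rule K_sub)
    let ?a = "\<alpha> (Suc i)"
    let ?T = "{poly P ?a / poly Q ?a | P Q.
       (\<forall>k. coeff P k \<in> K i) \<and> (\<forall>k. coeff Q k \<in> K i) \<and> poly Q ?a \<noteq> 0}"
    have const_T: "b \<in> ?T" if "b \<in> K i" for b
      using that by (intro CollectI exI[of _ "[:b:]"] exI[of _ 1]) (auto simp: coeff_pCons coeff_1 split: nat.split)
    have a_T: "?a \<in> ?T"
      by (intro CollectI exI[of _ "[:0,1:]"] exI[of _ 1]) (auto simp: coeff_pCons coeff_1 split: nat.split)
    have "complex_subfield ?T"
      unfolding complex_subfield_iff using Ki.subfield_simple_extension const_T
      by (auto simp: K_def const_mem_adjoin)
    moreover have "E \<union> \<alpha> ` {1..Suc i} \<subseteq> ?T"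
    proof
      fix g assume "g \<in> E \<union> \<alpha> ` {1..Suc i}"
      then consider "g \<in> K i" | "g = ?a"
        using E_mem[of i] \<alpha>_mem[of _ i] by (auto simp: atLeastAtMostSuc_conv)
      then show "g \<in> ?T"
        by cases (erule const_T, simp only: a_T)
    qed
    ultimately have "K (Suc i) \<subseteq> ?T"
      unfolding K_def by (rule adjoin_least)
    then obtain P Q where fPQ: "f = poly P ?a / poly Q ?a"
      and P: "\<And>k. coeff P k \<in> K i" and Q: "\<And>k. coeff Q k \<in> K i" "poly Q ?a \<noteq> 0"
      using f by blast
    obtain c where c: "\<And>k. coeff c k \<in> K i" "degree c = m - i" "coeff c (m - i) = 1"
      "\<And>j. j \<in> {i<..m} \<Longrightarrow> poly c (\<alpha> j) = 0"
      using factor[OF Suc_leD[OF im]] by blast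
    let ?S = "\<alpha> ` {i<..m}"
    have "inj_on \<alpha> {i<..m}" by (rule inj_on_subset[OF inj]) auto
    then have card: "card ?S = m - i" by (simp add: card_image)
    have conj: "poly P (\<alpha> j) = f * poly Q (\<alpha> j)" if j: "j \<in> {i<..m}" for j
    proof -
      obtain \<tau> where \<tau>: "complex_hom_on (K m) \<tau>" "\<And>g. g \<in> E \<Longrightarrow> \<tau> g = g"
        "\<And>k. k \<in> {1..m} \<Longrightarrow> \<tau> (\<alpha> k) = \<alpha> (transpose (Suc i) j k)" "\<tau> f = f"
      proof -
        have "Suc i \<in> {1..m}" "j \<in> {1..m}" using im j by auto
        from transp[OF this] show ?thesis using that by blast
      qed
      have "complex_subfield (K m)" unfolding K_def by (rule complex_subfield_adjoin)
      then interpret ratfun_hom "K m" \<tau> using \<tau>(1) by (rule ratfun_hom.intro)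
      have fixes_Ki: "\<tau> g = g" if g: "g \<in> K i" for g
      proof (rule hom_agree_on_adjoin[OF L hom complex_hom_on_id, of "E \<union> \<alpha> ` {1..i}"])
        show "E \<union> \<alpha> ` {1..i} \<subseteq> K m"
          using E_mem[of m] \<alpha>_mem[of _ m] im by auto
        show "\<tau> g = g" if "g \<in> E \<union> \<alpha> ` {1..i}" for g
          using that \<tau> im j by (auto simp: transpose_def)
        show "g \<in> complex_adjoin (E \<union> \<alpha> ` {1..i})" using g by (simp add: K_def)
      qed
      have sub: "K i \<subseteq> K m" using K_mono im by simp
      have a: "?a \<in> K m" "\<tau> ?a = \<alpha> j" using \<alpha>_mem[of "Suc i" m] \<tau>(3)[of "Suc i"] im by auto
      have conj_value: "\<tau> (poly R ?a) = poly R (\<alpha> j)" if R: "\<And>k. coeff R k \<in> K i" for R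
      proof -
        have "coeff R k \<in> K m" "\<tau> (coeff R k) = coeff R k" for k
          using subsetD[OF sub R] fixes_Ki[OF R] by simp_all
        then show ?thesis using map_poly_value[of R ?a] a by simp
      qed
      have "f * poly Q ?a = poly P ?a" using fPQ Q by simp
      moreover have "poly Q ?a \<in> K m" "f \<in> K m"
        using poly_mem[OF subsetD[OF sub Q(1)] a(1)] subsetD[OF K_mono[OF im] f] by simp_all
      ultimately show ?thesis using map_mult[of f "poly Q ?a"] \<tau>(4) conj_value[OF P] conj_value[OF Q(1)] by simp
    qed
    show ?thesis
    proof (rule Ki.mem_of_conjugates_agree[of c ?S ?a P Q])
      show "?a \<in> ?S" using im by simp
      show "degree c = card ?S" "coeff c (card ?S) = 1" using c card by simp_all
      show "poly c b = 0" if "b \<in> ?S" for b using that by (elim imageE) (simp only: c(4))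
      show "poly P b = f * poly Q b" if "b \<in> ?S" for b using that by (elim imageE) (simp only: conj)
    qed (simp_all add: c P Q)
  qed
  have "f \<in> K (m - i)" if "i \<le> m" for i
    using that
  proof (induction i)
    case (Suc i)
    have "m - i = Suc (m - Suc i)" using Suc.prems by simp
    then show ?case using descend[of "m - Suc i"] Suc by simp
  qed (use f in simp)
  from this[of m] show ?thesis by (simp add: K_def)
qed

section \<open>The polynomials kappa and the exchange of two factors\<close>

lemma prod_periodic_window:
  fixes f :: "int \<Rightarrow> 'a::comm_monoid_mult"
  assumes "\<And>r. f (r + int n) = f r"
  shows "(\<Prod>k<n. f (r + int k)) = (\<Prod>k<n. f (int k))"
proof -
  define g where "g s = (\<Prod>k<n. f (s + int k))" for s
  \<comment> \<open>Moving the window by one drops \<open>f s\<close> and adds \<open>f (s + n)\<close>, which is the same.\<close>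
  have step: "g (s + 1) = g s" for s
  proof (cases n)
    case (Suc p)
    have "g (s + 1) = (\<Prod>k<p. f (s + int (Suc k))) * f (s + int n)"
      by (simp add: g_def Suc algebra_simps)
    also have "\<dots> = g s"
      unfolding assms unfolding g_def Suc prod.lessThan_Suc_shift by (simp add: mult.commute)
    finally show ?thesis .
  qed (simp add: g_def)
  have up: "g (s + int k) = g s" for s k
  proof (induction k)
    case (Suc k)
    then show ?case using step[of "s + int k"] by (simp add: algebra_simps)
  qed simp
  have "g r = g 0"
    using up[of r "nat (- r)"] up[of 0 "nat r"] by (cases "r \<ge> 0") auto
  then show ?thesis by (simp add: g_def)
qed

lemma prod_periodic_shift:
  fixes f :: "int \<Rightarrow> 'a::comm_monoid_mult"
  assumes "\<And>r. f (r + int n) = f r"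
  shows "(\<Prod>k=1..n. f (r + int k)) = (\<Prod>k<n. f (int k))"
proof -
  have "(\<Prod>k=1..n. f (r + int k)) = (\<Prod>k<n. f (r + 1 + int k))"
    by (rule prod.reindex_bij_witness[of _ Suc "\<lambda>k. k - 1"]) (auto simp: algebra_simps of_nat_diff)
  also have "\<dots> = (\<Prod>k<n. f (int k))" by (rule prod_periodic_window[of f n, OF assms])
  finally show ?thesis .
qed

locale kappa_pair =
  fixes n :: nat and x y :: "int \<Rightarrow> 'a::field" and \<kappa> X Y
  assumes n: "n > 0"
    and x: "x (r + int n) = x r" and y: "y (r + int n) = y r"
  defines "\<kappa> \<equiv> kappa n x y"
    and "X \<equiv> \<Prod>k<n. x (int k)" and "Y \<equiv> \<Prod>k<n. y (int k)"
begin

lemma kappa_periodic: "\<kappa> (r + int n) = \<kappa> r"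
proof -
  have "x (r + int n + int t) = x (r + int t)" "y (r + int n + int t) = y (r + int t)" for t
    using x[of "r + int t"] y[of "r + int t"] by (simp_all add: algebra_simps)
  then show ?thesis by (simp add: \<kappa>_def kappa_def)
qed

text \<open>
  Both \<open>x^(r) \<kappa>_r\<close> and \<open>y^(r+1) \<kappa>_(r+1)\<close> are sums of monomials \<open>T s\<close> that take the first \<open>s\<close> of the \<open>n\<close>
  factors from \<open>y\<close> and the others from \<open>x\<close>; one sum misses \<open>T n = Y\<close>, the other one \<open>T 0 = X\<close>.
\<close>

lemma kappa_cross: "y (r + 1) * \<kappa> (r + 1) - x r * \<kappa> r = Y - X"
proof -
  obtain p where p: "n = Suc p" using n by (cases n) auto
  define T where "T s = (\<Prod>t=1..s. y (r + int t)) * (\<Prod>t=s + 1..n. x (r + int t))" for s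
  have "x r * \<kappa> r = (\<Sum>s=0..p. T s)"
    unfolding \<kappa>_def kappa_def p diff_Suc_1 sum_distrib_left
  proof (rule sum.cong)
    fix s assume "s \<in> {0..p}"
    then have "(\<Prod>t=s + 1..n. x (r + int t)) = (\<Prod>t=s + 1..p. x (r + int t)) * x (r + int n)"
      by (simp add: p)
    then show "x r * ((\<Prod>t=1..s. y (r + int t)) * (\<Prod>t=s + 1..p. x (r + int t))) = T s"
      by (simp add: T_def x)
  qed simp
  moreover have "y (r + 1) * \<kappa> (r + 1) = (\<Sum>s=0..p. T (Suc s))"
    unfolding \<kappa>_def kappa_def p diff_Suc_1 sum_distrib_left
  proof (rule sum.cong)
    fix s assume "s \<in> {0..p}"
    have "(\<Prod>t=1..Suc s. y (r + int t)) = y (r + 1) * (\<Prod>t=Suc 1..Suc s. y (r + int t))"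
      by (subst prod.atLeast_Suc_atMost) auto
    also have "(\<Prod>t=Suc 1..Suc s. y (r + int t)) = (\<Prod>t=1..s. y (r + 1 + int t))"
      by (subst prod.shift_bounds_cl_Suc_ivl) (simp add: algebra_simps)
    finally have Y: "(\<Prod>t=1..Suc s. y (r + int t)) = y (r + 1) * (\<Prod>t=1..s. y (r + 1 + int t))" .
    have X: "(\<Prod>t=Suc s + 1..n. x (r + int t)) = (\<Prod>t=s + 1..p. x (r + 1 + int t))"
      unfolding p by (simp add: prod.shift_bounds_cl_Suc_ivl algebra_simps del: prod.cl_ivl_Suc)
    show "y (r + 1) * ((\<Prod>t=1..s. y (r + 1 + int t)) * (\<Prod>t=s + 1..p. x (r + 1 + int t))) = T (Suc s)"
      unfolding T_def Y X by (simp add: mult.assoc)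
  qed simp
  ultimately have "y (r + 1) * \<kappa> (r + 1) - x r * \<kappa> r = (\<Sum>s=0..p. T (Suc s) - T s)"
    by (simp add: sum_subtractf)
  also have "\<dots> = T n - T 0" by (simp add: p sum_Suc_diff)
  also have "\<dots> = Y - X"
    using prod_periodic_shift[of y n r] prod_periodic_shift[of x n r] x y
    by (simp add: T_def X_def Y_def)
  finally show ?thesis .
qed

end

lemma multiplier_shift:
  assumes "\<And>r. u (r + int n) = u r"
  shows "multiplier n (\<lambda>r. u (r + c)) = multiplier n u"
  using prod_periodic_window[of "\<lambda>r. - inverse (u r)" n c] assms
  by (simp add: multiplier_def kernel_seq_def add.commute)

lemma multiplier_mult:
  "multiplier n (\<lambda>r. u r * (w r / w' r)) = multiplier n u * (\<Prod>k<n. w' (int k) / w (int k))"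
  by (simp add: multiplier_def kernel_seq_def divide_inverse mult_ac flip: prod.distrib)

locale kappa_units = kappa_pair +
  assumes kappa_nonzero: "\<kappa> r \<noteq> 0"
begin

text \<open>
  The two families \<open>s_j(x_j)\<close> and \<open>s_j(x_(j+1))\<close> of the birational R-matrix, for \<open>x = x_j\<close> and
  \<open>y = x_(j+1)\<close>.
\<close>

definition x' :: "int \<Rightarrow> 'a" where "x' r = y (r + 1) * \<kappa> (r + 1) / \<kappa> r"
definition y' :: "int \<Rightarrow> 'a" where "y' r = x (r - 1) * \<kappa> (r - 1) / \<kappa> r"

lemma x'_periodic: "x' (r + int n) = x' r"
  using y[of "r + 1"] kappa_periodic[of "r + 1"] kappa_periodic[of r]
  by (simp add: x'_def algebra_simps)

lemma y'_periodic: "y' (r + int n) = y' r"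
  using x[of "r - 1"] kappa_periodic[of "r - 1"] kappa_periodic[of r]
  by (simp add: y'_def algebra_simps)

lemma sum_preserved: "x' r + y' r = x r + y r"
proof -
  have "(x' r + y' r) * \<kappa> r = y (r + 1) * \<kappa> (r + 1) + x (r - 1) * \<kappa> (r - 1)"
    using kappa_nonzero[of r] by (simp add: x'_def y'_def distrib_right)
  also have "y (r + 1) * \<kappa> (r + 1) = x r * \<kappa> r + (Y - X)"
    using kappa_cross[of r] by (simp add: diff_eq_eq add.commute)
  also have "x (r - 1) * \<kappa> (r - 1) = y r * \<kappa> r - (Y - X)"
    using kappa_cross[of "r - 1"] by (simp add: algebra_simps)
  also have "x r * \<kappa> r + (Y - X) + (y r * \<kappa> r - (Y - X)) = (x r + y r) * \<kappa> r"
    by (simp add: algebra_simps)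
  finally show ?thesis using kappa_nonzero[of r] by simp
qed

lemma product_preserved: "x' r * y' (r + 1) = x r * y (r + 1)"
  using kappa_nonzero[of r] kappa_nonzero[of "r + 1"] by (simp add: x'_def y'_def)

lemma multiplier_x': "multiplier n x' = multiplier n y"
proof -
  have "x' = (\<lambda>r. y (r + 1) * (\<kappa> (r + 1) / \<kappa> r))" by (simp add: x'_def fun_eq_iff)
  then have "multiplier n x' = multiplier n (\<lambda>r. y (r + 1)) * (\<Prod>k<n. \<kappa> (int k) / \<kappa> (int k + 1))"
    by (simp only: multiplier_mult)
  also have "(\<Prod>k<n. \<kappa> (int k) / \<kappa> (int k + 1)) = 1"
    using prod_periodic_window[of \<kappa> n 1] kappa_periodic kappa_nonzero
    by (simp add: prod_dividef add.commute)
  finally show ?thesis using multiplier_shift[of y n 1] y by simp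
qed

lemma multiplier_y': "multiplier n y' = multiplier n x"
proof -
  have "y' = (\<lambda>r. x (r - 1) * (\<kappa> (r - 1) / \<kappa> r))" by (simp add: y'_def fun_eq_iff)
  then have "multiplier n y' = multiplier n (\<lambda>r. x (r - 1)) * (\<Prod>k<n. \<kappa> (int k) / \<kappa> (int k - 1))"
    by (simp only: multiplier_mult)
  also have "(\<Prod>k<n. \<kappa> (int k) / \<kappa> (int k - 1)) = 1"
    using prod_periodic_window[of \<kappa> n "-1"] kappa_periodic kappa_nonzero
    by (simp add: prod_dividef)
  finally show ?thesis using multiplier_shift[of x n "-1"] x by simp
qed

text \<open>
  Each summand of \<open>kappa n x' y' r\<close> collapses to \<open>\<kappa>_r^2 A_s B_(s+2) / (\<kappa>_(r+s) \<kappa>_(r+s+1))\<close>, where \<open>A\<close> and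
  \<open>B\<close> are partial products of \<open>x\<close> and \<open>y\<close>.  By \<open>kappa_cross\<close>, multiplying it by \<open>Y - X\<close> splits the
  fraction into a difference, and the sum telescopes.
\<close>

lemma kappa_preserved:
  assumes "X \<noteq> Y"
  shows "kappa n x' y' r = \<kappa> r"
proof -
  obtain p where p: "n = Suc p" using n by (cases n) auto
  then have np: "n - 1 = p" by simp
  define A where "A s = (\<Prod>t<s. x (r + int t))" for s
  define B where "B s = (\<Prod>t=s..n. y (r + int t))" for s
  define G where "G s = A s * B (s + 1) / \<kappa> (r + int s)" for s
  have y'_prod: "(\<Prod>t=1..s. y' (r + int t)) = A s * \<kappa> r / \<kappa> (r + int s)" for s
  proof (induction s)
    case (Suc s)
    have "y' (r + int (Suc s)) = x (r + int s) * \<kappa> (r + int s) / \<kappa> (r + int (Suc s))"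
      by (simp add: y'_def algebra_simps)
    then show ?case
      using Suc kappa_nonzero[of "r + int s"] by (simp add: A_def algebra_simps)
  qed (use kappa_nonzero[of r] in \<open>simp add: A_def\<close>)
  have x'_prod: "(\<Prod>t=s + 1..p. x' (r + int t)) = B (s + 2) * \<kappa> r / \<kappa> (r + int s + 1)" if "s \<le> p" for s
    using that
  proof (induction rule: inc_induct)
    case base
    have "\<kappa> (r + int p + 1) = \<kappa> r" using kappa_periodic[of r] by (simp add: p algebra_simps)
    then show ?case using kappa_nonzero[of r] by (simp add: B_def p)
  next
    case (step s)
    have "(\<Prod>t=s + 1..p. x' (r + int t)) = x' (r + int s + 1) * (\<Prod>t=Suc s + 1..p. x' (r + int t))"
      using step.hyps by (subst prod.atLeast_Suc_atMost) (auto simp: algebra_simps)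
    moreover have "B (s + 2) = y (r + int s + 2) * B (Suc s + 2)"
      using step.hyps unfolding B_def p
      by (subst prod.atLeast_Suc_atMost) (auto simp: algebra_simps)
    moreover have "x' (r + int s + 1) = y (r + int s + 2) * \<kappa> (r + int s + 2) / \<kappa> (r + int s + 1)"
      by (simp add: x'_def algebra_simps)
    moreover have "r + int (Suc s) + 1 = r + int s + 2" by simp
    ultimately show ?case
      using step.IH kappa_nonzero[of "r + int s + 2"] by (simp add: algebra_simps)
  qed
  have telescope: "(Y - X) * (A s * B (s + 2) / (\<kappa> (r + int s) * \<kappa> (r + int s + 1))) = G s - G (Suc s)"
    if "s \<le> p" for s
  proof -
    have "B (s + 1) = y (r + int s + 1) * B (s + 2)"
      using that unfolding B_def p by (subst prod.atLeast_Suc_atMost) (auto simp: algebra_simps)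
    moreover have "A (Suc s) = A s * x (r + int s)" by (simp add: A_def)
    moreover have "r + int (Suc s) = r + int s + 1" by simp
    ultimately have "G s - G (Suc s) = A s * B (s + 2) *
        (y (r + int s + 1) * \<kappa> (r + int s + 1) - x (r + int s) * \<kappa> (r + int s))
        / (\<kappa> (r + int s) * \<kappa> (r + int s + 1))"
      using kappa_nonzero[of "r + int s"] kappa_nonzero[of "r + int s + 1"]
      by (simp add: G_def field_simps)
    then show ?thesis unfolding kappa_cross by (simp add: mult_ac)
  qed
  have "(Y - X) * kappa n x' y' r
      = (\<Sum>s=0..p. (Y - X) * ((A s * \<kappa> r / \<kappa> (r + int s)) * (B (s + 2) * \<kappa> r / \<kappa> (r + int s + 1))))"
    unfolding kappa_def np sum_distrib_left
    using y'_prod x'_prod by (intro sum.cong) auto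
  also have "\<dots> = (\<Sum>s=0..p. \<kappa> r ^ 2 * (G s - G (Suc s)))"
  proof (rule sum.cong[OF refl])
    fix s assume "s \<in> {0..p}"
    then show "(Y - X) * ((A s * \<kappa> r / \<kappa> (r + int s)) * (B (s + 2) * \<kappa> r / \<kappa> (r + int s + 1)))
        = \<kappa> r ^ 2 * (G s - G (Suc s))"
      by (subst telescope[symmetric]) (simp_all add: power2_eq_square)
  qed
  also have "\<dots> = \<kappa> r ^ 2 * (G 0 - G n)"
    unfolding sum_distrib_left[symmetric] p
    using sum_Suc_diff[of 0 p "\<lambda>s. - G s"] by simp
  also have "G 0 - G n = (Y - X) / \<kappa> r"
  proof -
    have "B 1 = Y" unfolding B_def Y_def using prod_periodic_shift[of y n r] y by simp
    moreover have "A n = X" unfolding A_def X_def using prod_periodic_window[of x n r] x by simp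
    ultimately show ?thesis
      by (simp add: G_def kappa_periodic diff_divide_distrib) (simp add: A_def B_def)
  qed
  finally have "(Y - X) * kappa n x' y' r = (Y - X) * \<kappa> r"
    using kappa_nonzero[of r] by (simp add: power2_eq_square)
  then show ?thesis using assms by simp
qed

lemma R_matrix_involution:
  assumes "X \<noteq> Y"
  shows "y' (r + 1) * kappa n x' y' (r + 1) / kappa n x' y' r = x r"
    and "x' (r - 1) * kappa n x' y' (r - 1) / kappa n x' y' r = y r"
  using kappa_nonzero[of r] kappa_nonzero[of "r + 1"] kappa_nonzero[of "r - 1"]
  unfolding kappa_preserved[OF assms] by (simp_all add: x'_def y'_def)

end

section \<open>Evaluating polynomials and specialising fractions\<close>

definition meval :: "(complex \<Rightarrow> 'a::comm_ring_1) \<Rightarrow> ('v \<Rightarrow> 'a) \<Rightarrow> 'v cpoly \<Rightarrow> 'a" where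
  "meval h f p = (\<Sum>a\<in>Poly_Mapping.keys p. h (Poly_Mapping.lookup p a) *
     (\<Prod>v\<in>Poly_Mapping.keys a. f v ^ Poly_Mapping.lookup a v))"

lemma eval_cpoly_eq_meval: "eval_cpoly f p = meval const_rf f p"
  by (simp add: eval_cpoly_def meval_def)

locale ring_map =
  fixes h :: "'r::comm_ring_1 \<Rightarrow> 'b::comm_ring_1"
  assumes zero [simp]: "h 0 = 0" and one [simp]: "h 1 = 1"
    and add: "h (a + b) = h a + h b" and mult: "h (a * b) = h a * h b"

lemma ring_map_const_rf: "ring_map const_rf"
  by unfold_locales (simp_all add: const_rf_def single_add mult_single flip: to_fract_add to_fract_mult)

lemma ring_map_id: "ring_map (\<lambda>c. c)"
  by unfold_locales simp_all

lemma monomial_add: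
  fixes f :: "'v \<Rightarrow> 'c::comm_ring_1"
  shows "(\<Prod>v\<in>Poly_Mapping.keys (a + b). f v ^ Poly_Mapping.lookup (a + b) v) =
    (\<Prod>v\<in>Poly_Mapping.keys a. f v ^ Poly_Mapping.lookup a v) *
    (\<Prod>v\<in>Poly_Mapping.keys b. f v ^ Poly_Mapping.lookup b v)"
proof -
  let ?S = "Poly_Mapping.keys a \<union> Poly_Mapping.keys b"
  have S: "(\<Prod>v\<in>Poly_Mapping.keys c. f v ^ Poly_Mapping.lookup c v) = (\<Prod>v\<in>?S. f v ^ Poly_Mapping.lookup c v)"
    if "Poly_Mapping.keys c \<subseteq> ?S" for c
    using that by (intro prod.mono_neutral_left) (auto simp: in_keys_iff)
  show ?thesis
    using S[of a] S[of b] S[of "a + b"] keys_add[of a b]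
    by (simp add: lookup_add power_add prod.distrib)
qed

lemma cpoly_sum_monomials:
  fixes p :: "'a \<Rightarrow>\<^sub>0 'b::comm_monoid_add"
  shows "p = (\<Sum>a\<in>Poly_Mapping.keys p. Poly_Mapping.single a (Poly_Mapping.lookup p a))"
proof (rule poly_mapping_eqI)
  fix k
  have "Poly_Mapping.lookup (\<Sum>a\<in>Poly_Mapping.keys p. Poly_Mapping.single a (Poly_Mapping.lookup p a)) k
      = (\<Sum>a\<in>Poly_Mapping.keys p. if a = k then Poly_Mapping.lookup p k else 0)"
    unfolding lookup_sum by (rule sum.cong) (auto simp: lookup_single when_def)
  then show "Poly_Mapping.lookup p k =
      Poly_Mapping.lookup (\<Sum>a\<in>Poly_Mapping.keys p. Poly_Mapping.single a (Poly_Mapping.lookup p a)) k"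
    by (simp add: not_in_keys_iff_lookup_eq_zero)
qed

lemma meval_var: "h 1 = 1 \<Longrightarrow>
    meval h f (Poly_Mapping.single (Poly_Mapping.single v 1) 1) = f v"
  by (simp add: meval_def)

context
  fixes h :: "complex \<Rightarrow> 'a::comm_ring_1"
  assumes h: "ring_map h"
begin

interpretation ring_map h by (rule h)

lemma meval_superset:
  assumes "finite S" "Poly_Mapping.keys p \<subseteq> S"
  shows "meval h f p = (\<Sum>a\<in>S. h (Poly_Mapping.lookup p a) *
     (\<Prod>v\<in>Poly_Mapping.keys a. f v ^ Poly_Mapping.lookup a v))"
  unfolding meval_def using assms by (intro sum.mono_neutral_left) (auto simp: in_keys_iff)

lemma meval_add: "meval h f (p + q) = meval h f p + meval h f q"
proof -
  let ?S = "Poly_Mapping.keys p \<union> Poly_Mapping.keys q"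
  show ?thesis
    using meval_superset[of ?S p f] meval_superset[of ?S q f] meval_superset[of ?S "p + q" f]
      keys_add[of p q]
    by (simp add: lookup_add add distrib_right sum.distrib)
qed

lemma meval_0 [simp]: "meval h f 0 = 0" by (simp add: meval_def)

lemma meval_sum: "meval h f (sum g A) = (\<Sum>a\<in>A. meval h f (g a))"
  by (induction A rule: infinite_finite_induct) (auto simp: meval_add)

lemma meval_single: "meval h f (Poly_Mapping.single a c) =
    h c * (\<Prod>v\<in>Poly_Mapping.keys a. f v ^ Poly_Mapping.lookup a v)"
  by (simp add: meval_def)

lemma meval_const [simp]: "meval h f (Poly_Mapping.single 0 c) = h c"
  by (simp add: meval_single)

lemma meval_1 [simp]: "meval h f 1 = 1"
  by (subst single_one[symmetric]) (simp del: single_one)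

lemma meval_mult: "meval h f (p * q) = meval h f p * meval h f q"
proof -
  let ?m = "\<lambda>a. \<Prod>v\<in>Poly_Mapping.keys a. f v ^ Poly_Mapping.lookup a v"
  have "meval h f (p * q) = meval h f
      ((\<Sum>a\<in>Poly_Mapping.keys p. Poly_Mapping.single a (Poly_Mapping.lookup p a)) *
       (\<Sum>b\<in>Poly_Mapping.keys q. Poly_Mapping.single b (Poly_Mapping.lookup q b)))"
    using cpoly_sum_monomials[of p] cpoly_sum_monomials[of q] by simp
  also have "\<dots> = (\<Sum>a\<in>Poly_Mapping.keys p. \<Sum>b\<in>Poly_Mapping.keys q.
      (h (Poly_Mapping.lookup p a) * ?m a) * (h (Poly_Mapping.lookup q b) * ?m b))"
    by (simp add: sum_product mult_single meval_sum meval_single monomial_add mult mult.assoc mult.left_commute)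
  also have "\<dots> = meval h f p * meval h f q"
    by (simp add: meval_def sum_product)
  finally show ?thesis .
qed

lemma ring_map_meval: "ring_map (meval h f)"
  by unfold_locales (simp_all add: meval_add meval_mult)

end

lemma to_fract_sum: "to_fract (sum f A) = (\<Sum>a\<in>A. to_fract (f a))"
  by (induction A rule: infinite_finite_induct) auto

lemma to_fract_prod: "to_fract (prod f A) = (\<Prod>a\<in>A. to_fract (f a))"
  by (induction A rule: infinite_finite_induct) auto

lemma to_fract_power: "to_fract (p ^ k) = to_fract p ^ k"
  by (induction k) auto

lemma single_prod_powers:
  fixes a :: "'v \<Rightarrow>\<^sub>0 nat"
  shows "(\<Prod>v\<in>Poly_Mapping.keys a. Poly_Mapping.single (Poly_Mapping.single v 1) (1::complex) ^ Poly_Mapping.lookup a v)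
    = Poly_Mapping.single a 1"
proof -
  have power: "Poly_Mapping.single (Poly_Mapping.single v 1) (1::complex) ^ k
      = Poly_Mapping.single (Poly_Mapping.single v k) 1" for v :: 'v and k :: nat
    by (induction k) (simp_all add: mult_single flip: single_add)
  have prod_single: "(\<Prod>v\<in>S. Poly_Mapping.single (g v) (1::complex)) = Poly_Mapping.single (\<Sum>v\<in>S. g v) 1"
    if "finite S" for S :: "'v set" and g :: "'v \<Rightarrow> 'v \<Rightarrow>\<^sub>0 nat"
    using that by (induction S) (auto simp: mult_single)
  show ?thesis
    unfolding power
    by (simp only: prod_single finite_keys cpoly_sum_monomials[of a, symmetric])
qed

lemma meval_variables: "meval const_rf var_rf p = to_fract p"
proof -
  have mono: "(\<Prod>v\<in>Poly_Mapping.keys a. var_rf v ^ Poly_Mapping.lookup a v) = to_fract (Poly_Mapping.single a 1)"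
    for a
    by (subst single_prod_powers[of a, symmetric]) (simp only: var_rf_def to_fract_prod to_fract_power)
  have "meval const_rf var_rf p = (\<Sum>a\<in>Poly_Mapping.keys p.
      to_fract (Poly_Mapping.single 0 (Poly_Mapping.lookup p a) * Poly_Mapping.single a 1))"
    unfolding meval_def mono const_rf_def to_fract_mult ..
  also have "\<dots> = to_fract p"
    using cpoly_sum_monomials[of p] by (simp add: mult_single flip: to_fract_sum)
  finally show ?thesis .
qed

text \<open>
  A ring homomorphism \<open>H\<close> from an integral domain to a field extends to those fractions whose
  denominator is not killed by \<open>H\<close>.  As this extension is only partially defined, it is treated as a
  relation that is compatible with the field operations.
\<close>

locale specialization = ring_map H for H :: "'r::idom \<Rightarrow> 'b::field"
begin

definition specializes :: "'r fract \<Rightarrow> 'b \<Rightarrow> bool" where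
  "specializes f z \<longleftrightarrow> (\<exists>P Q. H Q \<noteq> 0 \<and> f = to_fract P / to_fract Q \<and> z = H P / H Q)"

lemma H_uminus: "H (- a) = - H a"
  using add[of a "- a"] by (simp add: eq_neg_iff_add_eq_0 add.commute)

lemma nonzero: "H Q \<noteq> 0 \<Longrightarrow> to_fract Q \<noteq> 0"
  by auto

lemma specializes_to_fract: "specializes (to_fract P) (H P)"
  unfolding specializes_def by (intro exI[of _ P] exI[of _ 1]) simp

lemma specializes_0: "specializes 0 0" using specializes_to_fract[of 0] by simp
lemma specializes_1: "specializes 1 1" using specializes_to_fract[of 1] by simp

lemma specializes_unique:
  assumes "specializes f z" "specializes f z'"
  shows "z = z'"
proof -
  obtain P Q where Q: "H Q \<noteq> 0" and f: "f = to_fract P / to_fract Q" and z: "z = H P / H Q"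
    using assms(1) specializes_def by auto
  obtain P' Q' where Q': "H Q' \<noteq> 0" and f': "f = to_fract P' / to_fract Q'" and z': "z' = H P' / H Q'"
    using assms(2) specializes_def by auto
  have "to_fract (P * Q') = to_fract (P' * Q)"
    using f f' nonzero[OF Q] nonzero[OF Q'] by (simp add: frac_eq_eq)
  then have "P * Q' = P' * Q" by (simp only: to_fract_eq_iff)
  then have "H P * H Q' = H P' * H Q" by (metis mult)
  then show ?thesis using Q Q' z z' by (simp add: frac_eq_eq)
qed

lemma specializes_add:
  assumes "specializes f z" "specializes g w"
  shows "specializes (f + g) (z + w)"
proof -
  obtain P Q where Q: "H Q \<noteq> 0" and f: "f = to_fract P / to_fract Q" and z: "z = H P / H Q"
    using assms(1) specializes_def by auto
  obtain P' Q' where Q': "H Q' \<noteq> 0" and g: "g = to_fract P' / to_fract Q'" and w: "w = H P' / H Q'"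
    using assms(2) specializes_def by auto
  show ?thesis
    unfolding specializes_def
    by (intro exI[of _ "P * Q' + P' * Q"] exI[of _ "Q * Q'"])
      (use Q Q' nonzero[OF Q] nonzero[OF Q'] in \<open>simp add: f g z w add mult add_frac_eq\<close>)
qed

lemma specializes_mult:
  assumes "specializes f z" "specializes g w"
  shows "specializes (f * g) (z * w)"
proof -
  obtain P Q where Q: "H Q \<noteq> 0" and f: "f = to_fract P / to_fract Q" and z: "z = H P / H Q"
    using assms(1) specializes_def by auto
  obtain P' Q' where Q': "H Q' \<noteq> 0" and g: "g = to_fract P' / to_fract Q'" and w: "w = H P' / H Q'"
    using assms(2) specializes_def by auto
  show ?thesis
    unfolding specializes_def
    by (intro exI[of _ "P * P'"] exI[of _ "Q * Q'"]) (use Q Q' in \<open>simp add: f g z w mult\<close>)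
qed

lemma specializes_uminus:
  assumes "specializes f z" shows "specializes (- f) (- z)"
proof -
  obtain P Q where "H Q \<noteq> 0" and "f = to_fract P / to_fract Q" and "z = H P / H Q"
    using assms specializes_def by auto
  then show ?thesis
    unfolding specializes_def
    by (intro exI[of _ "- P"] exI[of _ Q]) (simp add: H_uminus)
qed

lemma specializes_inverse:
  assumes "specializes f z" "z \<noteq> 0" shows "specializes (inverse f) (inverse z)"
proof -
  obtain P Q where "H Q \<noteq> 0" and "f = to_fract P / to_fract Q" and "z = H P / H Q"
    using assms specializes_def by auto
  then show ?thesis
    unfolding specializes_def using assms(2)
    by (intro exI[of _ Q] exI[of _ P]) simp
qed

lemma specializes_divide:
  "specializes f z \<Longrightarrow> specializes g w \<Longrightarrow> w \<noteq> 0 \<Longrightarrow> specializes (f / g) (z / w)"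
  unfolding divide_inverse by (intro specializes_mult specializes_inverse)

lemma specializes_sum:
  "(\<And>a. a \<in> A \<Longrightarrow> specializes (f a) (z a)) \<Longrightarrow> specializes (sum f A) (sum z A)"
  by (induction A rule: infinite_finite_induct) (auto intro: specializes_add specializes_0)

lemma specializes_prod:
  "(\<And>a. a \<in> A \<Longrightarrow> specializes (f a) (z a)) \<Longrightarrow> specializes (prod f A) (prod z A)"
  by (induction A rule: infinite_finite_induct) (auto intro: specializes_mult specializes_1)

lemma specializes_power: "specializes f z \<Longrightarrow> specializes (f ^ k) (z ^ k)"
  by (induction k) (auto intro: specializes_mult specializes_1)

lemma specializes_kappa:
  assumes "\<And>r. specializes (x r) (x' r)" "\<And>r. specializes (y r) (y' r)"
  shows "specializes (kappa n x y r) (kappa n x' y' r)"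
  unfolding kappa_def using assms by (intro specializes_sum specializes_mult specializes_prod)

lemma specializes_loop_e:
  assumes "\<And>i r. i \<in> {1..m} \<Longrightarrow> specializes (x i r) (z i r)"
  shows "specializes (loop_e m x r s) (loop_e m z r s)"
  unfolding loop_e_def
proof (intro specializes_sum specializes_prod)
  fix "is" k assume "is \<in> {is. length is = r \<and> sorted_wrt (<) is \<and> set is \<subseteq> {1..m}}" "k \<in> {..<r}"
  then have "is ! k \<in> {1..m}" using nth_mem[of k "is"] by blast
  then show "specializes (x (is ! k) (s + int k)) (z (is ! k) (s + int k))" by (rule assms)
qed

lemma specializes_multiplier:
  assumes "\<And>r. specializes (u r) (w r)" "\<And>r. w r \<noteq> 0"
  shows "specializes (multiplier n u) (multiplier n w)"
  unfolding multiplier_def kernel_seq_def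
  using assms by (intro specializes_prod specializes_uminus specializes_inverse)

end

lemma (in specialization) specializes_meval:
  assumes "\<And>c. specializes (k c) (h c)" "\<And>v. specializes (f v) (z v)"
  shows "specializes (meval k f p) (meval h z p)"
  unfolding meval_def
  by (intro specializes_sum specializes_mult specializes_prod specializes_power assms)

locale injective_specialization = specialization +
  assumes injective: "H P = 0 \<Longrightarrow> P = 0"
begin

definition extension where "extension f = (THE z. specializes f z)"

lemma specializes_extension: "specializes f (extension f)"
proof -
  obtain P Q where PQ: "f = Fract P Q" "Q \<noteq> 0" by (cases f) auto
  then have "specializes f (H P / H Q)"
    unfolding specializes_def using injective Fract_conv_to_fract by blast
  then show ?thesis
    unfolding extension_def using specializes_unique by (metis theI)
qed

lemma extension_eqI: "specializes f z \<Longrightarrow> extension f = z"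
  using specializes_unique specializes_extension by blast

lemma extension_add: "extension (f + g) = extension f + extension g"
  by (intro extension_eqI specializes_add specializes_extension)

lemma extension_mult: "extension (f * g) = extension f * extension g"
  by (intro extension_eqI specializes_mult specializes_extension)

end

section \<open>The coordinates as elements of the function field\<close>

lemma coord_periodic: "coord n i (r + int n) = coord n i r"
  by (simp add: coord_def)

lemma coord_nonzero: "coord n i r \<noteq> 0"
proof -
  have "Poly_Mapping.lookup (Poly_Mapping.single (Poly_Mapping.single v 1) (1::complex))
      (Poly_Mapping.single v (1::nat)) \<noteq> 0" for v :: nat
    by simp
  then show ?thesis unfolding coord_def var_rf_def by (metis lookup_zero to_fract_eq_0_iff)
qed

definition family_values :: "(nat \<Rightarrow> int \<Rightarrow> 'a) \<Rightarrow> nat \<Rightarrow> 'a" where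
  "family_values z v = (case prod_decode v of (i, r) \<Rightarrow> z i (int r))"

lemma specialization_meval: "ring_map h \<Longrightarrow> specialization (meval h f)"
  by (simp add: specialization_def ring_map_meval)

lemma coord_specializes:
  assumes h: "ring_map h" and n: "n > 0" and z: "\<And>r. z i (r + int n) = z i r"
  shows "specialization.specializes (meval h (family_values z)) (coord n i r) (z i r)"
proof -
  interpret specialization "meval h (family_values z)"
    by (rule specialization_meval[OF h])
  let ?v = "prod_encode (i, nat (r mod int n))"
  have "specializes (coord n i r) (meval h (family_values z) (Poly_Mapping.single (Poly_Mapping.single ?v 1) 1))"
    unfolding coord_def var_rf_def by (rule specializes_to_fract)
  also have "meval h (family_values z) (Poly_Mapping.single (Poly_Mapping.single ?v 1) 1) = z i (r mod int n)"
    using n ring_map.one[OF h] by (subst meval_var) (auto simp: family_values_def)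
  also have "\<dots> = z i r" by (rule int_periodic_mod[of "z i", OF z])
  finally show ?thesis .
qed

lemma multiplier_const: "multiplier n (\<lambda>r. c) = (- inverse c) ^ n"
  by (simp add: multiplier_def kernel_seq_def)

text \<open>
  Evaluate at the point where \<open>x_i\<close> is constantly \<open>2\<close> and all other families are constantly \<open>1\<close>.
\<close>

lemma coord_multipliers_distinct:
  assumes n: "n > 0" and eq: "multiplier n (coord n i) = multiplier n (coord n j)"
  shows "i = j"
proof (rule ccontr)
  assume ij: "i \<noteq> j"
  define z :: "nat \<Rightarrow> int \<Rightarrow> complex" where "z k r = (if k = i then 2 else 1)" for k r
  interpret specialization "meval (\<lambda>c. c) (family_values z)"
    by (rule specialization_meval[OF ring_map_id])
  have "specializes (coord n k r) (z k r)" for k r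
    by (rule coord_specializes[OF ring_map_id n]) (simp add: z_def)
  then have spec: "specializes (multiplier n (coord n k)) (multiplier n (z k))" for k
    by (rule specializes_multiplier) (simp add: z_def)
  have "multiplier n (z i) = multiplier n (z j)"
    by (rule specializes_unique[OF spec[of i, unfolded eq] spec[of j]])
  moreover have "z i = (\<lambda>r. 2)" "z j = (\<lambda>r. 1)"
    using ij by (simp_all add: z_def fun_eq_iff)
  ultimately have "(- inverse 2) ^ n = (- inverse 1 :: complex) ^ n"
    by (simp only: multiplier_const)
  then have "norm ((- inverse 2 :: complex) ^ n) = norm ((- inverse 1 :: complex) ^ n)"
    by (rule arg_cong)
  moreover have "norm (- inverse 2 :: complex) = 1 / 2" "norm (- inverse 1 :: complex) = 1"
    by (simp_all add: norm_divide)
  ultimately have "(1 / 2 :: real) ^ n = 1 ^ n" by (simp only: norm_power)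
  moreover have "(1 / 2 :: real) ^ n < 1 ^ n" using n by (intro power_strict_mono) simp_all
  ultimately show False by simp
qed

text \<open>
  At the point with all coordinates \<open>1\<close>, the polynomial takes the value \<open>n\<close>.
\<close>

lemma kappa_coord_nonzero:
  assumes n: "n > 0"
  shows "kappa n (coord n i) (coord n j) r \<noteq> 0"
proof
  assume 0: "kappa n (coord n i) (coord n j) r = 0"
  define z :: "nat \<Rightarrow> int \<Rightarrow> complex" where "z = (\<lambda>k r. 1)"
  interpret specialization "meval (\<lambda>c. c) (family_values z)"
    by (rule specialization_meval[OF ring_map_id])
  have "specializes (coord n k r) (z k r)" for k r
    by (rule coord_specializes[OF ring_map_id n]) (simp add: z_def)
  then have "specializes (kappa n (coord n i) (coord n j) r) (kappa n (z i) (z j) r)"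
    by (intro specializes_kappa)
  then have "kappa n (z i) (z j) r = 0"
    using specializes_unique specializes_0 0 by metis
  moreover have "kappa n (z i) (z j) r = of_nat n"
    using n by (simp add: kappa_def z_def)
  ultimately show False using n by simp
qed

section \<open>The R-matrix endomorphisms\<close>

locale R_matrix =
  fixes n j :: nat
  assumes n_pos: "n > 0"
begin

sublocale kappa_units n "coord n j" "coord n (Suc j)" "kappa n (coord n j) (coord n (Suc j))"
  "\<Prod>k<n. coord n j (int k)" "\<Prod>k<n. coord n (Suc j) (int k)"
  by unfold_locales (auto simp: n_pos coord_periodic kappa_coord_nonzero)

lemma products_distinct: "(\<Prod>k<n. coord n j (int k)) \<noteq> (\<Prod>k<n. coord n (Suc j) (int k))"
proof
  assume eq: "(\<Prod>k<n. coord n j (int k)) = (\<Prod>k<n. coord n (Suc j) (int k))"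
  have "multiplier n (coord n i) = (- 1) ^ n * inverse (\<Prod>k<n. coord n i (int k))" for i
  proof -
    have "multiplier n (coord n i) = (\<Prod>k<n. (- 1) * inverse (coord n i (int k)))"
      by (simp add: multiplier_def kernel_seq_def)
    also have "\<dots> = (- 1) ^ n * (\<Prod>k<n. inverse (coord n i (int k)))"
      by (simp only: prod.distrib prod_constant card_lessThan)
    also have "(\<Prod>k<n. inverse (coord n i (int k))) = inverse (\<Prod>k<n. coord n i (int k))"
      by (simp add: prod_inversef[symmetric] o_def)
    finally show ?thesis .
  qed
  then have "multiplier n (coord n j) = multiplier n (coord n (Suc j))" using eq by simp
  then show False using coord_multipliers_distinct[OF n_pos] by fastforce
qed

definition swapped :: "nat \<Rightarrow> int \<Rightarrow> ratfun" where
  "swapped i = (if i = j then x' else if i = Suc j then y' else coord n i)"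

lemma swapped_periodic: "swapped i (r + int n) = swapped i r"
  by (simp add: swapped_def x'_periodic y'_periodic coord_periodic)

text \<open>
  The numbers \<open>prod_encode (i, r)\<close> with \<open>r \<ge> n\<close> do not belong to any coordinate; the corresponding
  variables stay fixed, so that the substitution is an involution on all variables.
\<close>

definition substituted :: "nat \<Rightarrow> ratfun" where
  "substituted v = (if snd (prod_decode v) < n then family_values swapped v else var_rf v)"

definition substitute :: "nat cpoly \<Rightarrow> ratfun" where
  "substitute = meval const_rf substituted"

sublocale specialization substitute
  unfolding substitute_def by (rule specialization_meval[OF ring_map_const_rf])

lemma specializes_const: "specializes (const_rf c) (const_rf c)"
  using specializes_to_fract[of "Poly_Mapping.single 0 c"]
  by (simp only: substitute_def meval_const[OF ring_map_const_rf] const_rf_def[symmetric])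

lemma specializes_var: "specializes (var_rf v) (substituted v)"
  using specializes_to_fract[of "Poly_Mapping.single (Poly_Mapping.single v 1) 1"]
    ring_map.one[OF ring_map_const_rf]
  by (simp only: substitute_def var_rf_def[symmetric] meval_var)

lemma specializes_coord: "specializes (coord n i r) (swapped i r)"
proof -
  have "specializes (coord n i r) (substituted (prod_encode (i, nat (r mod int n))))"
    unfolding coord_def by (rule specializes_var)
  also have "substituted (prod_encode (i, nat (r mod int n))) = swapped i (r mod int n)"
    using n_pos by (simp add: substituted_def family_values_def nat_less_iff)
  also have "\<dots> = swapped i r"
    by (rule int_periodic_mod[of "swapped i", OF swapped_periodic])
  finally show ?thesis .
qed

text \<open>
  Applying the substitution twice gives back the coordinates: this is \<open>R_matrix_involution\<close>.
\<close>

lemma swapped_specializes: "specializes (swapped i r) (coord n i r)"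
proof -
  have swapped: "swapped j = x'" "swapped (Suc j) = y'" by (simp_all add: swapped_def)
  have coords: "specializes (coord n j r) (x' r)" "specializes (coord n (Suc j) r) (y' r)" for r
    using specializes_coord[of j r] specializes_coord[of "Suc j" r] by (simp_all only: swapped)
  then have kappa: "specializes (kappa n (coord n j) (coord n (Suc j)) r) (kappa n x' y' r)" for r
    by (intro specializes_kappa)
  have nonzero: "kappa n x' y' r \<noteq> 0" for r
    using kappa_preserved[OF products_distinct] kappa_nonzero by simp
  have "specializes (x' r) (y' (r + 1) * kappa n x' y' (r + 1) / kappa n x' y' r)"
    by (subst x'_def) (intro specializes_divide specializes_mult kappa nonzero coords)
  moreover have "specializes (y' r) (x' (r - 1) * kappa n x' y' (r - 1) / kappa n x' y' r)"
    by (subst y'_def) (intro specializes_divide specializes_mult kappa nonzero coords)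
  moreover have "specializes (coord n i r) (coord n i r)" if "i \<noteq> j" "i \<noteq> Suc j"
    using specializes_coord[of i r] that by (simp add: swapped_def)
  ultimately show ?thesis
    using R_matrix_involution[OF products_distinct] by (simp add: swapped_def)
qed

lemma substituted_specializes: "specializes (substituted v) (var_rf v)"
proof (cases "snd (prod_decode v) < n")
  case True
  obtain i r where v: "prod_decode v = (i, r)" by fastforce
  moreover have "prod_encode (i, r) = v" using prod_decode_inverse[of v] v by simp
  ultimately have "coord n i (int r) = var_rf v"
    using True by (simp add: coord_def)
  then show ?thesis
    using swapped_specializes[of i "int r"] True v
    by (simp add: substituted_def family_values_def)
next
  case False
  then show ?thesis using specializes_var[of v] by (simp add: substituted_def)
qed

lemma substitute_specializes: "specializes (substitute p) (to_fract p)"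
proof -
  have "specializes (meval const_rf substituted p) (meval const_rf var_rf p)"
    by (rule specializes_meval) (rule specializes_const substituted_specializes)+
  then show ?thesis by (simp add: substitute_def meval_variables)
qed

text \<open>
  A substitution that is undone by repeating it cannot kill a nonzero polynomial, and therefore
  extends to all rational functions.
\<close>

sublocale injective_specialization substitute
proof
  fix p assume "substitute p = 0"
  then have "to_fract p = 0"
    using substitute_specializes[of p] specializes_0 specializes_unique by metis
  then show "p = 0" by simp
qed

lemma hom_UNIV: "complex_hom_on UNIV extension"
  unfolding complex_hom_on_def
  by (auto simp: extension_add extension_mult intro: extension_eqI specializes_const)

lemma extension_coord: "extension (coord n i r) = swapped i r"
  by (rule extension_eqI[OF specializes_coord])

end

section \<open>Lifting permutations of the multipliers\<close>

definition loop_generators :: "nat \<Rightarrow> nat \<Rightarrow> ratfun set" where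
  "loop_generators n m = {loop_e m (coord n) r s | r s. r \<in> {1..m}}"

lemma loop_e_mem:
  assumes "subfield_set K" "loop_generators n m \<subseteq> K"
  shows "loop_e m (coord n) r s \<in> K"
proof -
  interpret subfield_set K by (rule assms)
  consider "r = 0" | "r \<in> {1..m}" | "r > m" by fastforce
  then show ?thesis
    using assms(2) by cases (auto simp: loop_generators_def loop_e_eq_0)
qed

lemma periodic_units_coord: "periodic_units n m (coord n)"
  by (simp add: periodic_units_def coord_periodic coord_nonzero)

lemma complex_subfield_ratfun_field: "complex_subfield (ratfun_field n m)"
  unfolding ratfun_field_def by (rule complex_subfield_adjoin)

lemma subfield_ratfun_field: "subfield_set (ratfun_field n m)"
  using complex_subfield_ratfun_field complex_subfield_iff by blast

lemma coord_mem: "i \<in> {1..m} \<Longrightarrow> coord n i r \<in> ratfun_field n m"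
  unfolding ratfun_field_def
  using adjoin_superset[of "{coord n i r | i r. i \<in> {1..m}}"] by blast

lemma (in subfield_set) loop_e_closed:
  assumes "\<And>i r. i \<in> {1..m} \<Longrightarrow> x i r \<in> F"
  shows "loop_e m x r s \<in> F"
  using assms
proof (induction m arbitrary: r)
  case 0
  then show ?case by (cases r) auto
next
  case (Suc m)
  have low: "loop_e m x r s \<in> F" for r by (rule Suc.IH) (use Suc.prems in auto)
  show ?case
    using Suc.prems[of "Suc m"] low
    by (cases r) (auto simp: loop_e_Suc_Suc intro!: add_mem mult_mem)
qed

lemma (in subfield_set) multiplier_closed: "(\<And>r. u r \<in> F) \<Longrightarrow> multiplier n u \<in> F"
  by (simp add: multiplier_def kernel_seq_def prod_mem uminus_mem inverse_mem)

lemma (in subfield_set) kappa_closed: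
  "(\<And>r. x r \<in> F) \<Longrightarrow> (\<And>r. y r \<in> F) \<Longrightarrow> kappa n x y r \<in> F"
  by (simp add: kappa_def sum_mem mult_mem prod_mem)

lemma (in ratfun_hom) map_loop_e:
  assumes "\<And>i r. i \<in> {1..m} \<Longrightarrow> x i r \<in> L"
  shows "\<phi> (loop_e m x r s) = loop_e m (\<lambda>i r. \<phi> (x i r)) r s"
  using assms
proof (induction m arbitrary: r)
  case 0
  then show ?case by (cases r) auto
next
  case (Suc m)
  have low: "loop_e m x r s \<in> L" "\<phi> (loop_e m x r s) = loop_e m (\<lambda>i r. \<phi> (x i r)) r s" for r
    using Suc by (auto intro: loop_e_closed)
  have top: "x (Suc m) r \<in> L" for r using Suc.prems by simp
  show ?case
    by (cases r) (simp_all add: loop_e_Suc_Suc low top map_add map_mult mult_mem)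
qed

lemma (in ratfun_hom) map_multiplier:
  "(\<And>r. u r \<in> L) \<Longrightarrow> \<phi> (multiplier n u) = multiplier n (\<lambda>r. \<phi> (u r))"
  by (simp add: multiplier_def kernel_seq_def map_prod map_uminus map_inverse uminus_mem inverse_mem)

lemma loop_generators_subset: "loop_generators n m \<subseteq> ratfun_field n m"
proof -
  have "loop_e m (coord n) r s \<in> ratfun_field n m" for r s
    by (rule subfield_set.loop_e_closed[OF subfield_ratfun_field]) (rule coord_mem)
  then show ?thesis by (auto simp: loop_generators_def)
qed

lemma coord_multiplier_mem: "i \<in> {1..m} \<Longrightarrow> multiplier n (coord n i) \<in> ratfun_field n m"
  by (rule subfield_set.multiplier_closed[OF subfield_ratfun_field coord_mem])

text \<open>
  The coordinates are rational in the loop elementary symmetric functions and the multipliers, by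
  \<open>factors_mem\<close>.
\<close>

theorem ratfun_field_generated:
  assumes "n > 0"
  shows "complex_adjoin (loop_generators n m \<union> (\<lambda>i. multiplier n (coord n i)) ` {1..m}) = ratfun_field n m"
    (is "complex_adjoin ?S = _")
proof
  show "complex_adjoin ?S \<subseteq> ratfun_field n m"
    using loop_generators_subset coord_multiplier_mem
    by (intro adjoin_least complex_subfield_ratfun_field) auto
  have sub: "?S \<subseteq> complex_adjoin ?S" by (rule adjoin_superset)
  have "coord n i r \<in> complex_adjoin ?S" if "i \<in> {1..m}" for i r
  proof (rule subfield_set.factors_mem[OF subfield_adjoin assms periodic_units_coord _ _ _ that])
    show "loop_e m (coord n) r s \<in> complex_adjoin ?S" for r s
      by (rule loop_e_mem[OF subfield_adjoin]) (use sub in auto)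
    show "inj_on (\<lambda>i. multiplier n (coord n i)) {1..m}"
      using coord_multipliers_distinct[OF assms] by (auto intro: inj_onI)
  qed (use sub in auto)
  then show "ratfun_field n m \<subseteq> complex_adjoin ?S"
    unfolding ratfun_field_def by (intro adjoin_least complex_subfield_adjoin) auto
qed

definition lifts :: "nat \<Rightarrow> nat \<Rightarrow> (nat \<Rightarrow> nat) \<Rightarrow> (ratfun \<Rightarrow> ratfun) \<Rightarrow> bool" where
  "lifts n m w \<phi> \<longleftrightarrow> complex_hom_on (ratfun_field n m) \<phi> \<and>
     (\<forall>g\<in>loop_generators n m. \<phi> g = g) \<and>
     (\<forall>i\<in>{1..m}. \<phi> (multiplier n (coord n i)) = multiplier n (coord n (w i)))"

lemma lifts_unique:
  assumes "n > 0" "lifts n m w \<phi>" "lifts n m w \<psi>" "f \<in> ratfun_field n m"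
  shows "\<phi> f = \<psi> f"
proof (rule hom_agree_on_adjoin[where \<phi> = \<phi> and \<psi> = \<psi> and f = f, OF complex_subfield_ratfun_field[of n m]])
  show "complex_hom_on (ratfun_field n m) \<phi>" "complex_hom_on (ratfun_field n m) \<psi>"
    using assms by (auto simp: lifts_def)
  show "f \<in> complex_adjoin (loop_generators n m \<union> (\<lambda>i. multiplier n (coord n i)) ` {1..m})"
    using assms ratfun_field_generated by simp
qed (use assms loop_generators_subset coord_multiplier_mem in \<open>auto simp: lifts_def\<close>)

lemma lifts_id: "lifts n m id (\<lambda>f. f)"
  by (simp add: lifts_def complex_hom_on_id)

lemma lifts_compose:
  assumes "lifts n m w \<phi>" "lifts n m v \<psi>" "v permutes {1..m}"
  shows "lifts n m (w \<circ> v) (\<lambda>f. \<phi> (\<psi> f))"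
  using assms complex_hom_on_compose[of "ratfun_field n m" \<phi> \<psi>] permutes_in_image[OF assms(3)]
  by (simp add: lifts_def)

lemma lifts_cong:
  assumes "lifts n m w \<phi>" "\<And>f. f \<in> ratfun_field n m \<Longrightarrow> \<psi> f = \<phi> f"
  shows "lifts n m w \<psi>"
proof -
  interpret subfield_set "ratfun_field n m" by (rule subfield_ratfun_field)
  have "const_rf c \<in> ratfun_field n m" for c
    unfolding ratfun_field_def by (rule const_mem_adjoin)
  then show ?thesis
    using assms loop_generators_subset[of n m] coord_multiplier_mem[of _ m n]
    unfolding lifts_def complex_hom_on_def
    by (auto simp: add_mem mult_mem image_subset_iff subset_iff)
qed

lemma (in R_matrix) lifts_transpose:
  assumes j: "j \<in> {1..<m}" and hom: "complex_hom_on (ratfun_field n m) \<phi>"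
    and coords: "\<And>i r. i \<in> {1..m} \<Longrightarrow> \<phi> (coord n i r) = swapped i r"
  shows "lifts n m (transpose j (Suc j)) \<phi>"
proof -
  interpret h: ratfun_hom "ratfun_field n m" \<phi>
    using complex_subfield_ratfun_field hom by unfold_locales
  have e: "\<phi> (loop_e m (coord n) r s) = loop_e m (coord n) r s" for r s
  proof -
    have "\<phi> (loop_e m (coord n) r s) = loop_e m (\<lambda>i r. \<phi> (coord n i r)) r s"
      by (rule h.map_loop_e) (rule coord_mem)
    also have "\<dots> = loop_e m swapped r s" by (rule loop_e_cong) (rule coords)
    also have "\<dots> = loop_e m (coord n) r s"
      by (rule loop_e_swap[of j])
        (use j sum_preserved product_preserved in \<open>auto simp: swapped_def\<close>)
    finally show ?thesis .
  qed
  have "\<phi> (multiplier n (coord n i)) = multiplier n (coord n (transpose j (Suc j) i))"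
    if i: "i \<in> {1..m}" for i
  proof -
    have "\<phi> (multiplier n (coord n i)) = multiplier n (swapped i)"
      using h.map_multiplier[of "coord n i" n] coord_mem[OF i] coords[OF i] by simp
    also have "\<dots> = multiplier n (coord n (transpose j (Suc j) i))"
      by (simp add: swapped_def multiplier_x' multiplier_y' transpose_def)
    finally show ?thesis .
  qed
  then show ?thesis using hom e by (auto simp: lifts_def loop_generators_def)
qed

lemma (in R_matrix) extension_hom:
  assumes j: "j \<in> {1..<m}"
  shows "complex_hom_on (ratfun_field n m) extension"
proof -
  have "complex_subfield (UNIV :: ratfun set)" by (simp add: complex_subfield_def)
  then interpret h: ratfun_hom UNIV extension using hom_UNIV by (rule ratfun_hom.intro)
  interpret subfield_set "ratfun_field n m" by (rule subfield_ratfun_field)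
  have coords: "coord n j r \<in> ratfun_field n m" "coord n (Suc j) r \<in> ratfun_field n m" for r
    using j by (auto intro!: coord_mem)
  have "x' r \<in> ratfun_field n m" "y' r \<in> ratfun_field n m" for r
    unfolding x'_def y'_def using coords by (auto intro!: divide_mem mult_mem kappa_closed)
  then have "swapped i r \<in> ratfun_field n m" if "i \<in> {1..m}" for i r
    using coord_mem[OF that] by (simp add: swapped_def)
  moreover have "complex_subfield {f. extension f \<in> ratfun_field n m}"
    unfolding complex_subfield_def
    by (auto simp: h.map_const h.map_add h.map_mult h.map_uminus h.map_inverse
        add_mem mult_mem uminus_mem inverse_mem) (simp add: ratfun_field_def const_mem_adjoin)
  ultimately have "ratfun_field n m \<subseteq> {f. extension f \<in> ratfun_field n m}"
    unfolding ratfun_field_def[of n m]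
    by (intro adjoin_least) (auto simp: extension_coord simp flip: ratfun_field_def)
  then show ?thesis using hom_UNIV by (auto simp: complex_hom_on_def)
qed

lemma (in R_matrix) lifts_extension:
  "j \<in> {1..<m} \<Longrightarrow> lifts n m (transpose j (Suc j)) extension"
  by (rule lifts_transpose) (simp_all add: extension_hom extension_coord)

text \<open>
  A transposition of \<open>a\<close> and \<open>b + 1\<close> is conjugate, by the transposition of \<open>a\<close> and \<open>b\<close>, to the adjacent
  transposition of \<open>b\<close> and \<open>b + 1\<close>.
\<close>

lemma adjacent_transpositions_generate:
  assumes w: "w permutes {1..m}" and id: "P id"
    and adj: "\<And>j. j \<in> {1..<m} \<Longrightarrow> P (transpose j (Suc j))"
    and comp: "\<And>w v. w permutes {1..m} \<Longrightarrow> v permutes {1..m} \<Longrightarrow> P w \<Longrightarrow> P v \<Longrightarrow> P (w \<circ> v)"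
  shows "P w"
proof -
  have perm: "transpose a b permutes {1..m}" if "a \<in> {1..m}" "b \<in> {1..m}" for a b
    using that by (rule permutes_swap_id)
  have far: "P (transpose a b)" if "a < b" "1 \<le> a" "b \<le> m" for a b
    using Suc_leI[OF that(1)] that(2,3)
  proof (induction b rule: dec_induct)
    case base
    then show ?case using adj by simp
  next
    case (step b)
    let ?t = "transpose a b" and ?s = "transpose b (Suc b)"
    have "P ?t" "P ?s" using step adj by auto
    moreover have "?t permutes {1..m}" "?s permutes {1..m}"
      using step perm[of a b] perm[of b "Suc b"] by auto
    moreover have "transpose a (Suc b) = ?t \<circ> (?s \<circ> ?t)"
      using step by (auto simp: transpose_def fun_eq_iff)
    ultimately show ?case using comp permutes_compose by metis
  qed
  have any: "P (transpose a b)" if "a \<in> {1..m}" "b \<in> {1..m}" for a b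
  proof -
    consider "a = b" | "a < b" | "b < a" by linarith
    then show ?thesis
      by cases (use that far[of a b] far[of b a] id in \<open>auto simp: transpose_commute id_def\<close>)
  qed
  have "finite {1..m}" by simp
  with w show ?thesis
  proof (induction rule: permutes_induct)
    case (swap a b p)
    then show ?case using comp perm any by blast
  qed (rule id)
qed

section \<open>The action of the symmetric group\<close>

lemma lift_exists:
  assumes n: "n > 0" and w: "w permutes {1..m}"
  shows "\<exists>\<phi>. lifts n m w \<phi>"
proof (rule adjacent_transpositions_generate[OF w])
  show "\<exists>\<phi>. lifts n m id \<phi>" using lifts_id by blast
  show "\<exists>\<phi>. lifts n m (transpose j (Suc j)) \<phi>" if "j \<in> {1..<m}" for j
  proof -
    interpret R_matrix n j by unfold_locales (rule n)
    show ?thesis using lifts_extension[OF that] by blast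
  qed
  show "\<exists>\<phi>. lifts n m (w \<circ> v) \<phi>"
    if "v permutes {1..m}" "\<exists>\<phi>. lifts n m w \<phi>" "\<exists>\<phi>. lifts n m v \<phi>" for w v
    using that lifts_compose by blast
qed

text \<open>
  The choice is unambiguous on the function field by \<open>lifts_unique\<close>, which also makes
  \<open>R_action\<close> multiplicative.
\<close>

definition R_action :: "nat \<Rightarrow> nat \<Rightarrow> (nat \<Rightarrow> nat) \<Rightarrow> ratfun \<Rightarrow> ratfun" where
  "R_action n m w = restrict (SOME \<phi>. lifts n m w \<phi>) (ratfun_field n m)"

lemma lifts_R_action:
  assumes "n > 0" "w permutes {1..m}"
  shows "lifts n m w (R_action n m w)"
proof (rule lifts_cong)
  show "lifts n m w (SOME \<phi>. lifts n m w \<phi>)"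
    using lift_exists[OF assms] by (rule someI_ex)
qed (simp add: R_action_def)

lemma R_action_mem:
  "n > 0 \<Longrightarrow> w permutes {1..m} \<Longrightarrow> f \<in> ratfun_field n m \<Longrightarrow> R_action n m w f \<in> ratfun_field n m"
  using lifts_R_action[of n w m] by (auto simp: lifts_def complex_hom_on_def)

lemma R_action_compose:
  assumes "n > 0" "w permutes {1..m}" "v permutes {1..m}" "f \<in> ratfun_field n m"
  shows "R_action n m (w \<circ> v) f = R_action n m w (R_action n m v f)"
  by (rule lifts_unique[OF assms(1) lifts_R_action[OF assms(1) permutes_compose[OF assms(3,2)]]
        lifts_compose[OF lifts_R_action[OF assms(1,2)] lifts_R_action[OF assms(1,3)] assms(3)] assms(4)])

lemma R_action_id: "n > 0 \<Longrightarrow> f \<in> ratfun_field n m \<Longrightarrow> R_action n m id f = f"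
  by (rule lifts_unique[OF _ lifts_R_action lifts_id]) (auto intro: permutes_id)

lemma R_action_bij:
  assumes "n > 0" "w permutes {1..m}"
  shows "R_action n m w \<in> Bij (ratfun_field n m)"
proof -
  have inverse: "R_action n m v (R_action n m u f) = f"
    if "v permutes {1..m}" "u permutes {1..m}" "v \<circ> u = id" "f \<in> ratfun_field n m" for u v f
    using R_action_compose[OF assms(1) that(1,2,4)] R_action_id[OF assms(1) that(4)] that(3) by simp
  have inv: "Hilbert_Choice.inv w permutes {1..m}" using assms(2) by (rule permutes_inv)
  have "bij_betw (R_action n m w) (ratfun_field n m) (ratfun_field n m)"
    by (rule bij_betw_byWitness[of _ "R_action n m (Hilbert_Choice.inv w)"])
      (use assms inv inverse permutes_inv_o[OF assms(2)] in \<open>auto intro: R_action_mem\<close>)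
  then show ?thesis by (simp add: Bij_def R_action_def)
qed

lemma group_action_R_action:
  assumes "n > 0"
  shows "group_action (sym_group m) (ratfun_field n m) (R_action n m)"
proof -
  have "R_action n m \<in> hom (sym_group m) (BijGroup (ratfun_field n m))"
  proof (rule homI)
    fix w assume "w \<in> carrier (sym_group m)"
    then show "R_action n m w \<in> carrier (BijGroup (ratfun_field n m))"
      using R_action_bij[OF assms] by (simp add: BijGroup_def sym_group_def)
  next
    fix w v assume "w \<in> carrier (sym_group m)" "v \<in> carrier (sym_group m)"
    then have wv: "w permutes {1..m}" "v permutes {1..m}" by (simp_all add: sym_group_def)
    have "R_action n m (w \<circ> v) = compose (ratfun_field n m) (R_action n m w) (R_action n m v)"
    proof
      fix f
      show "R_action n m (w \<circ> v) f = compose (ratfun_field n m) (R_action n m w) (R_action n m v) f"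
        using R_action_compose[OF assms wv]
        by (cases "f \<in> ratfun_field n m") (simp_all add: compose_def R_action_def)
    qed
    then show "R_action n m (w \<otimes>\<^bsub>sym_group m\<^esub> v) =
        R_action n m w \<otimes>\<^bsub>BijGroup (ratfun_field n m)\<^esub> R_action n m v"
      using wv R_action_bij[OF assms] by (simp add: BijGroup_def sym_group_def)
  qed
  then show ?thesis
    unfolding group_action_def group_hom_def group_hom_axioms_def
    by (simp add: group_BijGroup sym_group_is_group)
qed

theorem birational_R_action_R_action:
  assumes n: "n > 0"
  shows "birational_R_action n m (R_action n m)"
  unfolding birational_R_action_def
proof (intro conjI ballI)
  show "group_action (sym_group m) (ratfun_field n m) (R_action n m)"
    by (rule group_action_R_action[OF n])
next
  fix w assume "w \<in> carrier (sym_group m)"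
  then have hom: "complex_hom_on (ratfun_field n m) (R_action n m w)"
    using lifts_R_action[OF n] by (auto simp: sym_group_def lifts_def)
  then show "\<forall>c. R_action n m w (const_rf c) = const_rf c" by (simp add: complex_hom_on_def)
  fix f g assume "f \<in> ratfun_field n m" "g \<in> ratfun_field n m"
  then show "R_action n m w (f + g) = R_action n m w f + R_action n m w g"
    "R_action n m w (f * g) = R_action n m w f * R_action n m w g"
    using hom by (simp_all add: complex_hom_on_def)
next
  fix j assume j: "j \<in> {1..<m}"
  interpret R_matrix n j by unfold_locales (rule n)
  have "transpose j (Suc j) permutes {1..m}" by (rule permutes_swap_id) (use j in auto)
  then have "R_action n m (transpose j (Suc j)) f = extension f" if "f \<in> ratfun_field n m" for f
    using lifts_unique[OF n lifts_R_action lifts_extension[OF j] that] n by blast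
  then have "R_action n m (transpose j (Suc j)) (coord n i r) = swapped i r" if "i \<in> {1..m}" for i r
    using that by (simp add: coord_mem extension_coord)
  then show "let x = coord n; \<kappa> = kappa n (x j) (x (j + 1)); s = transpose j (j + 1) in
      \<forall>r. R_action n m s (x j r) = x (j + 1) (r + 1) * \<kappa> (r + 1) / \<kappa> r \<and>
          R_action n m s (x (j + 1) r) = x j (r - 1) * \<kappa> (r - 1) / \<kappa> r \<and>
          (\<forall>k\<in>{1..m} - {j, j + 1}. R_action n m s (x k r) = x k r)"
    using j by (simp add: Let_def swapped_def x'_def y'_def)
qed

section \<open>The field of invariants\<close>

text \<open>
  The formulas for the simple transpositions determine the action on the loop elementary symmetric
  functions and on the multipliers, and both descriptions are compatible with composition.
\<close>

lemma lifts_of_birational_R_action: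
  assumes n: "n > 0" and act: "birational_R_action n m act" and w: "w permutes {1..m}"
  shows "lifts n m w (act w)"
proof -
  interpret action: group_action "sym_group m" "ratfun_field n m" act
    using act by (simp add: birational_R_action_def)
  have hom: "complex_hom_on (ratfun_field n m) (act v)" if "v permutes {1..m}" for v
  proof -
    have v: "v \<in> carrier (sym_group m)" using that by (simp add: sym_group_def)
    then have "act v ` ratfun_field n m = ratfun_field n m" by (rule action.surj_prop)
    then show ?thesis using act v by (simp add: birational_R_action_def complex_hom_on_def)
  qed
  from w show ?thesis
  proof (rule adjacent_transpositions_generate[where P = "\<lambda>w. lifts n m w (act w)"])
    show "lifts n m id (act id)"
    proof (rule lifts_cong[OF lifts_id])
      show "act id f = f" if "f \<in> ratfun_field n m" for f
        using action.id_eq_one that by (metis restrict_apply' sym_group_one)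
    qed
    show "lifts n m (transpose j (Suc j)) (act (transpose j (Suc j)))" if j: "j \<in> {1..<m}" for j
    proof -
      interpret R_matrix n j by unfold_locales (rule n)
      have perm: "transpose j (Suc j) permutes {1..m}" by (rule permutes_swap_id) (use j in auto)
      have "\<forall>j\<in>{1..<m}. let x = coord n; \<kappa> = kappa n (x j) (x (j + 1)); s = transpose j (j + 1) in
        \<forall>r. act s (x j r) = x (j + 1) (r + 1) * \<kappa> (r + 1) / \<kappa> r \<and>
            act s (x (j + 1) r) = x j (r - 1) * \<kappa> (r - 1) / \<kappa> r \<and>
            (\<forall>k\<in>{1..m} - {j, j + 1}. act s (x k r) = x k r)"
        using act unfolding birational_R_action_def by (elim conjE)
      from bspec[OF this j] show ?thesis
        by (intro lifts_transpose[OF j hom[OF perm]])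
          (auto simp: Let_def swapped_def x'_def y'_def)
    qed
    show "lifts n m (w \<circ> v) (act (w \<circ> v))"
      if wv: "w permutes {1..m}" "v permutes {1..m}" "lifts n m w (act w)" "lifts n m v (act v)" for w v
    proof (rule lifts_cong[OF lifts_compose[OF wv(3,4,2)]])
      show "act (w \<circ> v) f = act w (act v f)" if "f \<in> ratfun_field n m" for f
        using action.composition_rule[OF that, of w v] wv(1,2) by (simp add: sym_group_def)
    qed
  qed
qed

text \<open>
  All roots of the polynomial from \<open>multiplier_integral_equation\<close> are obtained from the root \<open>l_m\<close> by
  the group action, because its coefficients are invariant; so the descent theorem applies.
\<close>

theorem invariant_field_eq:
  assumes n: "n > 0" and m: "m \<ge> 1" and act: "birational_R_action n m act"
  shows "invariant_field n m act = complex_adjoin (loop_generators n m)"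
proof
  let ?\<alpha> = "\<lambda>i. multiplier n (coord n i)"
  have lifts: "lifts n m w (act w)" if "w permutes {1..m}" for w
    by (rule lifts_of_birational_R_action[OF n act that])
  have hom: "complex_hom_on (ratfun_field n m) (act w)" if "w permutes {1..m}" for w
    using lifts[OF that] by (simp add: lifts_def)
  have gen: "complex_adjoin (loop_generators n m \<union> ?\<alpha> ` {1..m}) = ratfun_field n m"
    by (rule ratfun_field_generated[OF n])
  show "complex_adjoin (loop_generators n m) \<subseteq> invariant_field n m act"
  proof
    fix f assume f: "f \<in> complex_adjoin (loop_generators n m)"
    have "complex_adjoin (loop_generators n m) \<subseteq> ratfun_field n m"
      by (rule adjoin_least[OF complex_subfield_ratfun_field loop_generators_subset])
    then have "f \<in> ratfun_field n m" using f by (rule subsetD)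
    moreover have "act w f = f" if "w permutes {1..m}" for w
      by (rule hom_agree_on_adjoin[where \<phi> = "act w" and \<psi> = "\<lambda>f. f" and f = f,
            OF complex_subfield_ratfun_field hom[OF that] complex_hom_on_id loop_generators_subset _ f])
        (use lifts[OF that] in \<open>simp add: lifts_def\<close>)
    ultimately show "f \<in> invariant_field n m act"
      by (simp add: invariant_field_def sym_group_def)
  qed
  show "invariant_field n m act \<subseteq> complex_adjoin (loop_generators n m)"
  proof
    fix f assume f: "f \<in> invariant_field n m act"
    then have fL: "f \<in> ratfun_field n m" and fixed: "\<And>w. w permutes {1..m} \<Longrightarrow> act w f = f"
      by (simp_all add: invariant_field_def sym_group_def)
    let ?K = "complex_adjoin (loop_generators n m)"
    have transp: "transpose i j permutes {1..m}" if "i \<in> {1..m}" "j \<in> {1..m}" for i j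
      using that by (rule permutes_swap_id)
    obtain c where c: "\<And>k. coeff c k \<in> ?K" "degree c = m" "coeff c m = 1" "poly c (?\<alpha> m) = 0"
      using subfield_set.multiplier_integral_equation[OF subfield_adjoin periodic_units_coord m
          loop_e_mem[OF subfield_adjoin adjoin_superset]] by blast
    have roots: "poly c (?\<alpha> i) = 0" if i: "i \<in> {1..m}" for i
    proof -
      let ?w = "transpose i m"
      have w: "?w permutes {1..m}" using transp i m by simp
      interpret ratfun_hom "ratfun_field n m" "act ?w"
        using complex_subfield_ratfun_field hom[OF w] by (rule ratfun_hom.intro)
      have "act ?w g = g" "g \<in> ratfun_field n m" if "g \<in> ?K" for g
      proof -
        have "g \<in> invariant_field n m act"
          using \<open>?K \<subseteq> invariant_field n m act\<close> that by (rule subsetD)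
        then show "act ?w g = g" "g \<in> ratfun_field n m"
          using w by (simp_all add: invariant_field_def sym_group_def)
      qed
      then have "act ?w (poly c (?\<alpha> m)) = poly c (act ?w (?\<alpha> m))"
        using c(1) m by (intro map_poly_value coord_multiplier_mem) simp_all
      moreover have "act ?w (?\<alpha> m) = ?\<alpha> i"
        using lifts[OF w] m by (simp add: lifts_def)
      ultimately show ?thesis using c(4) by simp
    qed
    show "f \<in> ?K"
    proof (rule invariants_of_split_extension[of ?\<alpha> m c "loop_generators n m" f])
      show "inj_on ?\<alpha> {1..m}" using coord_multipliers_distinct[OF n] by (auto intro: inj_onI)
      show "coeff c k \<in> complex_adjoin (loop_generators n m \<union> ?\<alpha> ` {1..0})" for k
        using c(1) by simp
      show "f \<in> complex_adjoin (loop_generators n m \<union> ?\<alpha> ` {1..m})"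
        using fL gen by simp
      show "\<exists>\<tau>. complex_hom_on (complex_adjoin (loop_generators n m \<union> ?\<alpha> ` {1..m})) \<tau> \<and>
          (\<forall>g\<in>loop_generators n m. \<tau> g = g) \<and>
          (\<forall>k\<in>{1..m}. \<tau> (?\<alpha> k) = ?\<alpha> (transpose i j k)) \<and> \<tau> f = f"
        if "i \<in> {1..m}" "j \<in> {1..m}" for i j
        using lifts[OF transp[OF that]] fixed[OF transp[OF that]]
        unfolding gen lifts_def by (intro exI[of _ "act (transpose i j)"]) blast
    qed (use c roots in auto)
  qed
qed

section \<open>Algebraic independence\<close>

lemma digit_expansion_unique:
  fixes f g :: "nat \<Rightarrow> nat"
  assumes "\<And>k. k < K \<Longrightarrow> f k < N" "\<And>k. k < K \<Longrightarrow> g k < N"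
    and "(\<Sum>k<K. f k * N ^ k) = (\<Sum>k<K. g k * N ^ k)" and "k < K"
  shows "f k = g k"
  using assms
proof (induction K arbitrary: f g k)
  case (Suc K)
  have split: "(\<Sum>k<Suc K. h k * N ^ k) = h 0 + N * (\<Sum>k<K. h (Suc k) * N ^ k)" for h :: "nat \<Rightarrow> nat"
    unfolding sum.lessThan_Suc_shift by (simp add: sum_distrib_left mult.left_commute)
  have eq: "f 0 + N * (\<Sum>k<K. f (Suc k) * N ^ k) = g 0 + N * (\<Sum>k<K. g (Suc k) * N ^ k)"
    using Suc.prems(3) unfolding split .
  have N: "f 0 < N" "g 0 < N" using Suc.prems(1,2)[of 0] by auto
  have 0: "f 0 = g 0"
  proof -
    have "(f 0 + N * (\<Sum>k<K. f (Suc k) * N ^ k)) mod N = (g 0 + N * (\<Sum>k<K. g (Suc k) * N ^ k)) mod N"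
      by (simp only: eq)
    then show ?thesis using N by simp
  qed
  then have "(\<Sum>k<K. f (Suc k) * N ^ k) = (\<Sum>k<K. g (Suc k) * N ^ k)"
    using eq N by simp
  then have "f (Suc k) = g (Suc k)" if "k < K" for k
    using Suc.IH[of "\<lambda>k. f (Suc k)" "\<lambda>k. g (Suc k)" k] Suc.prems(1,2) that by simp
  then show ?case using 0 Suc.prems(4) by (cases k) auto
qed simp

lemma indexed_digit_expansion_unique:
  fixes f g :: "'v \<Rightarrow> nat"
  assumes I: "finite I" "inj_on idx I" and v: "v \<in> I"
    and bound: "\<And>v. v \<in> I \<Longrightarrow> f v < N" "\<And>v. v \<in> I \<Longrightarrow> g v < N"
    and eq: "(\<Sum>v\<in>I. f v * N ^ idx v) = (\<Sum>v\<in>I. g v * N ^ idx v)"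
  shows "f v = g v"
proof -
  obtain K where K: "idx ` I \<subseteq> {..<K}"
    using I(1) finite_nat_iff_bounded[of "idx ` I"] by blast
  define d where "d h k = (if k \<in> idx ` I then h (inv_into I idx k) else 0)" for h :: "'v \<Rightarrow> nat" and k
  have d_idx: "d h (idx v) = h v" if "v \<in> I" for h v
    using that I(2) by (simp add: d_def)
  have expand: "(\<Sum>v\<in>I. h v * N ^ idx v) = (\<Sum>k<K. d h k * N ^ k)" for h
  proof -
    have "(\<Sum>v\<in>I. h v * N ^ idx v) = (\<Sum>k\<in>idx ` I. d h k * N ^ k)"
      using I(2) by (simp add: sum.reindex d_idx)
    also have "\<dots> = (\<Sum>k<K. d h k * N ^ k)"
      by (rule sum.mono_neutral_left) (use K in \<open>auto simp: d_def\<close>)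
    finally show ?thesis .
  qed
  have "N > 0" using bound(1)[OF v] by simp
  then have small: "d h k < N" if "\<And>v. v \<in> I \<Longrightarrow> h v < N" for h k
    using that by (auto simp: d_def inv_into_into)
  have "d f (idx v) = d g (idx v)"
  proof (rule digit_expansion_unique[of K "d f" N "d g"])
    show "(\<Sum>k<K. d f k * N ^ k) = (\<Sum>k<K. d g k * N ^ k)"
      using eq by (simp only: expand)
    show "idx v < K" using K v by auto
  qed (use small bound in auto)
  then show ?thesis using v by (simp add: d_idx)
qed

text \<open>
  Give a monomial \<open>a\<close> the weight \<open>\<Sum>v. a v * W v\<close>.  Its contribution to the value is divisible by the
  power of the variable with this exponent, with the coefficient of \<open>a\<close> in lowest degree.  The monomial
  of least weight is unique, so its lowest term is not cancelled.
\<close>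

lemma meval_distinct_leading_terms_nonzero:
  fixes p :: "'v cpoly" and q u :: "'v \<Rightarrow> complex poly" and W :: "'v \<Rightarrow> nat"
  assumes p: "p \<noteq> 0" and I: "\<And>a. a \<in> Poly_Mapping.keys p \<Longrightarrow> Poly_Mapping.keys a \<subseteq> I"
    and q: "\<And>v. v \<in> I \<Longrightarrow> q v = monom 1 (W v) * u v" "\<And>v. v \<in> I \<Longrightarrow> coeff (u v) 0 = 1"
    and inj: "inj_on (\<lambda>a. \<Sum>v\<in>Poly_Mapping.keys a. Poly_Mapping.lookup a v * W v) (Poly_Mapping.keys p)"
  shows "meval (\<lambda>c. [:c:]) q p \<noteq> 0"
proof -
  let ?keys = "Poly_Mapping.keys p"
  define wt where "wt a = (\<Sum>v\<in>Poly_Mapping.keys a. Poly_Mapping.lookup a v * W v)" for a :: "'v \<Rightarrow>\<^sub>0 nat"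
  define U where "U a = [:Poly_Mapping.lookup p a:] * (\<Prod>v\<in>Poly_Mapping.keys a. u v ^ Poly_Mapping.lookup a v)" for a
  have monoms: "(\<Prod>v\<in>S. monom 1 (W v) ^ e v) = monom (1::complex) (\<Sum>v\<in>S. e v * W v)"
    if "finite S" for S and e :: "'v \<Rightarrow> nat"
    using that by (induction S) (auto simp: monom_power mult_monom mult.commute)
  have "meval (\<lambda>c. [:c:]) q p = (\<Sum>a\<in>?keys. monom 1 (wt a) * U a)"
    unfolding meval_def
  proof (rule sum.cong[OF refl])
    fix a assume a: "a \<in> ?keys"
    have "(\<Prod>v\<in>Poly_Mapping.keys a. q v ^ Poly_Mapping.lookup a v)
        = (\<Prod>v\<in>Poly_Mapping.keys a. monom 1 (W v) ^ Poly_Mapping.lookup a v * u v ^ Poly_Mapping.lookup a v)"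
      by (rule prod.cong[OF refl]) (use I[OF a] q in \<open>auto simp: power_mult_distrib\<close>)
    also have "\<dots> = monom 1 (wt a) * (\<Prod>v\<in>Poly_Mapping.keys a. u v ^ Poly_Mapping.lookup a v)"
      by (simp add: prod.distrib monoms wt_def)
    finally show "[:Poly_Mapping.lookup p a:] * (\<Prod>v\<in>Poly_Mapping.keys a. q v ^ Poly_Mapping.lookup a v)
        = monom 1 (wt a) * U a"
      by (simp only: U_def mult.left_commute)
  qed
  then have coeffs: "coeff (meval (\<lambda>c. [:c:]) q p) k = (\<Sum>a\<in>?keys. if wt a \<le> k then coeff (U a) (k - wt a) else 0)" for k
    by (auto simp: coeff_sum coeff_monom_mult intro!: sum.cong)
  have "?keys \<noteq> {}" using p by (metis (full_types) all_not_in_conv in_keys_iff lookup_zero poly_mapping_eqI)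
  then obtain b where b: "b \<in> ?keys" "\<And>a. a \<in> ?keys \<Longrightarrow> wt b \<le> wt a"
    using ex_min_if_finite[of "wt ` ?keys"] by (fastforce simp: not_less)
  have "coeff (meval (\<lambda>c. [:c:]) q p) (wt b) = (\<Sum>a\<in>?keys. if a = b then coeff (U b) 0 else 0)"
    unfolding coeffs
  proof (rule sum.cong[OF refl])
    fix a assume a: "a \<in> ?keys"
    have "a = b" if "wt a \<le> wt b"
      using inj_onD[OF inj, of a b] b(2)[OF a] that a b(1) by (simp add: wt_def)
    then show "(if wt a \<le> wt b then coeff (U a) (wt b - wt a) else 0) = (if a = b then coeff (U b) 0 else 0)"
      by auto
  qed
  also have "\<dots> = coeff (U b) 0" using b(1) by simp
  also have "\<dots> = Poly_Mapping.lookup p b"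
  proof -
    have "poly (\<Prod>v\<in>Poly_Mapping.keys b. u v ^ Poly_Mapping.lookup b v) 0 = 1"
      unfolding poly_prod poly_power
      by (rule prod.neutral) (use I[OF b(1)] q(2) in \<open>auto simp: poly_0_coeff_0\<close>)
    then show ?thesis by (simp add: U_def poly_0_coeff_0[symmetric])
  qed
  also have "\<dots> \<noteq> 0" using b(1) by (simp add: in_keys_iff)
  finally show ?thesis by auto
qed

text \<open>
  Lowering any of the indices in \<open>i_1 < ... < i_r\<close> lowers the exponent, so the sequence \<open>1, ..., r\<close>
  contributes the lowest power.
\<close>

lemma loop_e_leading_term:
  fixes B :: "nat \<Rightarrow> int \<Rightarrow> nat"
  assumes B: "\<And>i j t. i \<ge> 1 \<Longrightarrow> i < j \<Longrightarrow> B i t < B j t" and r: "r \<le> m"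
  shows "\<exists>u. loop_e m (\<lambda>i t. monom (1::complex) (B i t)) r s
      = monom 1 (\<Sum>k<r. B (Suc k) (s + int k)) * u \<and> coeff u 0 = 1"
  using r
proof (induction m arbitrary: r)
  case 0
  then show ?case by (intro exI[of _ 1]) simp
next
  case (Suc m)
  let ?x = "\<lambda>i t. monom (1::complex) (B i t)"
  let ?W = "\<lambda>r. \<Sum>k<r. B (Suc k) (s + int k)"
  show ?case
  proof (cases r)
    case 0
    then show ?thesis by (intro exI[of _ 1]) simp
  next
    case r: (Suc q)
    then obtain u where u: "loop_e m ?x q s = monom 1 (?W q) * u" "coeff u 0 = 1"
      using Suc by fastforce
    have split: "monom (1::complex) (a + b) = monom 1 a * monom 1 b" for a b
      by (simp add: mult_monom)
    have last: "loop_e m ?x q s * ?x (Suc m) (s + int q) = monom 1 (?W q + B (Suc m) (s + int q)) * u"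
      unfolding split u(1) by (simp only: mult_ac)
    show ?thesis
    proof (cases "q = m")
      case True
      then show ?thesis
        using last u r by (intro exI[of _ u]) (simp add: loop_e_Suc_Suc loop_e_eq_0)
    next
      case False
      then have "r \<le> m" using r Suc.prems by simp
      then obtain u' where u': "loop_e m ?x r s = monom 1 (?W r) * u'" "coeff u' 0 = 1"
        using Suc.IH by blast
      have "B (Suc q) (s + int q) < B (Suc m) (s + int q)"
        using B[of "Suc q" "Suc m"] r \<open>r \<le> m\<close> by simp
      then obtain d where d: "B (Suc m) (s + int q) = B (Suc q) (s + int q) + Suc d"
        using less_imp_Suc_add by fastforce
      have "loop_e (Suc m) ?x r s = monom 1 (?W r) * (u' + monom 1 (Suc d) * u)"
      proof -
        have W: "?W q + B (Suc m) (s + int q) = ?W r + Suc d" by (simp add: r d)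
        have "loop_e (Suc m) ?x r s = loop_e m ?x r s + loop_e m ?x q s * ?x (Suc m) (s + int q)"
          by (simp add: r loop_e_Suc_Suc)
        then show ?thesis
          unfolding last u'(1) W split by (simp only: distrib_left mult.assoc)
      qed
      moreover have "coeff (u' + monom 1 (Suc d) * u) 0 = 1"
        using u' by (simp add: coeff_monom_mult)
      ultimately show ?thesis by blast
    qed
  qed
qed

text \<open>
  The total weights of the leading monomials are prescribed first, as distinct powers of \<open>N\<close>, and the
  weights of the single variables are their successive differences.  The base \<open>3\<close> is large enough to
  make these differences grow with the lower index.
\<close>

lemma increasing_weights_exist:
  fixes n N :: nat
  assumes n: "n > 0" and N: "N \<ge> 3"
  obtains B :: "nat \<Rightarrow> int \<Rightarrow> nat" where "\<And>i t. B i (t + int n) = B i t"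
    and "\<And>i j t. i \<ge> 1 \<Longrightarrow> i < j \<Longrightarrow> B i t < B j t"
    and "\<And>r s. r \<ge> 1 \<Longrightarrow> (\<Sum>k<r. B (Suc k) (s + int k)) = N ^ (r * n + nat (s mod int n))"
proof -
  define W where "W r s = (if r = 0 then 0 else N ^ (r * n + nat (s mod int n)))" for r s
  define B where "B i t = W i (t - int i + 1) - W (i - 1) (t - int i + 1)" for i t
  have residue: "nat (s mod int n) < n" for s using n by (simp add: nat_less_iff)
  have W_mono: "W k s \<le> W (Suc k) s" for k s
    using N by (auto simp: W_def intro!: power_increasing)
  have periodic: "B i (t + int n) = B i t" for i t
  proof -
    have "(t + int n - int i + 1) mod int n = (t - int i + 1) mod int n"
      using mod_add_self2[of "t - int i + 1" "int n"] by (simp add: algebra_simps)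
    then show ?thesis by (simp add: B_def W_def)
  qed
  have step: "B (Suc i) t < B (Suc (Suc i)) t" for i t
  proof -
    let ?e = "(Suc i) * n + n - 1"
    let ?s = "t - int (Suc (Suc i)) + 1"
    have "B (Suc i) t \<le> W (Suc i) (t - int (Suc i) + 1)" by (simp add: B_def)
    also have "\<dots> \<le> N ^ ?e"
      using N residue[of "t - int (Suc i) + 1"] by (auto simp: W_def intro!: power_increasing)
    finally have low: "B (Suc i) t \<le> N ^ ?e" .
    obtain d where d: "Suc (Suc i) * n + nat (?s mod int n) = Suc ?e + d"
      using n by (metis (no_types, lifting) Nat.add_0_right Suc_pred' add.commute add_gr_0 mult_Suc add.assoc)
    have e1: "Suc i * n + nat (?s mod int n) = (?e + d) + 1 - n"
      using d n by simp
    have "W (Suc i) ?s \<le> N ^ (?e + d)"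
      unfolding W_def using N n e1 by (auto intro!: power_increasing)
    moreover have "W (Suc (Suc i)) ?s = N * N ^ (?e + d)"
      unfolding W_def d by simp
    moreover have "3 * N ^ (?e + d) \<le> N * N ^ (?e + d)" using N by simp
    moreover have "B (Suc (Suc i)) t = W (Suc (Suc i)) ?s - W (Suc i) ?s" by (simp add: B_def)
    ultimately have "2 * N ^ (?e + d) \<le> B (Suc (Suc i)) t" by linarith
    moreover have "N ^ ?e \<le> N ^ (?e + d)" "0 < N ^ ?e"
      using N by (auto intro!: power_increasing)
    ultimately show ?thesis using low by linarith
  qed
  have mono: "B i t < B j t" if "i \<ge> 1" "i < j" for i j t
  proof -
    have "B (Suc (i - 1)) t < B (Suc (j - 1)) t"
      by (rule lift_Suc_mono_less[where f = "\<lambda>k. B (Suc k) t"]) (use step that in auto)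
    then show ?thesis using that by simp
  qed
  have sums: "(\<Sum>k<r. B (Suc k) (s + int k)) = W r s" for r s
  proof (induction r)
    case (Suc r)
    have "B (Suc r) (s + int r) = W (Suc r) s - W r s" by (simp add: B_def)
    then show ?case using Suc W_mono[of r s] by simp
  qed (simp add: W_def)
  show ?thesis
    by (rule that[of B]) (use periodic mono sums in \<open>auto simp: W_def\<close>)
qed

lemma poly_meval:
  "poly (meval (\<lambda>c. [:c:]) q p) t = meval (\<lambda>c. c) (\<lambda>v. poly (q v) t) p"
  by (simp add: meval_def poly_sum poly_prod)

lemma poly_loop_e: "poly (loop_e m x r s) t = loop_e m (\<lambda>i k. poly (x i k) t) r s"
  by (simp add: loop_e_def poly_sum poly_prod)

text \<open>
  Take \<open>N\<close> larger than all exponents occurring in \<open>p\<close>.  The weight of a monomial is then a number whose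
  digits in base \<open>N\<close> are the exponents, so different monomials have different weights, and \<open>p\<close> does
  not vanish at a suitable point of the curve \<open>x_i^(k) = t^(B i k)\<close>.
\<close>

theorem loop_e_values_dense:
  fixes p :: "(nat \<times> int) cpoly"
  assumes n: "n > 0"
    and keys: "\<And>a. a \<in> Poly_Mapping.keys p \<Longrightarrow> Poly_Mapping.keys a \<subseteq> {1..m} \<times> {0..<int n}"
    and vanish: "\<And>x. x \<in> X_space n m \<Longrightarrow> meval (\<lambda>c. c) (\<lambda>(r, s). loop_e m x r s) p = 0"
  shows "p = 0"
proof (rule ccontr)
  assume p: "p \<noteq> 0"
  let ?I = "{1..m} \<times> {0..<int n}"
  have "finite (\<Union>a\<in>Poly_Mapping.keys p. Poly_Mapping.lookup a ` ?I)" by simp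
  then obtain N0 where N0: "(\<Union>a\<in>Poly_Mapping.keys p. Poly_Mapping.lookup a ` ?I) \<subseteq> {..<N0}"
    using finite_nat_iff_bounded by blast
  define N where "N = N0 + 3"
  have N: "N \<ge> 3" by (simp add: N_def)
  have small: "Poly_Mapping.lookup a v < N" if "a \<in> Poly_Mapping.keys p" "v \<in> ?I" for a v
    using N0 that by (fastforce simp: N_def)
  obtain B :: "nat \<Rightarrow> int \<Rightarrow> nat" where B: "\<And>i t. B i (t + int n) = B i t"
    "\<And>i j t. i \<ge> 1 \<Longrightarrow> i < j \<Longrightarrow> B i t < B j t"
    "\<And>r s. r \<ge> 1 \<Longrightarrow> (\<Sum>k<r. B (Suc k) (s + int k)) = N ^ (r * n + nat (s mod int n))"
    using increasing_weights_exist[OF n N] by blast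
  define idx where "idx v = (case v of (r, s) \<Rightarrow> r * n + nat (s mod int n))" for v :: "nat \<times> int"
  have inj_idx: "inj_on idx ?I"
  proof (rule inj_onI)
    fix v w assume "v \<in> ?I" "w \<in> ?I" "idx v = idx w"
    then obtain r s r' s' where v: "v = (r, s)" "w = (r', s')" and s: "0 \<le> s" "s < int n" "0 \<le> s'" "s' < int n"
      and eq: "r * n + nat s = r' * n + nat s'"
      by (auto simp: idx_def)
    have "(nat s + r * n) div n = (nat s' + r' * n) div n" "(nat s + r * n) mod n = (nat s' + r' * n) mod n"
      using eq by (simp_all add: add.commute)
    then show "v = w" using s v n by (simp add: nat_less_iff)
  qed
  define q where "q = (\<lambda>(r, s). loop_e m (\<lambda>i t. monom (1::complex) (B i t)) r s)"
  have "\<exists>u. q v = monom 1 (N ^ idx v) * u \<and> coeff u 0 = 1" if "v \<in> ?I" for v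
  proof -
    obtain r s where v: "v = (r, s)" by fastforce
    then have r: "r \<ge> 1" "r \<le> m" using that by auto
    show ?thesis
      using loop_e_leading_term[of B r m s, OF B(2) r(2)] unfolding B(3)[OF r(1)] v
      by (simp add: q_def idx_def)
  qed
  then obtain u where u: "\<And>v. v \<in> ?I \<Longrightarrow> q v = monom 1 (N ^ idx v) * u v"
    "\<And>v. v \<in> ?I \<Longrightarrow> coeff (u v) 0 = 1"
    by metis
  have "inj_on (\<lambda>a. \<Sum>v\<in>Poly_Mapping.keys a. Poly_Mapping.lookup a v * N ^ idx v) (Poly_Mapping.keys p)"
  proof (rule inj_onI)
    fix a b assume a: "a \<in> Poly_Mapping.keys p" and b: "b \<in> Poly_Mapping.keys p"
      and eq: "(\<Sum>v\<in>Poly_Mapping.keys a. Poly_Mapping.lookup a v * N ^ idx v)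
        = (\<Sum>v\<in>Poly_Mapping.keys b. Poly_Mapping.lookup b v * N ^ idx v)"
    have full: "(\<Sum>v\<in>Poly_Mapping.keys c. Poly_Mapping.lookup c v * N ^ idx v)
        = (\<Sum>v\<in>?I. Poly_Mapping.lookup c v * N ^ idx v)" if "c \<in> Poly_Mapping.keys p" for c
      by (rule sum.mono_neutral_left) (use keys[OF that] in \<open>auto simp: in_keys_iff\<close>)
    show "a = b"
    proof (rule poly_mapping_eqI)
      fix v
      show "Poly_Mapping.lookup a v = Poly_Mapping.lookup b v"
      proof (cases "v \<in> ?I")
        case True
        show ?thesis
          by (rule indexed_digit_expansion_unique[of ?I idx v _ N])
            (use True inj_idx small a b eq full[OF a] full[OF b] in auto)
      next
        case False
        then show ?thesis
          using keys[OF a] keys[OF b] by (metis in_keys_iff subsetD)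
      qed
    qed
  qed
  from meval_distinct_leading_terms_nonzero[OF p keys u this]
  have "meval (\<lambda>c. [:c:]) q p \<noteq> 0" by simp
  then have "finite {t. poly (meval (\<lambda>c. [:c:]) q p) t = 0}" by (rule poly_roots_finite)
  then have "finite ({t. poly (meval (\<lambda>c. [:c:]) q p) t = 0} \<union> {0})" by simp
  then obtain t where t: "poly (meval (\<lambda>c. [:c:]) q p) t \<noteq> 0" "t \<noteq> 0"
    using ex_new_if_finite[OF infinite_UNIV_char_0] by (metis (mono_tags, lifting) UnI1 UnI2 mem_Collect_eq singletonI)
  define x where "x = (\<lambda>i\<in>{1..m}. \<lambda>k. t ^ B i k)"
  have "x \<in> X_space n m" using t(2) B(1) by (auto simp: x_def X_space_def)
  moreover have "poly (q v) t = (case v of (r, s) \<Rightarrow> loop_e m x r s)" for v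
  proof -
    have "loop_e m (\<lambda>i k. t ^ B i k) r s = loop_e m x r s" for r s
      by (rule loop_e_cong) (simp add: x_def)
    then show ?thesis by (cases v) (simp add: q_def poly_loop_e poly_monom)
  qed
  ultimately have "poly (meval (\<lambda>c. [:c:]) q p) t = 0"
    using vanish[of x] by (simp add: poly_meval)
  then show False using t by simp
qed

text \<open>
  An algebraic relation between rational functions can be evaluated at every point of \<open>X\<close>.
\<close>

theorem algebraically_independent_loop_e:
  assumes n: "n > 0"
  shows "algebraically_independent (\<lambda>(r, s). loop_e m (coord n) r s) ({1..m} \<times> {0..<int n})"
  unfolding algebraically_independent_def
proof (intro allI impI)
  fix p :: "(nat \<times> int) cpoly"
  assume keys: "\<forall>a\<in>Poly_Mapping.keys p. Poly_Mapping.keys a \<subseteq> {1..m} \<times> {0..<int n}"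
    and vanishes: "eval_cpoly (\<lambda>(r, s). loop_e m (coord n) r s) p = 0"
  show "p = 0"
  proof (rule loop_e_values_dense[OF n])
    show "Poly_Mapping.keys a \<subseteq> {1..m} \<times> {0..<int n}" if "a \<in> Poly_Mapping.keys p" for a
      using keys that by blast
    fix x assume x: "x \<in> X_space n m"
    interpret specialization "meval (\<lambda>c. c) (family_values x)"
      by (rule specialization_meval[OF ring_map_id])
    have "specializes (coord n i r) (x i r)" if "i \<in> {1..m}" for i r
      by (rule coord_specializes[OF ring_map_id n]) (use x that in \<open>auto simp: X_space_def PiE_iff\<close>)
    then have loop: "specializes (loop_e m (coord n) r s) (loop_e m x r s)" for r s
      by (rule specializes_loop_e)
    have const: "specializes (const_rf c) c" for c
      using specializes_to_fract[of "Poly_Mapping.single 0 c"]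
      by (simp only: meval_const[OF ring_map_id] const_rf_def)
    have "specializes (eval_cpoly (\<lambda>(r, s). loop_e m (coord n) r s) p)
        (meval (\<lambda>c. c) (\<lambda>(r, s). loop_e m x r s) p)"
      unfolding eval_cpoly_eq_meval
      by (rule specializes_meval) (auto simp: loop const split: prod.split)
    with vanishes have "specializes 0 (meval (\<lambda>c. c) (\<lambda>(r, s). loop_e m x r s) p)" by simp
    then show "meval (\<lambda>c. c) (\<lambda>(r, s). loop_e m x r s) p = 0"
      using specializes_0 by (rule specializes_unique)
  qed
qed

section \<open>The coordinate ring of products of whirls\<close>

lemma infmat_mult_assoc: "infmat_mult (infmat_mult A B) C = infmat_mult A (infmat_mult B C)"
proof (intro ext)
  fix i j
  have "(\<Sum>l=i..j. \<Sum>k=i..l. A i k * B k l * C l j) = (\<Sum>k=i..j. \<Sum>l=k..j. A i k * B k l * C l j)"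
    by (subst (1 2) sum.Sigma)
      (auto intro!: sum.reindex_bij_witness[of _ "\<lambda>(k, l). (l, k)" "\<lambda>(l, k). (k, l)"])
  then show "infmat_mult (infmat_mult A B) C i j = infmat_mult A (infmat_mult B C) i j"
    by (simp add: infmat_mult_def sum_distrib_left sum_distrib_right mult.assoc)
qed

lemma infmat_mult_one_right:
  "(\<And>i j. j < i \<Longrightarrow> A i j = 0) \<Longrightarrow> infmat_mult A infmat_one = A"
  by (auto simp: infmat_mult_def infmat_one_def fun_eq_iff if_distrib cong: if_cong)

lemma infmat_mult_one_left:
  "(\<And>i j. j < i \<Longrightarrow> A i j = 0) \<Longrightarrow> infmat_mult infmat_one A = A"
  by (auto simp: infmat_mult_def infmat_one_def fun_eq_iff if_distrib[of "\<lambda>t. t * _"] cong: if_cong)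

lemma infmat_mult_lower: "j < i \<Longrightarrow> infmat_mult A B i j = 0"
  by (simp add: infmat_mult_def)

lemma whirl_lower: "j < i \<Longrightarrow> whirl u i j = 0"
  by (simp add: whirl_def)

lemma foldr_whirls_lower:
  assumes "\<And>i j. j < i \<Longrightarrow> A i j = 0"
  shows "foldr (\<lambda>i. infmat_mult (whirl (x i))) ks A
    = infmat_mult (foldr (\<lambda>i. infmat_mult (whirl (x i))) ks infmat_one) A"
  by (induction ks) (simp_all add: infmat_mult_one_left[OF assms] infmat_mult_assoc)

lemma whirl_product_0: "whirl_product 0 x = infmat_one"
  by (simp add: whirl_product_def)

lemma whirl_product_Suc:
  "whirl_product (Suc m) x = infmat_mult (whirl_product m x) (whirl (x (Suc m)))"
proof -
  have "[1..<Suc m + 1] = [1..<m + 1] @ [Suc m]" by simp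
  then have "whirl_product (Suc m) x = foldr (\<lambda>i. infmat_mult (whirl (x i))) [1..<m + 1] (whirl (x (Suc m)))"
    unfolding whirl_product_def by (simp add: infmat_mult_one_right whirl_lower)
  also have "\<dots> = infmat_mult (whirl_product m x) (whirl (x (Suc m)))"
    unfolding whirl_product_def by (rule foldr_whirls_lower[OF whirl_lower])
  finally show ?thesis .
qed

lemma infmat_mult_whirl:
  assumes "i \<le> j"
  shows "infmat_mult A (whirl u) i j = A i j + (if i < j then A i (j - 1) * u (j - 1) else 0)"
proof -
  have "infmat_mult A (whirl u) i j
      = (\<Sum>k=i..j. (if k = j then A i k else 0) + (if k = j - 1 then A i k * u k else 0))"
    unfolding infmat_mult_def by (rule sum.cong) (auto simp: whirl_def)
  then show ?thesis using assms by (simp add: sum.distrib)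
qed

theorem whirl_product_entry:
  "whirl_product m x i j = (if i \<le> j then loop_e m x (nat (j - i)) i else 0)"
proof (induction m arbitrary: i j)
  case 0
  show ?case
  proof (cases "i < j")
    case True
    then obtain r where "nat (j - i) = Suc r" by (cases "nat (j - i)") auto
    then show ?thesis using True by (simp add: whirl_product_0 infmat_one_def)
  qed (auto simp: whirl_product_0 infmat_one_def)
next
  case (Suc m)
  consider "j < i" | "i = j" | "i < j" by linarith
  then show ?case
  proof cases
    case 3
    then obtain r where r: "nat (j - i) = Suc r" by (cases "nat (j - i)") auto
    then have "nat (j - 1 - i) = r" "j - 1 = i + int r" by linarith+
    then show ?thesis
      using 3 r Suc by (simp add: whirl_product_Suc infmat_mult_whirl loop_e_Suc_Suc)
  qed (use Suc in \<open>simp_all add: whirl_product_Suc infmat_mult_lower infmat_mult_whirl\<close>)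
qed

lemma whirl_product_in_U_le:
  assumes "x \<in> X_space n m"
  shows "whirl_product m x \<in> U_le n m"
proof -
  have "x i (r + int n) = x i r" if "i \<in> {1..m}" for i r
    using assms that by (auto simp: X_space_def PiE_iff)
  then have "loop_e m x r (s + int n) = loop_e m x r s" for r s
    by (rule loop_e_periodic)
  then show ?thesis
    by (auto simp: U_le_def U_group_def whirl_product_entry loop_e_eq_0)
qed

definition cpolys_in :: "'v set \<Rightarrow> 'v cpoly set" where
  "cpolys_in I = {p. \<forall>a\<in>Poly_Mapping.keys p. Poly_Mapping.keys a \<subseteq> I}"

lemma cpolys_in_add: "p \<in> cpolys_in I \<Longrightarrow> q \<in> cpolys_in I \<Longrightarrow> p + q \<in> cpolys_in I"
  using keys_add[of p q] by (force simp: cpolys_in_def)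

lemma cpolys_in_uminus: "p \<in> cpolys_in I \<Longrightarrow> - p \<in> cpolys_in I"
  by (simp add: cpolys_in_def in_keys_iff)

lemma cpolys_in_mult:
  assumes "p \<in> cpolys_in I" "q \<in> cpolys_in I"
  shows "p * q \<in> cpolys_in I"
  unfolding cpolys_in_def
proof (intro CollectI ballI)
  fix c assume "c \<in> Poly_Mapping.keys (p * q)"
  then obtain a b where "c = a + b" "a \<in> Poly_Mapping.keys p" "b \<in> Poly_Mapping.keys q"
    using keys_mult[of p q] by blast
  then show "Poly_Mapping.keys c \<subseteq> I"
    using keys_add[of a b] assms unfolding cpolys_in_def by blast
qed

lemma generated_algebra_extensional: "f \<in> generated_algebra S G \<Longrightarrow> f \<in> extensional S"
  by (induction rule: generated_algebra.induct) (auto simp: extensional_def)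

lemma U_le_coordinate_mod:
  assumes "Y \<in> U_le n m"
  shows "Y s (s + int r) = Y (s mod int n) (s mod int n + int r)"
proof -
  have "Y (s + int n) (s + int r + int n) = Y s (s + int r)" for s
    using assms by (simp add: U_le_def U_group_def)
  then have "Y (s + int n) (s + int n + int r) = Y s (s + int r)" for s
    by (simp only: add.assoc add.commute[of "int r"])
  from int_periodic_mod[of "\<lambda>s. Y s (s + int r)", OF this] show ?thesis by simp
qed

lemma U_functions_are_polynomials:
  assumes n: "n > 0"
    and "f \<in> generated_algebra (U_le n m) {(\<lambda>Y. Y s (s + int r)) | r s. r \<in> {1..m}}"
  shows "\<exists>p\<in>cpolys_in ({1..m} \<times> {0..<int n}).
    \<forall>Y\<in>U_le n m. f Y = meval (\<lambda>c. c) (\<lambda>(r, s). Y s (s + int r)) p"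
  using assms(2)
proof (induction rule: generated_algebra.induct)
  case (const c)
  show ?case
    by (intro bexI[of _ "Poly_Mapping.single 0 c"]) (auto simp: meval_const[OF ring_map_id] cpolys_in_def)
next
  case (gen g)
  then obtain r s where g: "g = (\<lambda>Y. Y s (s + int r))" "r \<in> {1..m}" by blast
  let ?p = "Poly_Mapping.single (Poly_Mapping.single (r, s mod int n) 1) (1::complex)"
  have "?p \<in> cpolys_in ({1..m} \<times> {0..<int n})" using g n by (simp add: cpolys_in_def)
  moreover have "restrict g (U_le n m) Y = meval (\<lambda>c. c) (\<lambda>(r, s). Y s (s + int r)) ?p"
    if "Y \<in> U_le n m" for Y
    unfolding meval_var[of "\<lambda>c. c", OF refl] using that U_le_coordinate_mod[OF that, of s r] by (simp add: g)
  ultimately show ?case by blast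
next
  case (add f g)
  then obtain p q where p: "p \<in> cpolys_in ({1..m} \<times> {0..<int n})" "q \<in> cpolys_in ({1..m} \<times> {0..<int n})"
    "\<forall>Y\<in>U_le n m. f Y = meval (\<lambda>c. c) (\<lambda>(r, s). Y s (s + int r)) p"
    "\<forall>Y\<in>U_le n m. g Y = meval (\<lambda>c. c) (\<lambda>(r, s). Y s (s + int r)) q"
    by blast
  then show ?case
    by (intro bexI[of _ "p + q"]) (auto simp: meval_add[OF ring_map_id] intro: cpolys_in_add)
next
  case (mult f g)
  then obtain p q where p: "p \<in> cpolys_in ({1..m} \<times> {0..<int n})" "q \<in> cpolys_in ({1..m} \<times> {0..<int n})"
    "\<forall>Y\<in>U_le n m. f Y = meval (\<lambda>c. c) (\<lambda>(r, s). Y s (s + int r)) p"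
    "\<forall>Y\<in>U_le n m. g Y = meval (\<lambda>c. c) (\<lambda>(r, s). Y s (s + int r)) q"
    by blast
  then show ?case
    by (intro bexI[of _ "p * q"]) (auto simp: meval_mult[OF ring_map_id] intro: cpolys_in_mult)
qed

text \<open>
  The coordinate \<open>y_{s,s+r}\<close> pulls back to \<open>e_r^(s)\<close>, so the image is generated by the \<open>e_r^(s)\<close> with
  \<open>r \<le> m\<close>; those with \<open>r > m\<close> vanish.  Injectivity is \<open>loop_e_values_dense\<close>.
\<close>

theorem pullback_whirl_product_iso:
  assumes n: "n > 0"
  shows "pullback (X_space n m) (whirl_product m) \<in> ring_iso (U_coordinate_ring n m) (LSym n m)"
proof -
  let ?X = "X_space n m" and ?U = "U_le n m" and ?\<Phi> = "whirl_product m :: _ \<Rightarrow> complex infmat"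
  let ?GU = "{(\<lambda>Y::complex infmat. Y s (s + int r)) | r s. r \<in> {1..m}}"
  let ?GX = "{(\<lambda>x::nat \<Rightarrow> int \<Rightarrow> complex. loop_e m x r s) | r s. r \<ge> 1}"
  let ?pb = "pullback ?X ?\<Phi>"
  have \<Phi>: "?\<Phi> x \<in> ?U" if "x \<in> ?X" for x using that by (rule whirl_product_in_U_le)
  have entry: "?\<Phi> x s (s + int r) = loop_e m x r s" for x r s
    by (simp add: whirl_product_entry)
  have pb_const: "?pb (\<lambda>Y\<in>?U. c) = (\<lambda>x\<in>?X. c)" for c
    using \<Phi> by (auto simp: pullback_def fun_eq_iff)
  have pb_add: "?pb (\<lambda>Y\<in>?U. f Y + g Y) = (\<lambda>x\<in>?X. ?pb f x + ?pb g x)" for f g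
    using \<Phi> by (auto simp: pullback_def fun_eq_iff)
  have pb_mult: "?pb (\<lambda>Y\<in>?U. f Y * g Y) = (\<lambda>x\<in>?X. ?pb f x * ?pb g x)" for f g
    using \<Phi> by (auto simp: pullback_def fun_eq_iff)
  have pb_gen: "?pb (restrict (\<lambda>Y. Y s (s + int r)) ?U) = restrict (\<lambda>x. loop_e m x r s) ?X" for r s
    using \<Phi> entry by (auto simp: pullback_def fun_eq_iff)
  have into: "?pb f \<in> generated_algebra ?X ?GX" if "f \<in> generated_algebra ?U ?GU" for f
    using that
  proof (induction rule: generated_algebra.induct)
    case (gen g)
    then obtain r s where "g = (\<lambda>Y. Y s (s + int r))" "r \<in> {1..m}" by blast
    then show ?case
      by (simp only: pb_gen) (rule generated_algebra.gen, auto)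
  qed (simp_all only: pb_const pb_add pb_mult generated_algebra.intros)
  have onto: "g \<in> ?pb ` generated_algebra ?U ?GU" if "g \<in> generated_algebra ?X ?GX" for g
    using that
  proof (induction rule: generated_algebra.induct)
    case (const c)
    show ?case by (subst pb_const[symmetric], rule imageI) (rule generated_algebra.const)
  next
    case (gen g)
    then obtain r s where g: "g = (\<lambda>x. loop_e m x r s)" "r \<ge> 1" by blast
    show ?case
    proof (cases "r \<le> m")
      case True
      show ?thesis unfolding g
        by (subst pb_gen[symmetric], rule imageI, rule generated_algebra.gen) (use True g in auto)
    next
      case False
      then have zero: "restrict g ?X = (\<lambda>x\<in>?X. 0)" by (simp add: g loop_e_eq_0)
      show ?thesis
        unfolding zero by (subst pb_const[symmetric], rule imageI) (rule generated_algebra.const)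
    qed
  next
    case (add f g)
    then obtain f' g' where f': "f = ?pb f'" "f' \<in> generated_algebra ?U ?GU"
      and g': "g = ?pb g'" "g' \<in> generated_algebra ?U ?GU" by blast
    show ?case unfolding f'(1) g'(1)
      by (subst pb_add[symmetric]) (rule imageI[OF generated_algebra.add[OF f'(2) g'(2)]])
  next
    case (mult f g)
    then obtain f' g' where f': "f = ?pb f'" "f' \<in> generated_algebra ?U ?GU"
      and g': "g = ?pb g'" "g' \<in> generated_algebra ?U ?GU" by blast
    show ?case unfolding f'(1) g'(1)
      by (subst pb_mult[symmetric]) (rule imageI[OF generated_algebra.mult[OF f'(2) g'(2)]])
  qed
  have inj: "f = g" if f: "f \<in> generated_algebra ?U ?GU" and g: "g \<in> generated_algebra ?U ?GU"
    and eq: "?pb f = ?pb g" for f g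
  proof -
    let ?I = "{1..m} \<times> {0..<int n}"
    let ?ev = "\<lambda>Y. meval (\<lambda>c. c) (\<lambda>(r, s). Y s (s + int r) :: complex)"
    obtain p where p: "p \<in> cpolys_in ?I" "\<forall>Y\<in>?U. f Y = ?ev Y p"
      using U_functions_are_polynomials[OF n f] by blast
    obtain q where q: "q \<in> cpolys_in ?I" "\<forall>Y\<in>?U. g Y = ?ev Y q"
      using U_functions_are_polynomials[OF n g] by blast
    have "p + - q = 0"
    proof (rule loop_e_values_dense[OF n])
      show "Poly_Mapping.keys a \<subseteq> ?I" if "a \<in> Poly_Mapping.keys (p + - q)" for a
        using cpolys_in_add[OF p(1) cpolys_in_uminus[OF q(1)]] that by (simp add: cpolys_in_def)
      fix x assume x: "x \<in> ?X"
      have "f (?\<Phi> x) = g (?\<Phi> x)" using fun_cong[OF eq, of x] x by (simp add: pullback_def)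
      then have "?ev (?\<Phi> x) p = ?ev (?\<Phi> x) q" using p(2) q(2) \<Phi>[OF x] by simp
      also have "\<dots> = ?ev (?\<Phi> x) q + 0" by simp
      finally have "?ev (?\<Phi> x) ((p + - q) + q) = ?ev (?\<Phi> x) q + 0" by simp
      then have "?ev (?\<Phi> x) (p + - q) = 0" unfolding meval_add[OF ring_map_id] by simp
      then show "meval (\<lambda>c. c) (\<lambda>(r, s). loop_e m x r s) (p + - q) = 0"
        by (simp only: entry)
    qed
    then have "p = q" by simp
    show "f = g"
    proof (rule extensionalityI[of _ ?U])
      show "f Y = g Y" if "Y \<in> ?U" for Y using p(2) q(2) that \<open>p = q\<close> by simp
    qed (use f g in \<open>auto intro: generated_algebra_extensional\<close>)
  qed
  have carriers: "carrier (U_coordinate_ring n m) = generated_algebra ?U ?GU"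
    "carrier (LSym n m) = generated_algebra ?X ?GX"
    by (simp_all add: U_coordinate_ring_def LSym_def function_ring_def)
  have "?pb \<in> ring_hom (U_coordinate_ring n m) (LSym n m)"
  proof (rule ring_hom_memI)
    show "?pb f \<in> carrier (LSym n m)" if "f \<in> carrier (U_coordinate_ring n m)" for f
      using into that unfolding carriers .
  qed (simp_all add: U_coordinate_ring_def LSym_def function_ring_def pb_add pb_mult pb_const)
  moreover have "bij_betw ?pb (carrier (U_coordinate_ring n m)) (carrier (LSym n m))"
    unfolding bij_betw_def carriers
  proof
    show "inj_on ?pb (generated_algebra ?U ?GU)" by (rule inj_onI) (rule inj)
    show "?pb ` generated_algebra ?U ?GU = generated_algebra ?X ?GX"
      using into onto by blast
  qed
  ultimately show ?thesis by (simp add: ring_iso_def)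
qed

section \<open>The field of invariants and the ring of loop symmetric functions\<close>

theorem theorem4p1:
  fixes n m :: nat
  assumes "n > 1" and "m \<ge> 1"
  shows "(\<exists>act. birational_R_action n m act) \<and>
    (\<forall>act. birational_R_action n m act \<longrightarrow>
       invariant_field n m act =
         complex_adjoin {loop_e m (coord n) r s | r s. r \<in> {1..m}}) \<and>
    algebraically_independent (\<lambda>(r, s). loop_e m (coord n) r s) ({1..m} \<times> {0..<int n}) \<and>
    whirl_product m \<in> X_space n m \<rightarrow> U_le n m \<and>
    pullback (X_space n m) (whirl_product m) \<in> ring_iso (U_coordinate_ring n m) (LSym n m)"
proof (intro conjI allI impI)
  have n: "n > 0" using assms(1) by simp
  show "\<exists>act. birational_R_action n m act"
    using birational_R_action_R_action[OF n] by blast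
  show "invariant_field n m act = complex_adjoin {loop_e m (coord n) r s | r s. r \<in> {1..m}}"
    if "birational_R_action n m act" for act
    using invariant_field_eq[OF n assms(2) that] by (simp only: loop_generators_def)
  show "algebraically_independent (\<lambda>(r, s). loop_e m (coord n) r s) ({1..m} \<times> {0..<int n})"
    by (rule algebraically_independent_loop_e[OF n])
  show "whirl_product m \<in> X_space n m \<rightarrow> U_le n m"
    using whirl_product_in_U_le by blast
  show "pullback (X_space n m) (whirl_product m) \<in> ring_iso (U_coordinate_ring n m) (LSym n m)"
    by (rule pullback_whirl_product_iso[OF n])
qed

end
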